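(* Let $k$ be a field, $S=k[x_0,\dots,x_n]$ a standard graded polynomial ring, $\mathfrak p\subset S$ a homogeneous prime ideal, and $R=S/\mathfrak p$. Let $d$ be a positive integer and let $M_1,\dots,M_N$, $N=\binom{n+d}{d}$, be all the monomials of degree $d$ in $S$; for $\mathbf a=(a_1,\dots,a_N)\in k^N$ put $f_{\mathbf a}=\sum_{i=1}^N a_iM_i\in S$. Then the set $$G_2=\{(\mathbf a,\mathbf b)\in\mathbb P^{2N-1}_k:\ (f_{\mathbf a},f_{\mathbf b})\ \text{is a regular sequence in } R\}$$ is a Zariski open subset of $\mathbb P^{2N-1}_k$. Moreover, $G_2$ is non-empty if and only if $\operatorname{depth}(R)\ge 2$.
   Context: A point of $\mathbb P^{2N-1}_k$ is written as a pair $(\mathbf a,\mathbf b)$ of vectors in $k^N$, not both zero, up to simultaneous scaling by $k\setminus\{0\}$. Elements $f_{\mathbf a}$ are viewed in $R$ via their classes modulo $\mathfrak p$. $\operatorname{depth}(R)$ is the depth of $R$ with respect to its irrelevant (homogeneous) maximal ideal.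
   Formalization: The implication "depth(R) ≥ 2 implies G_2 non-empty" is stated only for infinite k, since it fails for finite fields with k-rational points (e.g. a plane quartic over F_2 through all seven points, d = 1); openness and the other implication hold for every field. *)

theory Defs
  imports
    "HOL-Algebra.QuotRing"
    "HOL-Library.Poly_Mapping"
    "HOL-Library.Extended_Nat"
    "Jordan_Normal_Form.Matrix"
begin

section \<open>Polynomial rings\<close>

type_synonym monom = "nat \<Rightarrow>\<^sub>0 nat"
type_synonym 'k mpoly = "monom \<Rightarrow>\<^sub>0 'k"

definition monom_degree :: "monom \<Rightarrow> nat" where
  "monom_degree m = (\<Sum>i\<in>Poly_Mapping.keys m. Poly_Mapping.lookup m i)"

text \<open>The ring \<open>k[x\<^sub>0, \<dots>, x\<^sub>n]\<close>: the multiplication of \<^typ>\<open>'k mpoly\<close> is the convolution product.\<close>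

definition poly_ring :: "nat \<Rightarrow> 'k::field mpoly ring" where
  "poly_ring n =
     \<lparr>carrier = {f. \<forall>m\<in>Poly_Mapping.keys f. Poly_Mapping.keys m \<subseteq> {..n}},
      monoid.mult = (*), one = 1, zero = 0, add = (+)\<rparr>"

definition var :: "nat \<Rightarrow> 'k::field mpoly" where
  "var i = Poly_Mapping.single (Poly_Mapping.single i 1) 1"

definition monomials_of_degree :: "nat \<Rightarrow> nat \<Rightarrow> monom set" where
  "monomials_of_degree n d = {m. Poly_Mapping.keys m \<subseteq> {..n} \<and> monom_degree m = d}"

definition homogeneous_component :: "nat \<Rightarrow> 'k::field mpoly \<Rightarrow> 'k mpoly" where
  "homogeneous_component e f =
     (\<Sum>m\<in>{m\<in>Poly_Mapping.keys f. monom_degree m = e}.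
        Poly_Mapping.single m (Poly_Mapping.lookup f m))"

definition homogeneous_of_degree :: "nat \<Rightarrow> 'k::field mpoly \<Rightarrow> bool" where
  "homogeneous_of_degree e f \<longleftrightarrow> (\<forall>m\<in>Poly_Mapping.keys f. monom_degree m = e)"

definition homogeneous_ideal :: "nat \<Rightarrow> 'k::field mpoly set \<Rightarrow> bool" where
  "homogeneous_ideal n I \<longleftrightarrow>
     ideal I (poly_ring n) \<and> (\<forall>f\<in>I. \<forall>e. homogeneous_component e f \<in> I)"

definition eval_mpoly :: "'k::field mpoly \<Rightarrow> 'k vec \<Rightarrow> 'k" where
  "eval_mpoly f v =
     (\<Sum>m\<in>Poly_Mapping.keys f. Poly_Mapping.lookup f m *
        (\<Prod>i\<in>Poly_Mapping.keys m. (v $ i) ^ Poly_Mapping.lookup m i))"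


section \<open>Regular sequences and depth\<close>

definition nonzerodivisor :: "('a, 'b) ring_scheme \<Rightarrow> 'a \<Rightarrow> bool" where
  "nonzerodivisor A r \<longleftrightarrow>
     r \<in> carrier A \<and> (\<forall>y\<in>carrier A. r \<otimes>\<^bsub>A\<^esub> y = \<zero>\<^bsub>A\<^esub> \<longrightarrow> y = \<zero>\<^bsub>A\<^esub>)"

definition regular_sequence :: "('a, 'b) ring_scheme \<Rightarrow> 'a list \<Rightarrow> bool" where
  "regular_sequence A rs \<longleftrightarrow>
     set rs \<subseteq> carrier A \<and>
     (\<forall>i<length rs. let J = Idl\<^bsub>A\<^esub> (set (take i rs)) in
        nonzerodivisor (A Quot J) (J +>\<^bsub>A\<^esub> (rs ! i))) \<and>
     Idl\<^bsub>A\<^esub> (set rs) \<noteq> carrier A"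

definition ring_depth :: "('a, 'b) ring_scheme \<Rightarrow> 'a set \<Rightarrow> enat" where
  "ring_depth A I = Sup {enat (length rs) | rs. set rs \<subseteq> I \<and> regular_sequence A rs}"

text \<open>The ideal of \<open>k[x\<^sub>0, \<dots>, x\<^sub>n]/P\<close> generated by the classes of the variables.\<close>

definition irrelevant_ideal :: "nat \<Rightarrow> 'k::field mpoly set \<Rightarrow> 'k mpoly set set" where
  "irrelevant_ideal n P =
     Idl\<^bsub>poly_ring n Quot P\<^esub> ((\<lambda>i. P +>\<^bsub>poly_ring n\<^esub> var i) ` {..n})"


section \<open>Projective space and its Zariski topology\<close>

text \<open>The \<open>k\<close>-rational points of projective \<open>r\<close>-space: classes of nonzero vectors of \<open>k\<^bsup>r+1\<^esup>\<close>.\<close>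

definition proj_space :: "nat \<Rightarrow> 'k::field vec set set" where
  "proj_space r =
     (carrier_vec (r + 1) - {0\<^sub>v (r + 1)}) //
       {(u, v). u \<in> carrier_vec (r + 1) - {0\<^sub>v (r + 1)} \<and> (\<exists>c. c \<noteq> 0 \<and> v = c \<cdot>\<^sub>v u)}"

definition proj_zero_locus :: "nat \<Rightarrow> 'k::field mpoly set \<Rightarrow> 'k vec set set" where
  "proj_zero_locus r F = {Q \<in> proj_space r. \<forall>f\<in>F. \<forall>v\<in>Q. eval_mpoly f v = 0}"

definition zariski_open :: "nat \<Rightarrow> 'k::field vec set set \<Rightarrow> bool" where
  "zariski_open r U \<longleftrightarrow>
     (\<exists>F. F \<subseteq> carrier (poly_ring r) \<and> (\<forall>f\<in>F. \<exists>e. homogeneous_of_degree e f) \<and>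
          U = proj_space r - proj_zero_locus r F)"


section \<open>Pairs of forms that are regular sequences\<close>

definition form_of :: "nat \<Rightarrow> (nat \<Rightarrow> monom) \<Rightarrow> 'k::field vec \<Rightarrow> 'k mpoly" where
  "form_of N M a = (\<Sum>i<N. Poly_Mapping.single (M i) (a $ i))"

text \<open>Whether \<open>(f\<^sub>a, f\<^sub>b)\<close> is regular does not change when \<open>(a, b)\<close> is scaled by a nonzero constant,
  so it does not matter which representative of a point is taken.\<close>

definition G2 :: "nat \<Rightarrow> nat \<Rightarrow> (nat \<Rightarrow> monom) \<Rightarrow> 'k::field mpoly set \<Rightarrow> 'k vec set set" where
  "G2 n N M P =
     {Q \<in> proj_space (2 * N - 1).
        \<exists>a\<in>carrier_vec N. \<exists>b\<in>carrier_vec N. a @\<^sub>v b \<in> Q \<and>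
          regular_sequence (poly_ring n Quot P)
            [P +>\<^bsub>poly_ring n\<^esub> form_of N M a, P +>\<^bsub>poly_ring n\<^esub> form_of N M b]}"

end

theory Submission
  imports Defs "Jordan_Normal_Form.Determinant" "HOL-Library.FuncSet"
    "HOL-Library.Diagonal_Subsequence"
begin

text \<open>
  Write \<open>S = k[x\<^sub>0, \<dots>, x\<^sub>n]\<close>, let \<open>P\<close> be the homogeneous prime, and for forms \<open>f\<close>, \<open>g\<close> of degree \<open>d\<close> let
  \<open>I = P + (f, g)\<close>.  Whether \<open>(f, g)\<close> is regular can be read off from the Hilbert function of \<open>I\<close>.

  Let \<open>A\<close> be a graded ideal and \<open>g\<close> a form of degree \<open>d\<close>.  Multiplication by \<open>g\<close> maps \<open>S\<close> onto
  \<open>(A + (g)) / A\<close> with kernel \<open>(A : g) \<supseteq> A\<close>.  So the dimension of \<open>A + (g)\<close> in degree \<open>e\<close> is bounded by a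
  number that only depends on the Hilbert function of \<open>A\<close>, and \<open>g\<close> is regular modulo \<open>A\<close> if and only if
  the bound is attained for every \<open>e\<close> (\<open>hilb_ideal_adjoin_eq_iff\<close>).  Used twice, this shows that
  \<open>(f, g)\<close> is regular modulo \<open>P\<close> if and only if the dimension of \<open>I\<close> in every degree \<open>e\<close> reaches a
  number \<open>H e\<close> that depends on \<open>P\<close> and \<open>d\<close> only (\<open>regular_pair_iff_hilb\<close>).

  For one fixed \<open>e\<close> this is an open condition on the coefficients of \<open>f\<close> and \<open>g\<close>, because it says that
  some minor of a matrix with constant and linear entries does not vanish (\<open>hilb_open_near\<close>).  Openness
  of \<open>G\<^sub>2\<close> thus rests on finitely many degrees being enough, for all pairs at once.  Consider the
  ideals of leading monomials of all the ideals \<open>I\<close>.  If no bound on \<open>e\<close> existed, a limit of such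
  monomial ideals could be formed, degree by degree; by Dickson's lemma the limit is generated in bounded
  degree, hence contained in a member of the sequence, whose Hilbert function would then be as large as
  that of the limit (\<open>up_closed_uniform_degree_bound\<close>).

  A point of \<open>G\<^sub>2\<close> gives a regular sequence of length two in the irrelevant ideal, so the depth is at
  least two.  For the converse, some variable \<open>x\<^sub>i\<close> is not in \<open>P\<close>; put \<open>f = x\<^sub>i\<^sup>d\<close> and \<open>A = P + (f)\<close>.  As
  the depth is at least two, the irrelevant ideal kills no nonzero element of \<open>S / A\<close>
  (\<open>saturated_adjoin\<close>).  The zero divisors modulo \<open>A\<close> among the forms of degree \<open>d\<close> lie in the maximal
  ideals of the form \<open>(A : u)\<close>, of which there are finitely many (\<open>finite_max_colons\<close>), and none of these
  contains all forms of degree \<open>d\<close>.  Over an infinite field a vector space is not a finite union of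
  proper subspaces, so some form \<open>g\<close> is regular modulo \<open>A\<close> (\<open>exists_regular_form\<close>).

  Dimensions are counted as numbers of leading exponents throughout.  This makes the vector space
  arguments elementary and connects them with monomial ideals.
\<close>

section \<open>Dimension counted by leading exponents\<close>

abbreviation coef :: "('x \<Rightarrow>\<^sub>0 'k::zero) \<Rightarrow> 'x \<Rightarrow> 'k" where
  "coef \<equiv> Poly_Mapping.lookup"

abbreviation supp :: "('x \<Rightarrow>\<^sub>0 'k::zero) \<Rightarrow> 'x set" where
  "supp \<equiv> Poly_Mapping.keys"

definition scal :: "'k::field \<Rightarrow> ('x \<Rightarrow>\<^sub>0 'k) \<Rightarrow> 'x \<Rightarrow>\<^sub>0 'k" where
  "scal c u = Poly_Mapping.map ((*) c) u"

lemma coef_scal [simp]: "coef (scal c u) x = c * coef u x"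
  unfolding scal_def by (simp add: Poly_Mapping.map.rep_eq when_def)

lemma scal_simps [simp]:
  "scal 0 u = 0" "scal 1 u = u" "scal c 0 = 0" "scal c (scal e u) = scal (c * e) u"
  "scal (- 1) u = - u"
  by (rule poly_mapping_eqI; simp)+

lemma scal_distribs:
  "scal c (u + v) = scal c u + scal c v" "scal (c + e) u = scal c u + scal e u"
  "scal c (u - v) = scal c u - scal c v" "scal (c - e) u = scal c u - scal e u"
  "scal (- c) u = - scal c u" "scal c (- u) = - scal c u"
  by (rule poly_mapping_eqI; simp add: lookup_add lookup_minus algebra_simps)+

lemma scal_sum: "scal c (sum u A) = (\<Sum>i\<in>A. scal c (u i))"
  by (rule poly_mapping_eqI) (simp add: lookup_sum sum_distrib_left)

lemma supp_scal: "supp (scal c u) \<subseteq> supp u"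
  by (auto simp: in_keys_iff)

text \<open>The set \<open>X\<close> bounds the supports.  For finite \<open>X\<close> the space is finite-dimensional, which is the
  case of interest: \<open>X\<close> will consist of the monomials of one degree.\<close>

definition lin_subspace :: "'x set \<Rightarrow> ('x \<Rightarrow>\<^sub>0 'k::field) set \<Rightarrow> bool" where
  "lin_subspace X W \<longleftrightarrow> (\<forall>w\<in>W. supp w \<subseteq> X) \<and> 0 \<in> W \<and>
     (\<forall>u\<in>W. \<forall>v\<in>W. u + v \<in> W) \<and> (\<forall>c. \<forall>u\<in>W. scal c u \<in> W)"

lemma lin_subspaceD:
  assumes "lin_subspace X W"
  shows "\<And>w. w \<in> W \<Longrightarrow> supp w \<subseteq> X" "0 \<in> W"
    "\<And>u v. u \<in> W \<Longrightarrow> v \<in> W \<Longrightarrow> u + v \<in> W" "\<And>c u. u \<in> W \<Longrightarrow> scal c u \<in> W"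
    "\<And>u. u \<in> W \<Longrightarrow> - u \<in> W"
    "\<And>u v. u \<in> W \<Longrightarrow> v \<in> W \<Longrightarrow> u - v \<in> W"
proof -
  show 1: "\<And>w. w \<in> W \<Longrightarrow> supp w \<subseteq> X" and 2: "0 \<in> W"
    and 3: "\<And>u v. u \<in> W \<Longrightarrow> v \<in> W \<Longrightarrow> u + v \<in> W" and 4: "\<And>c u. u \<in> W \<Longrightarrow> scal c u \<in> W"
    using assms by (auto simp: lin_subspace_def)
  show 5: "- u \<in> W" if "u \<in> W" for u
    using 4[OF that, of "-1"] by simp
  show "u - v \<in> W" if "u \<in> W" "v \<in> W" for u v
    using 3[OF that(1) 5[OF that(2)]] by simp
qed

text \<open>Any linear order of the exponents would serve for counting dimensions.  For monomials it is the
  lexicographic order, which is compatible with multiplication; this matters for ideals.\<close>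

definition lead :: "('x::linorder \<Rightarrow>\<^sub>0 'k::field) \<Rightarrow> 'x" where
  "lead u = Max (supp u)"

definition leads :: "('x::linorder \<Rightarrow>\<^sub>0 'k::field) set \<Rightarrow> 'x set" where
  "leads W = lead ` (W - {0})"

lemma lead_in_supp: "u \<noteq> 0 \<Longrightarrow> lead u \<in> supp u"
  unfolding lead_def by (intro Max_in) auto

lemma lead_ge: "x \<in> supp u \<Longrightarrow> x \<le> lead u"
  unfolding lead_def by (intro Max_ge) auto

lemma lead_eqI: "coef u x \<noteq> 0 \<Longrightarrow> (\<And>y. y > x \<Longrightarrow> coef u y = 0) \<Longrightarrow> lead u = x"
  unfolding lead_def by (intro Max_eqI) (auto simp: in_keys_iff not_le[symmetric])

lemma coef_gt_lead: "y > lead u \<Longrightarrow> coef u y = 0"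
  using lead_ge[of y u] leD by (auto simp: in_keys_iff)

lemma coef_lead: "u \<noteq> 0 \<Longrightarrow> coef u (lead u) \<noteq> 0"
  using lead_in_supp[of u] by (auto simp: in_keys_iff)

lemma lead_scal: "c \<noteq> 0 \<Longrightarrow> lead (scal c u) = lead u"
proof -
  assume "c \<noteq> 0"
  then have "supp (scal c u) = supp u" by (auto simp: in_keys_iff)
  then show ?thesis by (simp add: lead_def)
qed

lemma lead_add:
  assumes "lead u \<noteq> lead v" "u \<noteq> 0" "v \<noteq> 0"
  shows "lead (u + v) = max (lead u) (lead v)" "u + v \<noteq> 0"
proof -
  have *: "coef (u + v) (max (lead u) (lead v)) \<noteq> 0"
  proof (cases "lead u < lead v")
    case True
    then show ?thesis using coef_gt_lead[OF True] coef_lead[OF assms(3)] by (simp add: lookup_add max_def)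
  next
    case False
    then have "lead v < lead u" using assms by auto
    then show ?thesis using coef_gt_lead[of v "lead u"] coef_lead[OF assms(2)] by (simp add: lookup_add max_def)
  qed
  then show "u + v \<noteq> 0" by auto
  show "lead (u + v) = max (lead u) (lead v)"
    by (rule lead_eqI[OF *]) (simp add: lookup_add coef_gt_lead)
qed

lemma leads_mono: "U \<subseteq> V \<Longrightarrow> leads U \<subseteq> leads V"
  by (auto simp: leads_def)

lemma leadsE:
  assumes "t \<in> leads W"
  obtains w where "w \<in> W" "w \<noteq> 0" "t = lead w"
  using assms unfolding leads_def by blast

lemma leads_subset: "lin_subspace X W \<Longrightarrow> leads W \<subseteq> X"
  using lead_in_supp by (fastforce simp: leads_def lin_subspace_def)

lemma leads_zero [simp]: "leads {0} = {}"
  by (simp add: leads_def)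

definition adjoin :: "('x \<Rightarrow>\<^sub>0 'k::field) set \<Rightarrow> ('x \<Rightarrow>\<^sub>0 'k) \<Rightarrow> ('x \<Rightarrow>\<^sub>0 'k) set" where
  "adjoin W x = {w + scal c x | w c. w \<in> W}"

lemma lin_subspace_adjoin:
  assumes "lin_subspace X W" "supp x \<subseteq> X"
  shows "lin_subspace X (adjoin W x)"
  unfolding lin_subspace_def
proof (intro conjI ballI allI)
  note W = lin_subspaceD[OF assms(1)]
  show "supp w \<subseteq> X" if "w \<in> adjoin W x" for w
  proof -
    obtain w' c where w': "w' \<in> W" "w = w' + scal c x" using \<open>w \<in> adjoin W x\<close> by (auto simp: adjoin_def)
    have "supp w \<subseteq> supp w' \<union> supp (scal c x)" unfolding w'(2) by (rule Poly_Mapping.keys_add)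
    then show ?thesis using W(1)[OF w'(1)] supp_scal[of c x] assms(2) by blast
  qed
  show "0 \<in> adjoin W x" unfolding adjoin_def
    by (rule CollectI, rule exI[of _ 0], rule exI[of _ 0]) (use W(2) in simp)
  show "u + v \<in> adjoin W x" if uv: "u \<in> adjoin W x" "v \<in> adjoin W x" for u v
  proof -
    obtain w1 c1 where "w1 \<in> W" "u = w1 + scal c1 x"
      using uv(1) unfolding adjoin_def by blast
    moreover obtain w2 c2 where "w2 \<in> W" "v = w2 + scal c2 x"
      using uv(2) unfolding adjoin_def by blast
    ultimately have "w1 + w2 \<in> W" "u + v = (w1 + w2) + scal (c1 + c2) x"
      using W(3) by (auto simp: scal_distribs)
    then show ?thesis unfolding adjoin_def by blast
  qed
  show "scal c u \<in> adjoin W x" if u: "u \<in> adjoin W x" for c u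
  proof -
    obtain w1 c1 where "w1 \<in> W" "u = w1 + scal c1 x"
      using u by (auto simp: adjoin_def)
    then have "scal c w1 \<in> W" "scal c u = scal c w1 + scal (c * c1) x"
      using W(4) by (auto simp: scal_distribs)
    then show ?thesis unfolding adjoin_def by blast
  qed
qed

lemma adjoin_superset: "W \<subseteq> adjoin W x"
proof
  fix w assume "w \<in> W"
  then show "w \<in> adjoin W x" unfolding adjoin_def by (intro CollectI exI[of _ w] exI[of _ 0]) simp
qed

lemma adjoin_least: "lin_subspace X V \<Longrightarrow> W \<subseteq> V \<Longrightarrow> x \<in> V \<Longrightarrow> adjoin W x \<subseteq> V"
  unfolding adjoin_def lin_subspace_def by blast

text \<open>Among the vectors of \<open>x + W\<close>, one with smallest leading exponent has a leading exponent that
  no vector of \<open>W\<close> has, since otherwise a multiple of a vector of \<open>W\<close> would cancel it.  That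
  exponent is the only new one in the larger space.\<close>

lemma card_leads_adjoin:
  fixes W :: "('x::linorder \<Rightarrow>\<^sub>0 'k::field) set"
  assumes W: "lin_subspace X W" and X: "finite X" "supp x \<subseteq> X" and x: "x \<notin> W"
  shows "card (leads (adjoin W x)) = Suc (card (leads W))"
proof -
  note WD = lin_subspaceD[OF W]
  let ?L = "lead ` {x + w | w. w \<in> W}"
  have nz: "x + w \<noteq> 0" if "w \<in> W" for w
  proof
    assume "x + w = 0"
    then have "x = - w" by (simp add: add_eq_0_iff2)
    then show False using WD(5)[OF that] x by simp
  qed
  have suppX: "supp (x + w) \<subseteq> X" if "w \<in> W" for w
    using Poly_Mapping.keys_add[of x w] WD(1)[OF that] X(2) by blast
  have LX: "?L \<subseteq> X"
    using lead_in_supp[OF nz] suppX by blast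
  have finL: "finite ?L" using LX X(1) finite_subset by blast
  have "?L \<noteq> {}" using WD(2) by auto
  then have "Min ?L \<in> ?L" using finL by (intro Min_in)
  then obtain w0 where w0: "w0 \<in> W" "lead (x + w0) = Min ?L" by auto
  define y where "y = x + w0"
  have y0: "y \<noteq> 0" using nz[OF w0(1)] y_def by simp
  have min: "lead y \<le> lead (x + w)" if "w \<in> W" for w
    using Min_le[OF finL, of "lead (x + w)"] that w0(2) y_def by auto
  have new: "lead y \<notin> leads W"
  proof
    assume "lead y \<in> leads W"
    then obtain v where v: "v \<in> W" "v \<noteq> 0" "lead y = lead v"
      by (rule leadsE)
    define c where "c = coef y (lead y) / coef v (lead y)"
    have c: "coef y (lead y) = c * coef v (lead y)"
      using coef_lead[OF v(2)] unfolding c_def v(3) by simp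
    let ?w = "w0 - scal c v"
    have wW: "?w \<in> W" by (rule WD(6)[OF w0(1) WD(4)[OF v(1)]])
    have eq: "x + ?w = y - scal c v" by (simp add: y_def)
    have "coef (x + ?w) z = 0" if "z \<ge> lead y" for z
    proof (cases "z = lead y")
      case True
      then show ?thesis unfolding eq using c by (simp add: lookup_minus)
    next
      case False
      then have "z > lead y" using that by auto
      then show ?thesis unfolding eq using coef_gt_lead[of y z] coef_gt_lead[of v z] v(3) by (simp add: lookup_minus)
    qed
    moreover have "coef (x + ?w) (lead (x + ?w)) \<noteq> 0" using coef_lead[OF nz[OF wW]] .
    ultimately show False using min[OF wW] by blast
  qed
  have adj: "adjoin W x = {w + scal c y | w c. w \<in> W}"
  proof -
    have "w + scal c x = (w - scal c w0) + scal c y" "w + scal c y = (w + scal c w0) + scal c x" for w c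
      by (simp_all add: y_def scal_distribs)
    moreover have "w - scal c w0 \<in> W" "w + scal c w0 \<in> W" if "w \<in> W" for w c
      using WD(3,4,6) that w0(1) by blast+
    ultimately show ?thesis unfolding adjoin_def by blast
  qed
  have "leads (adjoin W x) = insert (lead y) (leads W)"
  proof (intro equalityI subsetI)
    fix t assume "t \<in> leads (adjoin W x)"
    then obtain w c where wc: "w \<in> W" "w + scal c y \<noteq> 0" "t = lead (w + scal c y)"
      unfolding leads_def adj by auto
    show "t \<in> insert (lead y) (leads W)"
    proof (cases "c = 0 \<or> w = 0")
      case True
      then show ?thesis
      proof
        assume "c = 0"
        then show ?thesis using wc by (auto simp: leads_def)
      next
        assume w: "w = 0"
        then have "c \<noteq> 0" using wc by auto
        then show ?thesis using wc w by (simp add: lead_scal)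
      qed
    next
      case False
      then have "lead w \<in> leads W" using wc by (auto simp: leads_def)
      then have "lead w \<noteq> lead y" using new by auto
      moreover have "scal c y \<noteq> 0"
      proof
        assume "scal c y = 0"
        then have "scal (1 / c) (scal c y) = 0" by simp
        then show False using False y0 by simp
      qed
      ultimately have "t = max (lead w) (lead y)"
        using lead_add(1)[of w "scal c y"] wc(3) False by (simp add: lead_scal)
      then show ?thesis using \<open>lead w \<in> leads W\<close> by (auto simp: max_def)
    qed
  next
    fix t assume "t \<in> insert (lead y) (leads W)"
    moreover have "y \<in> adjoin W x"
      unfolding adj using WD(2) by (intro CollectI exI[of _ 0] exI[of _ 1]) simp
    ultimately show "t \<in> leads (adjoin W x)"
      using leads_mono[OF adjoin_superset[of W x]] y0 by (auto simp: leads_def)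
  qed
  moreover have "finite (leads W)" using leads_subset[OF W] X(1) finite_subset by blast
  ultimately show ?thesis using new by simp
qed

text \<open>The number of leading exponents behaves like a dimension: a vector of \<open>V\<close> outside \<open>U\<close> would
  make it larger.\<close>

lemma subspace_eqI_leads:
  assumes "lin_subspace X U" "lin_subspace X V" "finite X" "U \<subseteq> V"
    "card (leads V) \<le> card (leads U)"
  shows "U = V"
proof (rule ccontr)
  assume "U \<noteq> V"
  then obtain x where x: "x \<in> V" "x \<notin> U" using assms(4) by blast
  have sx: "supp x \<subseteq> X" using lin_subspaceD(1)[OF assms(2) x(1)] .
  have "card (leads (adjoin U x)) = Suc (card (leads U))"
    using card_leads_adjoin[OF assms(1,3) sx x(2)] .
  moreover have "adjoin U x \<subseteq> V" using adjoin_least[OF assms(2,4) x(1)] .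
  ultimately have "Suc (card (leads U)) \<le> card (leads V)"
    using card_mono[OF finite_subset[OF leads_subset[OF assms(2)] assms(3)] leads_mono] by metis
  then show False using assms(5) by simp
qed

lemma card_leads_mono:
  assumes "lin_subspace X V" "finite X" "U \<subseteq> V"
  shows "card (leads U) \<le> card (leads V)"
  by (rule card_mono[OF finite_subset[OF leads_subset[OF assms(1)] assms(2)] leads_mono[OF assms(3)]])

text \<open>The dimension formula for the sum of a space and the image of another one.  Let a space grow
  from \<open>{v \<in> V. \<phi> v \<in> W}\<close> to \<open>V\<close>, one vector \<open>x\<close> at a time: \<open>\<phi> x\<close> is then never in the sum of \<open>W\<close>
  and the image reached so far, so both dimensions go up by one in every step.\<close>

lemma card_leads_sum_image:
  fixes \<phi> :: "('x::linorder \<Rightarrow>\<^sub>0 'k::field) \<Rightarrow> ('y::linorder \<Rightarrow>\<^sub>0 'k)"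
  assumes W: "lin_subspace Y W" and V: "lin_subspace X V" and fin: "finite X" "finite Y"
    and \<phi>: "\<And>u v. \<phi> (u + v) = \<phi> u + \<phi> v" "\<And>c u. \<phi> (scal c u) = scal c (\<phi> u)"
      "\<And>v. v \<in> V \<Longrightarrow> supp (\<phi> v) \<subseteq> Y"
  shows "card (leads {w + \<phi> v | w v. w \<in> W \<and> v \<in> V}) + card (leads {v \<in> V. \<phi> v \<in> W})
       = card (leads W) + card (leads V)"
proof -
  note WD = lin_subspaceD[OF W] and VD = lin_subspaceD[OF V]
  have \<phi>0: "\<phi> 0 = 0" using \<phi>(2)[of 0 0] by simp
  define U where "U = {v \<in> V. \<phi> v \<in> W}"
  have U: "lin_subspace X U"
    using WD VD unfolding lin_subspace_def U_def by (auto simp: \<phi> \<phi>0)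
  define S where "S V' = {w + \<phi> v | w v. w \<in> W \<and> v \<in> V'}" for V'
  have S: "lin_subspace Y (S V')" if "lin_subspace X V'" "V' \<subseteq> V" for V'
    unfolding lin_subspace_def
  proof (intro conjI ballI allI)
    note V'D = lin_subspaceD[OF that(1)]
    fix u assume "u \<in> S V'"
    then obtain w v where u: "w \<in> W" "v \<in> V'" "u = w + \<phi> v" by (auto simp: S_def)
    have "supp u \<subseteq> supp w \<union> supp (\<phi> v)" unfolding u(3) by (rule Poly_Mapping.keys_add)
    then show "supp u \<subseteq> Y" using WD(1) u \<phi>(3) that(2) by blast
    show "scal c u \<in> S V'" for c
      unfolding S_def u(3) scal_distribs \<phi>(2)[symmetric] using WD(4)[OF u(1)] V'D(4)[OF u(2)] by blast
    fix u' assume "u' \<in> S V'"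
    then obtain w' v' where u': "w' \<in> W" "v' \<in> V'" "u' = w' + \<phi> v'" by (auto simp: S_def)
    have "u + u' = (w + w') + \<phi> (v + v')" by (simp add: u u' \<phi>)
    then show "u + u' \<in> S V'"
      unfolding S_def using WD(3)[OF u(1) u'(1)] V'D(3)[OF u(2) u'(2)] by blast
  next
    show "0 \<in> S V'" unfolding S_def using WD(2) lin_subspaceD(2)[OF that(1)] \<phi>0
      by (intro CollectI exI[of _ 0]) simp
  qed
  have step: "card (leads (S V)) + card (leads V') = card (leads (S V')) + card (leads V)"
    if "lin_subspace X V'" "U \<subseteq> V'" "V' \<subseteq> V" for V'
    using that
  proof (induction "card (leads V) - card (leads V')" arbitrary: V' rule: less_induct)
    case (less V')
    note V'D = lin_subspaceD[OF less.prems(1)]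
    show ?case
    proof (cases "V' = V")
      case True
      then show ?thesis by simp
    next
      case False
      then obtain x where x: "x \<in> V" "x \<notin> V'" using less.prems(3) by blast
      let ?V = "adjoin V' x"
      have sx: "supp x \<subseteq> X" using VD(1) x(1) by blast
      have V: "lin_subspace X ?V" by (rule lin_subspace_adjoin[OF less.prems(1) sx])
      have sub: "?V \<subseteq> V" by (rule adjoin_least[OF \<open>lin_subspace X V\<close> less.prems(3) x(1)])
      have c1: "card (leads ?V) = Suc (card (leads V'))"
        by (rule card_leads_adjoin[OF less.prems(1) fin(1) sx x(2)])
      have c2: "card (leads ?V) \<le> card (leads V)"
        by (rule card_leads_mono[OF \<open>lin_subspace X V\<close> fin(1) sub])
      have nin: "\<phi> x \<notin> S V'"
      proof
        assume "\<phi> x \<in> S V'"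
        then obtain w v where wv: "w \<in> W" "v \<in> V'" "\<phi> x = w + \<phi> v" by (auto simp: S_def)
        have "\<phi> (x + scal (-1) v) = w" unfolding \<phi>(1) \<phi>(2) by (simp add: wv(3) del: scal_simps) simp
        then have "x - v \<in> U" using wv(1,2) less.prems(3) x(1) VD(6) by (auto simp: U_def)
        then have "x - v + v \<in> V'" using less.prems(2) wv(2) V'D(3) by blast
        then show False using x(2) by simp
      qed
      have eq: "S ?V = adjoin (S V') (\<phi> x)"
      proof (intro equalityI subsetI)
        fix t assume "t \<in> S ?V"
        then obtain w v c where "w \<in> W" "v \<in> V'" "t = w + \<phi> (v + scal c x)"
          by (auto simp: S_def adjoin_def)
        then have "w + \<phi> v \<in> S V'" "t = (w + \<phi> v) + scal c (\<phi> x)" by (auto simp: S_def \<phi>)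
        then show "t \<in> adjoin (S V') (\<phi> x)" unfolding adjoin_def by blast
      next
        fix t assume "t \<in> adjoin (S V') (\<phi> x)"
        then obtain w v c where "w \<in> W" "v \<in> V'" "t = w + \<phi> v + scal c (\<phi> x)"
          by (auto simp: S_def adjoin_def)
        then have "w \<in> W" "v + scal c x \<in> ?V" "t = w + \<phi> (v + scal c x)"
          by (auto simp: adjoin_def \<phi>)
        then show "t \<in> S ?V" unfolding S_def by blast
      qed
      have c3: "card (leads (S ?V)) = Suc (card (leads (S V')))"
        unfolding eq
        by (rule card_leads_adjoin[OF S[OF less.prems(1,3)] fin(2) \<phi>(3)[OF x(1)] nin])
      have "card (leads (S V)) + card (leads ?V) = card (leads (S ?V)) + card (leads V)"
        by (rule less.hyps[OF _ V _ sub]) (use c1 c2 less.prems(2) adjoin_superset[of V' x] in auto)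
      then show ?thesis using c1 c3 by simp
    qed
  qed
  have "S U = W"
  proof
    show "S U \<subseteq> W" using WD(3) by (auto simp: S_def U_def)
    show "W \<subseteq> S U"
    proof
      fix w assume "w \<in> W"
      then show "w \<in> S U" unfolding S_def using lin_subspaceD(2)[OF U] \<phi>0
        by (intro CollectI exI[of _ w] exI[of _ 0]) simp
    qed
  qed
  then show ?thesis using step[OF U order_refl] by (auto simp: S_def U_def)
qed

primrec lspan :: "(nat \<Rightarrow> 'x \<Rightarrow>\<^sub>0 'k::field) \<Rightarrow> nat \<Rightarrow> ('x \<Rightarrow>\<^sub>0 'k) set" where
  "lspan w 0 = {0}"
| "lspan w (Suc j) = adjoin (lspan w j) (w j)"

text \<open>Independence as a condition on initial segments, so that families can be built up one vector at
  a time.  Coefficients enter only through \<open>lin_indep_coeffs_zero\<close> and \<open>lin_indepI\<close>.\<close>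

definition lin_indep :: "(nat \<Rightarrow> 'x \<Rightarrow>\<^sub>0 'k::field) \<Rightarrow> nat \<Rightarrow> bool" where
  "lin_indep w r \<longleftrightarrow> (\<forall>j<r. w j \<notin> lspan w j)"

lemma lspan_iff: "x \<in> lspan w j \<longleftrightarrow> (\<exists>c. x = (\<Sum>i<j. scal (c i) (w i)))"
proof (induction j arbitrary: x)
  case (Suc j)
  show ?case
  proof
    assume "x \<in> lspan w (Suc j)"
    then obtain y e c where y: "x = y + scal e (w j)" "y = (\<Sum>i<j. scal (c i) (w i))"
      using Suc by (auto simp: adjoin_def)
    have "(\<Sum>i<j. scal (c i) (w i)) = (\<Sum>i<j. scal ((c(j := e)) i) (w i))"
      by (rule sum.cong) auto
    then show "\<exists>c. x = (\<Sum>i<Suc j. scal (c i) (w i))"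
      using y by (intro exI[of _ "c(j := e)"]) simp
  next
    assume "\<exists>c. x = (\<Sum>i<Suc j. scal (c i) (w i))"
    then show "x \<in> lspan w (Suc j)" using Suc by (auto simp: adjoin_def)
  qed
qed simp

lemma lin_subspace_lspan:
  assumes "\<And>i. i < j \<Longrightarrow> supp (w i) \<subseteq> X"
  shows "lin_subspace X (lspan w j)"
  using assms
proof (induction j)
  case 0
  then show ?case by (simp add: lin_subspace_def)
next
  case (Suc j)
  then show ?case by (simp add: lin_subspace_adjoin)
qed

lemma lspan_least:
  "lin_subspace X V \<Longrightarrow> (\<And>i. i < j \<Longrightarrow> w i \<in> V) \<Longrightarrow> lspan w j \<subseteq> V"
proof (induction j)
  case 0
  then show ?case by (simp add: lin_subspaceD(2))
next
  case (Suc j)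
  then have "lspan w j \<subseteq> V" "w j \<in> V" by auto
  then show ?case using adjoin_least[OF Suc.prems(1)] by simp
qed

lemma card_leads_lspan:
  assumes "finite X" "\<And>i. i < j \<Longrightarrow> supp (w i) \<subseteq> X" "lin_indep w j"
  shows "card (leads (lspan w j)) = j"
  using assms(2,3)
proof (induction j)
  case (Suc j)
  then have "lin_subspace X (lspan w j)" by (intro lin_subspace_lspan) auto
  then show ?case using card_leads_adjoin[OF _ assms(1), of "lspan w j" "w j"] Suc
    by (auto simp: lin_indep_def)
qed simp

lemma lin_indep_coeffs_zero:
  assumes "lin_indep w r" "(\<Sum>i<r. scal (c i) (w i)) = 0" "i < r"
  shows "c i = 0"
  using assms
proof (induction r)
  case (Suc r)
  have cr: "c r = 0"
  proof (rule ccontr)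
    assume n: "c r \<noteq> 0"
    have "scal (c r) (w r) = - (\<Sum>i<r. scal (c i) (w i))"
      using Suc.prems(2) by (simp add: add_eq_0_iff)
    then have "scal (1 / c r) (scal (c r) (w r)) = scal (1 / c r) (- (\<Sum>i<r. scal (c i) (w i)))"
      by simp
    also have "\<dots> = (\<Sum>i<r. scal (- (1 / c r) * c i) (w i))"
      unfolding scal_distribs scal_sum by (simp add: sum_negf scal_distribs)
    finally have "w r = (\<Sum>i<r. scal (- (1 / c r) * c i) (w i))" using n by simp
    then have "w r \<in> lspan w r"
      unfolding lspan_iff by (rule exI[of _ "\<lambda>i. - (1 / c r) * c i"])
    then show False using Suc.prems(1) by (auto simp: lin_indep_def)
  qed
  show ?case
  proof (cases "i = r")
    case False
    have "lin_indep w r" using Suc.prems(1) by (auto simp: lin_indep_def)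
    then show ?thesis using Suc.IH Suc.prems cr False by auto
  qed (use cr in simp)
qed simp

lemma lin_indepI:
  assumes "\<And>c. (\<Sum>i<r. scal (c i) (w i)) = 0 \<Longrightarrow> \<forall>i<r. c i = 0"
  shows "lin_indep w r"
  unfolding lin_indep_def
proof (intro allI impI notI)
  fix j assume j: "j < r" and "w j \<in> lspan w j"
  then obtain c where c: "w j = (\<Sum>i<j. scal (c i) (w i))" by (auto simp: lspan_iff)
  \<comment> \<open>the coefficients of the relation \<open>c\<^sub>0 w\<^sub>0 + \<dots> - w\<^sub>j = 0\<close>, extended by zero\<close>
  define e where "e i = (if i < j then c i else if i = j then - 1 else 0)" for i
  have "(\<Sum>i<r. scal (e i) (w i)) = (\<Sum>i<Suc j. scal (e i) (w i))"
    using j by (intro sum.mono_neutral_right) (auto simp: e_def)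
  also have "\<dots> = (\<Sum>i<j. scal (c i) (w i)) - w j"
    by (simp add: e_def)
  also have "\<dots> = 0" using c by simp
  finally have "e j = 0" using assms j by blast
  then show False by (simp add: e_def)
qed

text \<open>As long as the vectors chosen so far do not span \<open>V\<close>, some generator is outside their span.\<close>

lemma basis_from_generators:
  assumes V: "lin_subspace X V" and X: "finite X" and G: "G \<subseteq> V"
    and gen: "\<And>U. lin_subspace X U \<Longrightarrow> G \<subseteq> U \<Longrightarrow> V \<subseteq> U"
  shows "\<exists>w. (\<forall>i<card (leads V). w i \<in> G) \<and> lin_indep w (card (leads V))"
proof -
  have "\<exists>w. (\<forall>i<j. w i \<in> G) \<and> lin_indep w j" if "j \<le> card (leads V)" for j
    using that
  proof (induction j)
    case 0
    then show ?case by (simp add: lin_indep_def)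
  next
    case (Suc j)
    then obtain w where w: "\<forall>i<j. w i \<in> G" "lin_indep w j" by auto
    have s: "supp (w i) \<subseteq> X" if "i < j" for i
      using w(1) that G lin_subspaceD(1)[OF V] by blast
    have ls: "lin_subspace X (lspan w j)" by (rule lin_subspace_lspan[OF s])
    have "card (leads (lspan w j)) = j" by (rule card_leads_lspan[OF X s w(2)])
    then have "lspan w j \<noteq> V" using Suc.prems by auto
    moreover have "lspan w j \<subseteq> V" using lspan_least[OF V] w(1) G by blast
    ultimately have "\<not> G \<subseteq> lspan w j" using gen[OF ls] by blast
    then obtain x where x: "x \<in> G" "x \<notin> lspan w j" by blast
    have cong: "lspan (w(j := x)) i = lspan w i" if "i \<le> j" for i
      using that by (induction i) auto
    show ?case
      by (rule exI[of _ "w(j := x)"]) (use w x cong in \<open>auto simp: lin_indep_def less_Suc_eq simp del: fun_upd_apply; simp\<close>)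
  qed
  then show ?thesis by blast
qed

definition coef_mat :: "nat \<Rightarrow> (nat \<Rightarrow> 'x) \<Rightarrow> (nat \<Rightarrow> 'x \<Rightarrow>\<^sub>0 'k::zero) \<Rightarrow> 'k mat" where
  "coef_mat r t w = mat r r (\<lambda>(i, j). coef (w i) (t j))"

lemma coef_mat_combination:
  fixes w :: "nat \<Rightarrow> 'x \<Rightarrow>\<^sub>0 'k::field"
  assumes "v \<in> carrier_vec r" "j < r"
  shows "(transpose_mat (coef_mat r t w) *\<^sub>v v) $ j = coef (\<Sum>i<r. scal (v $ i) (w i)) (t j)"
  using assms
  by (simp add: coef_mat_def scalar_prod_def lookup_sum mult.commute atLeast0LessThan)

lemma lin_indep_if_det_nonzero:
  fixes w :: "nat \<Rightarrow> 'x \<Rightarrow>\<^sub>0 'k::field"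
  assumes "det (coef_mat r t w) \<noteq> 0"
  shows "lin_indep w r"
proof (rule lin_indepI)
  fix c assume c: "(\<Sum>i<r. scal (c i) (w i)) = 0"
  let ?A = "transpose_mat (coef_mat r t w)"
  have A: "coef_mat r t w \<in> carrier_mat r r" by (simp add: coef_mat_def)
  then have At: "?A \<in> carrier_mat r r" by simp
  have d: "det ?A \<noteq> 0" using assms det_transpose[OF A] by simp
  have "?A *\<^sub>v vec r c = 0\<^sub>v r"
  proof (rule eq_vecI)
    show "(?A *\<^sub>v vec r c) $ j = 0\<^sub>v r $ j" if "j < dim_vec (0\<^sub>v r)" for j
    proof -
      have "(\<Sum>i<r. scal (vec r c $ i) (w i)) = 0" using c by simp
      then show ?thesis using that coef_mat_combination[of "vec r c" r j t w] by simp
    qed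
  qed (simp add: coef_mat_def)
  then have "vec r c = 0\<^sub>v r"
    using det_0_iff_vec_prod_zero_field[OF At] d vec_carrier by metis
  then show "\<forall>i<r. c i = 0" by (metis index_vec index_zero_vec(1))
qed

text \<open>A nonzero vector of \<open>V\<close> has a nonzero coefficient at one of the leading exponents of \<open>V\<close>,
  namely at its own.  So these exponents serve as coordinates on \<open>V\<close>.\<close>

lemma det_leads_nonzero:
  fixes w :: "nat \<Rightarrow> 'x::linorder \<Rightarrow>\<^sub>0 'k::field"
  assumes V: "lin_subspace X V" and w: "\<And>i. i < r \<Longrightarrow> w i \<in> V" "lin_indep w r"
    and t: "leads V \<subseteq> t ` {..<r}"
  shows "det (coef_mat r t w) \<noteq> 0"
proof
  assume d: "det (coef_mat r t w) = 0"
  let ?A = "transpose_mat (coef_mat r t w)"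
  have A: "coef_mat r t w \<in> carrier_mat r r" by (simp add: coef_mat_def)
  then have At: "?A \<in> carrier_mat r r" by simp
  have "det ?A = 0" using d det_transpose[OF A] by simp
  then obtain v where v: "v \<in> carrier_vec r" "v \<noteq> 0\<^sub>v r" "?A *\<^sub>v v = 0\<^sub>v r"
    using det_0_iff_vec_prod_zero_field[OF At] by blast
  let ?x = "\<Sum>i<r. scal (v $ i) (w i)"
  have x0: "coef ?x (t j) = 0" if "j < r" for j
    using coef_mat_combination[OF v(1) that, of t w] v(3) that by simp
  have "?x \<in> lspan w r" unfolding lspan_iff by (rule exI[of _ "\<lambda>i. v $ i"]) simp
  then have xV: "?x \<in> V" using lspan_least[OF V, of r w] w(1) by blast
  have "?x = 0"
  proof (rule ccontr)
    assume n: "?x \<noteq> 0"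
    then have "lead ?x \<in> leads V" using xV by (auto simp: leads_def)
    then show False using t x0 coef_lead[OF n] by auto
  qed
  then have "\<forall>i<r. v $ i = 0" using lin_indep_coeffs_zero[OF w(2)] by blast
  then have "v = 0\<^sub>v r" using v(1) by (intro eq_vecI) auto
  then show False using v(2) by simp
qed

section \<open>The polynomial ring\<close>

abbreviation polys :: "nat \<Rightarrow> 'k::field mpoly set" where
  "polys n \<equiv> carrier (poly_ring n)"

lemma polys_iff: "f \<in> polys n \<longleftrightarrow> (\<forall>m\<in>supp f. supp m \<subseteq> {..n})"
  by (simp add: poly_ring_def)

lemma supp_add_nat: "supp (a + b :: monom) = supp a \<union> supp b"
  by (auto simp: in_keys_iff lookup_add)

lemma polys_closed [simp, intro]:
  "0 \<in> polys n" "1 \<in> polys n"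
  "f \<in> polys n \<Longrightarrow> g \<in> polys n \<Longrightarrow> f + g \<in> polys n"
  "f \<in> polys n \<Longrightarrow> g \<in> polys n \<Longrightarrow> f - g \<in> polys n"
  "f \<in> polys n \<Longrightarrow> - f \<in> polys n"
  "f \<in> polys n \<Longrightarrow> g \<in> polys n \<Longrightarrow> f * g \<in> polys n"
proof -
  show "0 \<in> polys n" "1 \<in> polys n" by (auto simp: polys_iff)
  show "f + g \<in> polys n" if "f \<in> polys n" "g \<in> polys n"
    using that Poly_Mapping.keys_add[of f g] unfolding polys_iff by blast
  have "supp (- f) = supp f" by (auto simp: in_keys_iff)
  then show "f \<in> polys n \<Longrightarrow> - f \<in> polys n" unfolding polys_iff by simp
  show "f - g \<in> polys n" if "f \<in> polys n" "g \<in> polys n"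
  proof -
    have "supp (f - g) \<subseteq> supp f \<union> supp g" by (auto simp: in_keys_iff lookup_minus)
    then show ?thesis using that unfolding polys_iff by blast
  qed
  show "f * g \<in> polys n" if fg: "f \<in> polys n" "g \<in> polys n"
    unfolding polys_iff
  proof
    fix m assume "m \<in> supp (f * g)"
    then obtain a b where "a \<in> supp f" "b \<in> supp g" "m = a + b"
      using Poly_Mapping.keys_mult[of f g] by blast
    then show "supp m \<subseteq> {..n}" using fg by (auto simp: polys_iff supp_add_nat)
  qed
qed

lemma polys_single: "supp m \<subseteq> {..n} \<Longrightarrow> Poly_Mapping.single m c \<in> polys n"
  by (auto simp: polys_iff)

lemma poly_ring_sel [simp]:
  "monoid.mult (poly_ring n) = (*)" "one (poly_ring n) = 1" "ring.zero (poly_ring n) = 0"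
  "ring.add (poly_ring n) = (+)"
  by (auto simp: poly_ring_def)

lemma cring_poly_ring: "cring (poly_ring n :: 'k::field mpoly ring)"
proof (rule cringI)
  show "abelian_group (poly_ring n :: 'k mpoly ring)"
  proof (rule abelian_groupI)
    fix x :: "'k mpoly" assume "x \<in> polys n"
    then show "\<exists>y\<in>polys n. y \<oplus>\<^bsub>poly_ring n\<^esub> x = \<zero>\<^bsub>poly_ring n\<^esub>"
      by (intro bexI[of _ "- x"]) auto
  qed (auto simp: add.assoc add.commute)
  show "comm_monoid (poly_ring n :: 'k mpoly ring)"
    by (rule comm_monoidI) (auto simp: mult.assoc mult.commute)
qed (auto simp: algebra_simps)

lemma scal_eq_mult: "scal c (f :: 'k::field mpoly) = Poly_Mapping.single 0 c * f"
  unfolding scal_def by (rule mult_map_scale_conv_mult)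

lemma scal_mult: "scal c (f * g :: 'k::field mpoly) = scal c f * g"
  by (simp add: scal_eq_mult mult.assoc)

lemma polys_scal [simp, intro]: "f \<in> polys n \<Longrightarrow> scal c f \<in> polys n"
  unfolding scal_eq_mult by (intro polys_closed polys_single) auto

section \<open>Degrees and homogeneous components\<close>

lemma monom_degree_eq:
  "finite A \<Longrightarrow> supp m \<subseteq> A \<Longrightarrow> monom_degree m = (\<Sum>i\<in>A. coef m i)"
  unfolding monom_degree_def by (rule sum.mono_neutral_left) (auto simp: in_keys_iff)

lemma monom_degree_add [simp]: "monom_degree (a + b) = monom_degree a + monom_degree b"
proof -
  let ?A = "supp a \<union> supp b"
  have "monom_degree (a + b) = (\<Sum>i\<in>?A. coef (a + b) i)"
    by (rule monom_degree_eq) (auto simp: supp_add_nat)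
  also have "\<dots> = (\<Sum>i\<in>?A. coef a i) + (\<Sum>i\<in>?A. coef b i)"
    by (simp add: lookup_add sum.distrib)
  also have "\<dots> = monom_degree a + monom_degree b"
    by (subst (1 2) monom_degree_eq[of ?A]) auto
  finally show ?thesis .
qed

lemma monom_degree_zero [simp]: "monom_degree 0 = 0"
  by (simp add: monom_degree_def)

lemma monom_degree_eq_0_iff: "monom_degree m = 0 \<longleftrightarrow> m = 0"
proof
  assume "monom_degree m = 0"
  then have "\<forall>i\<in>supp m. coef m i = 0" by (simp add: monom_degree_def)
  then show "m = 0" by (intro poly_mapping_eqI) (auto simp: in_keys_iff)
qed simp

lemma monom_degree_single [simp]: "monom_degree (Poly_Mapping.single i c) = c"
  by (simp add: monom_degree_def)

lemma coef_le_monom_degree: "coef m i \<le> monom_degree m"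
proof (cases "i \<in> supp m")
  case True
  then show ?thesis unfolding monom_degree_def by (intro member_le_sum) auto
qed (simp add: in_keys_iff)

lemma finite_monomials_of_degree: "finite (monomials_of_degree n e)"
proof (rule inj_on_finite)
  let ?F = "\<lambda>m. restrict (coef m) {..n}"
  show "inj_on ?F (monomials_of_degree n e)"
  proof (rule inj_onI, rule poly_mapping_eqI)
    fix a b i assume ab: "a \<in> monomials_of_degree n e" "b \<in> monomials_of_degree n e" "?F a = ?F b"
    show "coef a i = coef b i"
    proof (cases "i \<le> n")
      case True
      then show ?thesis using fun_cong[OF ab(3), of i] by simp
    next
      case False
      then have "i \<notin> supp a" "i \<notin> supp b" using ab(1,2) by (auto simp: monomials_of_degree_def)
      then show ?thesis by (simp add: in_keys_iff)
    qed
  qed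
  show "?F ` monomials_of_degree n e \<subseteq> (\<Pi>\<^sub>E i\<in>{..n}. {..e})"
  proof
    fix F assume "F \<in> ?F ` monomials_of_degree n e"
    then obtain m where m: "monom_degree m = e" "F = ?F m" by (auto simp: monomials_of_degree_def)
    then show "F \<in> (\<Pi>\<^sub>E i\<in>{..n}. {..e})" using coef_le_monom_degree[of m] by auto
  qed
  show "finite (\<Pi>\<^sub>E i\<in>{..n}. {..e})" by (intro finite_PiE) auto
qed

definition forms :: "nat \<Rightarrow> nat \<Rightarrow> 'k::field mpoly set" where
  "forms n e = {f. supp f \<subseteq> monomials_of_degree n e}"

lemma forms_iff: "f \<in> forms n e \<longleftrightarrow> f \<in> polys n \<and> homogeneous_of_degree e f"
  by (auto simp: forms_def polys_iff homogeneous_of_degree_def monomials_of_degree_def)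

lemma forms_polys: "f \<in> forms n e \<Longrightarrow> f \<in> polys n"
  by (simp add: forms_iff)

lemma lin_subspace_forms: "lin_subspace (monomials_of_degree n e) (forms n e)"
  unfolding lin_subspace_def forms_def
proof (intro conjI ballI allI CollectI)
  fix u v :: "'a mpoly" and c
  assume u: "u \<in> {f. supp f \<subseteq> monomials_of_degree n e}"
  then show "supp (scal c u) \<subseteq> monomials_of_degree n e" using supp_scal[of c u] by blast
  assume "v \<in> {f. supp f \<subseteq> monomials_of_degree n e}"
  then show "supp (u + v) \<subseteq> monomials_of_degree n e"
    using u Poly_Mapping.keys_add[of u v] by blast
qed auto

lemma forms_mult: "f \<in> forms n d \<Longrightarrow> g \<in> forms n e \<Longrightarrow> f * g \<in> forms n (d + e)"
  unfolding forms_def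
proof (intro CollectI subsetI)
  fix m assume f: "f \<in> {f. supp f \<subseteq> monomials_of_degree n d}"
    and g: "g \<in> {f. supp f \<subseteq> monomials_of_degree n e}" and "m \<in> supp (f * g)"
  then obtain a b where "a \<in> supp f" "b \<in> supp g" "m = a + b"
    using Poly_Mapping.keys_mult[of f g] by blast
  then show "m \<in> monomials_of_degree n (d + e)"
    using f g by (fastforce simp: monomials_of_degree_def supp_add_nat)
qed

lemma forms_single: "m \<in> monomials_of_degree n e \<Longrightarrow> Poly_Mapping.single m c \<in> forms n e"
  by (auto simp: forms_def)

lemma forms_sum: "(\<And>i. i \<in> A \<Longrightarrow> f i \<in> forms n e) \<Longrightarrow> sum f A \<in> forms n e"
  by (induction A rule: infinite_finite_induct)
    (simp_all add: lin_subspaceD(2,3)[OF lin_subspace_forms])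

lemma poly_mapping_eq_sum_single:
  "finite A \<Longrightarrow> supp f \<subseteq> A \<Longrightarrow> f = (\<Sum>m\<in>A. Poly_Mapping.single m (coef f m))"
proof (rule poly_mapping_eqI)
  fix x assume A: "finite A" "supp f \<subseteq> A"
  have "coef (\<Sum>m\<in>A. Poly_Mapping.single m (coef f m)) x = (\<Sum>m\<in>A. if m = x then coef f x else 0)"
    unfolding lookup_sum by (rule sum.cong) (auto simp: lookup_single when_def)
  also have "\<dots> = coef f x" using A by (auto simp: in_keys_iff)
  finally show "coef f x = coef (\<Sum>m\<in>A. Poly_Mapping.single m (coef f m)) x" ..
qed

lemma coef_homogeneous_component [simp]:
  "coef (homogeneous_component e f) m = (if monom_degree m = e then coef f m else 0)"
proof -
  have "coef (homogeneous_component e f) m =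
      (\<Sum>k\<in>{m \<in> supp f. monom_degree m = e}. if k = m then coef f m else 0)"
    unfolding homogeneous_component_def lookup_sum
    by (rule sum.cong) (auto simp: lookup_single when_def)
  then show ?thesis by (auto simp: in_keys_iff)
qed

lemma homogeneous_component_simps [simp]:
  "homogeneous_component e (f + g) = homogeneous_component e f + homogeneous_component e g"
  "homogeneous_component e 0 = 0"
  by (rule poly_mapping_eqI; simp add: lookup_add)+

lemma homogeneous_component_sum:
  "homogeneous_component e (sum f A) = (\<Sum>i\<in>A. homogeneous_component e (f i))"
  by (induction A rule: infinite_finite_induct) auto

lemma homogeneous_component_forms: "f \<in> polys n \<Longrightarrow> homogeneous_component e f \<in> forms n e"
  by (auto simp: forms_def polys_iff in_keys_iff monomials_of_degree_def split: if_splits)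

lemma homogeneous_component_of_form:
  "f \<in> forms n d \<Longrightarrow> homogeneous_component e f = (if e = d then f else 0)"
  by (rule poly_mapping_eqI) (auto simp: forms_def monomials_of_degree_def in_keys_iff)

lemma poly_eq_sum_components: "\<exists>D. f = (\<Sum>e\<le>D. homogeneous_component e f)"
proof -
  define D where "D = Max (insert 0 (monom_degree ` supp f))"
  have D: "monom_degree m \<le> D" if "m \<in> supp f" for m
    unfolding D_def using that by (intro Max_ge) auto
  have "f = (\<Sum>e\<le>D. homogeneous_component e f)"
  proof (rule poly_mapping_eqI)
    fix m
    have "coef (\<Sum>e\<le>D. homogeneous_component e f) m = (\<Sum>e\<le>D. if monom_degree m = e then coef f m else 0)"
      by (simp add: lookup_sum)
    also have "\<dots> = coef f m" using D[of m] by (auto simp: in_keys_iff)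
    finally show "coef f m = coef (\<Sum>e\<le>D. homogeneous_component e f) m" ..
  qed
  then show ?thesis by blast
qed

lemma homogeneous_component_mult:
  assumes f: "f \<in> polys n" and g: "g \<in> forms n d"
  shows "homogeneous_component e (f * g) =
    (if d \<le> e then homogeneous_component (e - d) f * g else 0)"
proof -
  obtain D where D: "f = (\<Sum>i\<le>D. homogeneous_component i f)"
    by (rule exE[OF poly_eq_sum_components])
  have z: "homogeneous_component i f = 0" if "i > D" for i
  proof -
    have "homogeneous_component i f = (\<Sum>j\<le>D. homogeneous_component i (homogeneous_component j f))"
      by (subst D) (simp add: homogeneous_component_sum)
    also have "\<dots> = 0"
      using that by (intro sum.neutral ballI) (simp add: homogeneous_component_of_form[OF homogeneous_component_forms[OF f]])
    finally show ?thesis .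
  qed
  have "f * g = (\<Sum>i\<le>D. homogeneous_component i f * g)"
    by (subst D) (simp add: sum_distrib_right)
  then have "homogeneous_component e (f * g) =
      (\<Sum>i\<le>D. homogeneous_component e (homogeneous_component i f * g))"
    by (simp add: homogeneous_component_sum)
  also have "\<dots> = (\<Sum>i\<le>D. if e = i + d then homogeneous_component i f * g else 0)"
    by (intro sum.cong refl)
      (rule homogeneous_component_of_form[OF forms_mult[OF homogeneous_component_forms[OF f] g]])
  also have "\<dots> = (\<Sum>i\<le>D. if d \<le> e \<and> i = e - d then homogeneous_component (e - d) f * g else 0)"
    by (intro sum.cong refl) auto
  also have "\<dots> = (if d \<le> e then homogeneous_component (e - d) f * g else 0)"
    using z[of "e - d"] by auto
  finally show ?thesis .
qed

section \<open>Graded ideals\<close>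

definition poly_ideal :: "nat \<Rightarrow> 'k::field mpoly set \<Rightarrow> bool" where
  "poly_ideal n A \<longleftrightarrow> A \<subseteq> polys n \<and> 0 \<in> A \<and> (\<forall>a\<in>A. \<forall>b\<in>A. a + b \<in> A) \<and>
     (\<forall>s\<in>polys n. \<forall>a\<in>A. s * a \<in> A)"

lemma poly_idealD:
  assumes "poly_ideal n A"
  shows "\<And>a. a \<in> A \<Longrightarrow> a \<in> polys n" "0 \<in> A" "\<And>a b. a \<in> A \<Longrightarrow> b \<in> A \<Longrightarrow> a + b \<in> A"
    "\<And>s a. s \<in> polys n \<Longrightarrow> a \<in> A \<Longrightarrow> s * a \<in> A"
    "\<And>a. a \<in> A \<Longrightarrow> - a \<in> A" "\<And>a b. a \<in> A \<Longrightarrow> b \<in> A \<Longrightarrow> a - b \<in> A"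
    "\<And>c a. a \<in> A \<Longrightarrow> scal c a \<in> A"
proof -
  show 1: "\<And>a. a \<in> A \<Longrightarrow> a \<in> polys n" "0 \<in> A" "\<And>a b. a \<in> A \<Longrightarrow> b \<in> A \<Longrightarrow> a + b \<in> A"
    "\<And>s a. s \<in> polys n \<Longrightarrow> a \<in> A \<Longrightarrow> s * a \<in> A"
    using assms by (auto simp: poly_ideal_def)
  show 2: "- a \<in> A" if "a \<in> A" for a
    using 1(4)[of "- 1" a] that by auto
  show "a - b \<in> A" if "a \<in> A" "b \<in> A" for a b
    using 1(3)[OF that(1) 2[OF that(2)]] by simp
  show "scal c a \<in> A" if "a \<in> A" for c a
    unfolding scal_eq_mult by (rule 1(4)[OF polys_single that]) simp
qed

lemma poly_ideal_sum: "poly_ideal n A \<Longrightarrow> (\<And>i. i \<in> B \<Longrightarrow> f i \<in> A) \<Longrightarrow> sum f B \<in> A"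
  by (induction B rule: infinite_finite_induct) (simp_all add: poly_idealD(2,3))

lemma ideal_iff_poly_ideal: "ideal A (poly_ring n) \<longleftrightarrow> poly_ideal n A"
proof
  assume I: "ideal A (poly_ring n)"
  then interpret ideal A "poly_ring n" .
  show "poly_ideal n A"
    unfolding poly_ideal_def
    using a_subset additive_subgroup.zero_closed[OF additive_subgroup_axioms]
      additive_subgroup.a_closed[OF additive_subgroup_axioms] I_l_closed by auto
next
  assume A: "poly_ideal n A"
  note D = poly_idealD[OF A]
  have D': "a * s \<in> A" if "s \<in> polys n" "a \<in> A" for s a
    using D(4)[OF that] by (simp add: mult.commute)
  interpret cring "poly_ring n :: 'a mpoly ring" by (rule cring_poly_ring)
  show "ideal A (poly_ring n)"
  proof (rule idealI)
    show "subgroup A (add_monoid (poly_ring n))"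
    proof (rule add.subgroupI)
      show "A \<subseteq> polys n" using D(1) by blast
      show "A \<noteq> {}" using D(2) by blast
      fix a assume a: "a \<in> A"
      have "\<ominus>\<^bsub>poly_ring n\<^esub> a = - a"
        by (rule add.inv_equality) (use D(1)[OF a] in auto)
      then show "\<ominus>\<^bsub>poly_ring n\<^esub> a \<in> A" using D(5)[OF a] by simp
    qed (use D in simp)
  qed (use D(4) D' ring_axioms in auto)
qed

definition graded_ideal :: "nat \<Rightarrow> 'k::field mpoly set \<Rightarrow> bool" where
  "graded_ideal n A \<longleftrightarrow> poly_ideal n A \<and> (\<forall>f\<in>A. \<forall>e. homogeneous_component e f \<in> A)"

lemma homogeneous_ideal_iff: "homogeneous_ideal n A \<longleftrightarrow> graded_ideal n A"
  by (simp add: homogeneous_ideal_def graded_ideal_def ideal_iff_poly_ideal)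

lemma graded_idealD:
  "graded_ideal n A \<Longrightarrow> poly_ideal n A"
  "graded_ideal n A \<Longrightarrow> f \<in> A \<Longrightarrow> homogeneous_component e f \<in> A"
  by (auto simp: graded_ideal_def)

lemma graded_ideal_memI:
  assumes "graded_ideal n A" "\<And>e. homogeneous_component e f \<in> A"
  shows "f \<in> A"
proof -
  obtain D where D: "f = (\<Sum>e\<le>D. homogeneous_component e f)" by (rule exE[OF poly_eq_sum_components])
  have "(\<Sum>e\<le>D. homogeneous_component e f) \<in> A"
    by (rule poly_ideal_sum[OF graded_idealD(1)[OF assms(1)] assms(2)])
  then show ?thesis by (subst D)
qed

definition ideal_adjoin :: "nat \<Rightarrow> 'k::field mpoly set \<Rightarrow> 'k mpoly \<Rightarrow> 'k mpoly set" where
  "ideal_adjoin n A g = {a + s * g | a s. a \<in> A \<and> s \<in> polys n}"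

definition colon :: "nat \<Rightarrow> 'k::field mpoly set \<Rightarrow> 'k mpoly \<Rightarrow> 'k mpoly set" where
  "colon n A u = {s \<in> polys n. s * u \<in> A}"

lemma poly_ideal_adjoin:
  assumes A: "poly_ideal n A" and g: "g \<in> polys n"
  shows "poly_ideal n (ideal_adjoin n A g)"
  unfolding poly_ideal_def
proof (intro conjI ballI)
  note D = poly_idealD[OF A]
  show "ideal_adjoin n A g \<subseteq> polys n" using D(1) g by (auto simp: ideal_adjoin_def)
  show "0 \<in> ideal_adjoin n A g" unfolding ideal_adjoin_def
    by (intro CollectI exI[of _ 0]) (use D(2) in simp)
  fix a assume "a \<in> ideal_adjoin n A g"
  then obtain a' s where a: "a' \<in> A" "s \<in> polys n" "a = a' + s * g" by (auto simp: ideal_adjoin_def)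
  show "r * a \<in> ideal_adjoin n A g" if "r \<in> polys n" for r
    unfolding ideal_adjoin_def
    by (intro CollectI exI[of _ "r * a'"] exI[of _ "r * s"])
      (use D(4)[OF that a(1)] a(2) that in \<open>simp add: a(3) distrib_left mult.assoc\<close>)
  fix b assume "b \<in> ideal_adjoin n A g"
  then obtain b' t where b: "b' \<in> A" "t \<in> polys n" "b = b' + t * g" by (auto simp: ideal_adjoin_def)
  show "a + b \<in> ideal_adjoin n A g"
    unfolding ideal_adjoin_def
    by (intro CollectI exI[of _ "a' + b'"] exI[of _ "s + t"])
      (use D(3)[OF a(1) b(1)] a(2) b(2) in \<open>simp add: a(3) b(3) distrib_right\<close>)
qed

lemma ideal_adjoin_superset: "A \<subseteq> ideal_adjoin n A g"
proof
  fix a assume "a \<in> A"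
  then show "a \<in> ideal_adjoin n A g"
    unfolding ideal_adjoin_def by (intro CollectI exI[of _ a] exI[of _ 0]) simp
qed

lemma ideal_adjoin_self: "poly_ideal n A \<Longrightarrow> g \<in> ideal_adjoin n A g"
  unfolding ideal_adjoin_def
  by (intro CollectI exI[of _ 0] exI[of _ 1]) (simp add: poly_idealD(2))

lemma ideal_adjoin_least:
  "poly_ideal n B \<Longrightarrow> A \<subseteq> B \<Longrightarrow> g \<in> B \<Longrightarrow> ideal_adjoin n A g \<subseteq> B"
  unfolding ideal_adjoin_def by (auto intro: poly_idealD(3,4))

lemma ideal_adjoin_absorb: "poly_ideal n A \<Longrightarrow> g \<in> A \<Longrightarrow> ideal_adjoin n A g = A"
  by (intro equalityI ideal_adjoin_least ideal_adjoin_superset order_refl)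

lemma graded_ideal_adjoin:
  assumes A: "graded_ideal n A" and g: "g \<in> forms n d"
  shows "graded_ideal n (ideal_adjoin n A g)"
  unfolding graded_ideal_def
proof (intro conjI ballI allI)
  show I: "poly_ideal n (ideal_adjoin n A g)"
    by (rule poly_ideal_adjoin[OF graded_idealD(1)[OF A] forms_polys[OF g]])
  fix f e assume "f \<in> ideal_adjoin n A g"
  then obtain a s where as: "a \<in> A" "s \<in> polys n" "f = a + s * g" by (auto simp: ideal_adjoin_def)
  have "homogeneous_component e a \<in> ideal_adjoin n A g"
    using graded_idealD(2)[OF A as(1)] ideal_adjoin_superset by blast
  moreover have "homogeneous_component e (s * g) \<in> ideal_adjoin n A g"
    unfolding homogeneous_component_mult[OF as(2) g]
    using poly_idealD(2,4)[OF I] forms_polys[OF homogeneous_component_forms[OF as(2)]]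
      ideal_adjoin_self[OF graded_idealD(1)[OF A]] by auto
  ultimately show "homogeneous_component e f \<in> ideal_adjoin n A g"
    unfolding as(3) using poly_idealD(3)[OF I] by simp
qed

lemma poly_ideal_colon: "poly_ideal n A \<Longrightarrow> u \<in> polys n \<Longrightarrow> poly_ideal n (colon n A u)"
  unfolding poly_ideal_def[of n "colon n A u"]
  by (auto simp: colon_def distrib_right mult.assoc poly_idealD)

lemma colon_superset: "poly_ideal n A \<Longrightarrow> u \<in> polys n \<Longrightarrow> A \<subseteq> colon n A u"
proof
  fix a assume "poly_ideal n A" "u \<in> polys n" "a \<in> A"
  then have "a \<in> polys n" "u * a \<in> A" by (blast intro: poly_idealD)+
  then show "a \<in> colon n A u" by (simp add: colon_def mult.commute)
qed

lemma graded_ideal_colon: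
  assumes A: "graded_ideal n A" and u: "u \<in> forms n d"
  shows "graded_ideal n (colon n A u)"
  unfolding graded_ideal_def
proof (intro conjI ballI allI)
  show "poly_ideal n (colon n A u)"
    by (rule poly_ideal_colon[OF graded_idealD(1)[OF A] forms_polys[OF u]])
  fix f e assume f: "f \<in> colon n A u"
  then have "homogeneous_component (e + d) (f * u) \<in> A"
    using graded_idealD(2)[OF A] by (auto simp: colon_def)
  then show "homogeneous_component e f \<in> colon n A u"
    using f homogeneous_component_mult[of f n u d "e + d"] u
    by (auto simp: colon_def intro: forms_polys homogeneous_component_forms)
qed

section \<open>Hilbert functions\<close>

text \<open>The dimension of \<open>A\<close> in degree \<open>e\<close>.\<close>

definition hilb :: "nat \<Rightarrow> 'k::field mpoly set \<Rightarrow> nat \<Rightarrow> nat" where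
  "hilb n A e = card (leads (A \<inter> forms n e))"

lemma lin_subspace_ideal:
  fixes A :: "'a::field mpoly set"
  shows "poly_ideal n A \<Longrightarrow> lin_subspace (monomials_of_degree n e) (A \<inter> forms n e)"
  unfolding lin_subspace_def[of _ "A \<inter> forms n e"]
  by (auto simp: lin_subspaceD(2-4)[OF lin_subspace_forms] poly_idealD(2,3,7)
      dest: subsetD[OF lin_subspaceD(1)[OF lin_subspace_forms]])

lemma hilb_mono:
  assumes "poly_ideal n B" "A \<subseteq> B" shows "hilb n A e \<le> hilb n B e"
  unfolding hilb_def
  by (rule card_leads_mono[OF lin_subspace_ideal[OF assms(1)] finite_monomials_of_degree])
    (use assms(2) in blast)

text \<open>Graded ideals can be compared degree by degree, where equal dimensions force equality.\<close>

lemma graded_ideal_eqI_hilb: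
  assumes A: "graded_ideal n A" and B: "graded_ideal n B" and "A \<subseteq> B"
    and le: "\<And>e. hilb n B e \<le> hilb n A e"
  shows "A = B"
proof
  show "B \<subseteq> A"
  proof
    fix f assume f: "f \<in> B"
    show "f \<in> A"
    proof (rule graded_ideal_memI[OF A])
      fix e
      have "A \<inter> forms n e = B \<inter> forms n e"
        by (rule subspace_eqI_leads[OF lin_subspace_ideal[OF graded_idealD(1)[OF A]]
              lin_subspace_ideal[OF graded_idealD(1)[OF B]] finite_monomials_of_degree])
          (use assms(3) le[of e] in \<open>auto simp: hilb_def\<close>)
      moreover have "homogeneous_component e f \<in> B \<inter> forms n e"
        using graded_idealD(2)[OF B f] homogeneous_component_forms
          poly_idealD(1)[OF graded_idealD(1)[OF B] f] by blast
      ultimately show "homogeneous_component e f \<in> A" by blast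
    qed
  qed
qed (rule assms(3))

lemma ideal_adjoin_Int_forms:
  assumes A: "graded_ideal n A" and g: "g \<in> forms n d"
  shows "ideal_adjoin n A g \<inter> forms n e =
    (if d \<le> e then {a + s * g | a s. a \<in> A \<inter> forms n e \<and> s \<in> forms n (e - d)} else A \<inter> forms n e)"
    (is "?L = ?R")
proof (intro equalityI subsetI)
  fix f assume f: "f \<in> ?L"
  then obtain a s where as: "a \<in> A" "s \<in> polys n" "f = a + s * g" by (auto simp: ideal_adjoin_def)
  have a: "homogeneous_component e a \<in> A \<inter> forms n e"
    using graded_idealD(2)[OF A as(1)] homogeneous_component_forms
      poly_idealD(1)[OF graded_idealD(1)[OF A] as(1)] by blast
  have s: "homogeneous_component (e - d) s \<in> forms n (e - d)"
    by (rule homogeneous_component_forms[OF as(2)])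
  have "f = homogeneous_component e (a + s * g)"
    using f as(3) homogeneous_component_of_form[of f n e e] by simp
  also have "\<dots> = homogeneous_component e a +
      (if d \<le> e then homogeneous_component (e - d) s * g else 0)"
    using homogeneous_component_mult[OF as(2) g, of e] by simp
  finally show "f \<in> ?R" using a s by auto
next
  fix f assume f: "f \<in> ?R"
  show "f \<in> ?L"
  proof (cases "d \<le> e")
    case True
    then obtain a s where as: "a \<in> A \<inter> forms n e" "s \<in> forms n (e - d)" "f = a + s * g"
      using f by auto
    have "f \<in> ideal_adjoin n A g"
      unfolding ideal_adjoin_def using as(1,3) forms_polys[OF as(2)] by blast
    moreover have "s * g \<in> forms n e" using forms_mult[OF as(2) g] True by simp
    then have "f \<in> forms n e"
      using lin_subspaceD(3)[OF lin_subspace_forms, of a n e "s * g"] as(1,3) by simp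
    ultimately show ?thesis by blast
  next
    case False
    then show ?thesis using f ideal_adjoin_superset by auto
  qed
qed

text \<open>Dimensions in degree \<open>e\<close> of the exact sequence
  \<open>0 \<rightarrow> (A : g)(-d) \<rightarrow> S(-d) \<rightarrow> (A + (g)) / A \<rightarrow> 0\<close>.\<close>

lemma hilb_ideal_adjoin:
  fixes A :: "'a::field mpoly set"
  assumes A: "graded_ideal n A" and g: "g \<in> forms n d" and "d \<le> e"
  shows "hilb n (ideal_adjoin n A g) e + hilb n (colon n A g) (e - d)
       = hilb n A e + hilb n (polys n :: 'a mpoly set) (e - d)"
proof -
  have eq1: "ideal_adjoin n A g \<inter> forms n e =
      {a + s * g | a s. a \<in> A \<inter> forms n e \<and> s \<in> forms n (e - d)}"
    using ideal_adjoin_Int_forms[OF A g, of e] assms(3) by simp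
  have mult: "s * g \<in> forms n e" if "s \<in> forms n (e - d)" for s
    using forms_mult[OF that g] assms(3) by simp
  have eq2: "colon n A g \<inter> forms n (e - d) = {s \<in> forms n (e - d). s * g \<in> A \<inter> forms n e}"
    using mult by (auto simp: colon_def forms_polys)
  have eq3: "polys n \<inter> forms n (e - d) = (forms n (e - d) :: 'a mpoly set)"
    using forms_polys by blast
  have "card (leads {w + v * g | w v. w \<in> A \<inter> forms n e \<and> v \<in> forms n (e - d)})
      + card (leads {v \<in> forms n (e - d). v * g \<in> A \<inter> forms n e})
      = card (leads (A \<inter> forms n e)) + card (leads (forms n (e - d) :: 'a mpoly set))"
  proof (rule card_leads_sum_image[where W = "A \<inter> forms n e" and V = "forms n (e - d)"
        and \<phi> = "\<lambda>v. v * g"])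
    show "lin_subspace (monomials_of_degree n e) (A \<inter> forms n e)"
      by (rule lin_subspace_ideal[OF graded_idealD(1)[OF A]])
    show "lin_subspace (monomials_of_degree n (e - d)) (forms n (e - d) :: 'a mpoly set)"
      by (rule lin_subspace_forms)
    show "supp (v * g) \<subseteq> monomials_of_degree n e" if "v \<in> forms n (e - d)" for v
      using mult[OF that] by (simp add: forms_def)
  qed (auto simp: finite_monomials_of_degree distrib_right scal_mult)
  then show ?thesis unfolding hilb_def eq1 eq2 eq3 .
qed

lemma hilb_ideal_adjoin_less:
  assumes "graded_ideal n A" "g \<in> forms n d" "e < d"
  shows "hilb n (ideal_adjoin n A g) e = hilb n A e"
  unfolding hilb_def ideal_adjoin_Int_forms[OF assms(1,2)] using assms(3) by simp

section \<open>Monomial ideals\<close>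

definition up_closed :: "nat \<Rightarrow> monom set \<Rightarrow> bool" where
  "up_closed n J \<longleftrightarrow> (\<forall>m\<in>J. supp m \<subseteq> {..n}) \<and>
     (\<forall>m\<in>J. \<forall>c. supp c \<subseteq> {..n} \<longrightarrow> c + m \<in> J)"

lemma up_closed_upward:
  assumes "up_closed n J" "m \<in> J" "supp m' \<subseteq> {..n}" "\<And>i. coef m i \<le> coef m' i"
  shows "m' \<in> J"
proof -
  have "supp (m' - m) \<subseteq> {..n}"
  proof
    fix x assume "x \<in> supp (m' - m)"
    then have "x \<in> supp m'" by (auto simp: in_keys_iff lookup_minus)
    then show "x \<in> {..n}" using assms(3) by blast
  qed
  then have "(m' - m) + m \<in> J" using assms(1,2) unfolding up_closed_def by blast
  moreover have "(m' - m) + m = m'"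
    by (rule poly_mapping_eqI) (simp add: lookup_add lookup_minus assms(4))
  ultimately show ?thesis by simp
qed

lemma nat_seq_has_mono_subseq:
  fixes s :: "nat \<Rightarrow> nat"
  shows "\<exists>r::nat \<Rightarrow> nat. strict_mono r \<and> mono (\<lambda>k. s (r k))"
proof -
  obtain f where f: "strict_mono f" "monoseq (\<lambda>k. s (f k))" using seq_monosub by blast
  show ?thesis
  proof (cases "mono (\<lambda>k. s (f k))")
    case True
    then show ?thesis using f(1) by blast
  next
    case False
    then have dec: "s (f j) \<le> s (f i)" if "i \<le> j" for i j
      using f(2) that unfolding monoseq_def mono_def by blast
    obtain N where N: "\<And>k. s (f N) \<le> s (f k)"
      using ex_has_least_nat[of "\<lambda>_. True" 0 "\<lambda>k. s (f k)"] by blast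
    have const: "s (f (N + k)) = s (f N)" for k
      using N[of "N + k"] dec[of N "N + k"] by simp
    show ?thesis
      by (rule exI[of _ "\<lambda>k. f (N + k)"]) (use f(1) const in \<open>auto simp: strict_mono_def mono_def\<close>)
  qed
qed

text \<open>Dickson's lemma: pass to subsequences along which one exponent after the other is monotone.\<close>

lemma dickson:
  fixes s :: "nat \<Rightarrow> monom"
  assumes "\<And>k. supp (s k) \<subseteq> {..n}"
  shows "\<exists>i j. i < j \<and> (\<forall>x. coef (s i) x \<le> coef (s j) x)"
proof -
  have "\<exists>r::nat \<Rightarrow> nat. strict_mono r \<and> (\<forall>x<K. mono (\<lambda>k. coef (s (r k)) x))" for K :: nat
  proof (induction K)
    case 0
    show ?case by (rule exI[of _ id]) (simp add: strict_mono_def)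
  next
    case (Suc K)
    then obtain r :: "nat \<Rightarrow> nat" where r: "strict_mono r" "\<forall>x<K. mono (\<lambda>k. coef (s (r k)) x)" by blast
    obtain q :: "nat \<Rightarrow> nat" where q: "strict_mono q" "mono (\<lambda>k. coef (s (r (q k))) K)"
      using nat_seq_has_mono_subseq[of "\<lambda>k. coef (s (r k)) K"] by blast
    have "mono (\<lambda>k. coef (s (r (q k))) x)" if "x < Suc K" for x
    proof (cases "x = K")
      case False
      then have "mono (\<lambda>k. coef (s (r k)) x)" using r(2) that by auto
      then show ?thesis using strict_mono_mono[OF q(1)] unfolding mono_def by blast
    qed (use q in simp)
    moreover have "strict_mono (\<lambda>k. r (q k))" using r(1) q(1) by (simp add: strict_mono_def)
    ultimately show ?case by (intro exI[of _ "\<lambda>k. r (q k)"]) blast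
  qed
  from this[of "Suc n"] obtain r :: "nat \<Rightarrow> nat" where r: "strict_mono r" "\<forall>x<Suc n. mono (\<lambda>k. coef (s (r k)) x)"
    by blast
  have "coef (s (r 0)) x \<le> coef (s (r 1)) x" for x
  proof (cases "x \<le> n")
    case True
    then have "mono (\<lambda>k. coef (s (r k)) x)" using r(2) by auto
    then show ?thesis by (auto simp: mono_def)
  next
    case False
    then have "x \<notin> supp (s (r 0))" using assms[of "r 0"] by auto
    then show ?thesis by (simp add: in_keys_iff)
  qed
  moreover have "r 0 < r 1" using r(1) by (simp add: strict_mono_def)
  ultimately show ?thesis by blast
qed

text \<open>Monomials \<open>s i\<close> that are new in step \<open>i\<close> would form a sequence in which none divides a later one.\<close>

lemma up_closed_ascending_stabilizes:
  assumes J: "\<And>i::nat. up_closed n (J i)" and asc: "\<And>i. J i \<subseteq> J (Suc i)"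
  shows "\<exists>i. J (Suc i) = J i"
proof (rule ccontr)
  assume "\<not> ?thesis"
  then have "\<forall>i. \<exists>m. m \<in> J (Suc i) \<and> m \<notin> J i" using asc by blast
  then obtain s where s: "\<And>i. s i \<in> J (Suc i)" "\<And>i. s i \<notin> J i" by metis
  have sn: "supp (s i) \<subseteq> {..n}" for i using J s(1) unfolding up_closed_def by blast
  obtain i j where ij: "i < j" "\<forall>x. coef (s i) x \<le> coef (s j) x" using dickson[of s n] sn by blast
  have "J (Suc i) \<subseteq> J j"
    by (rule lift_Suc_mono_le[of J, OF asc]) (use ij(1) in simp)
  then have "s i \<in> J j" using s(1) by blast
  then have "s j \<in> J j" using up_closed_upward[OF J _ sn] ij(2) by blast
  then show False using s(2) by blast
qed

text \<open>If no degree bound existed, monomials could be chosen one after the other, each without a divisor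
  in \<open>J\<close> of degree at most that of its predecessors, against Dickson's lemma.\<close>

lemma up_closed_bounded_generators:
  assumes J: "up_closed n J"
  shows "\<exists>D. \<forall>m\<in>J. \<exists>m'\<in>J. monom_degree m' \<le> D \<and> (\<forall>x. coef m' x \<le> coef m x)"
proof (rule ccontr)
  assume "\<not> ?thesis"
  then have "\<forall>D. \<exists>m. m \<in> J \<and> (\<forall>m'\<in>J. monom_degree m' \<le> D \<longrightarrow> \<not> (\<forall>x. coef m' x \<le> coef m x))"
    by blast
  then obtain g where g: "\<And>D. g D \<in> J"
    "\<And>D m'. m' \<in> J \<Longrightarrow> monom_degree m' \<le> D \<Longrightarrow> \<not> (\<forall>x. coef m' x \<le> coef (g D) x)"
    by metis
  \<comment> \<open>\<open>E k\<close> bounds the degrees of the first \<open>k\<close> monomials of the sequence \<open>g (E 0), g (E 1), \<dots>\<close>\<close>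
  define E where "E = rec_nat 0 (\<lambda>_ D. max D (monom_degree (g D)))"
  have E: "E (Suc k) = max (E k) (monom_degree (g (E k)))" for k by (simp add: E_def)
  have mono: "E i \<le> E j" if "i \<le> j" for i j
    by (rule lift_Suc_mono_le[of E, OF _ that]) (simp add: E)
  have "supp (g (E k)) \<subseteq> {..n}" for k using g(1) J unfolding up_closed_def by blast
  then obtain i j where ij: "i < j" "\<forall>x. coef (g (E i)) x \<le> coef (g (E j)) x"
    using dickson[of "\<lambda>k. g (E k)" n] by blast
  have "monom_degree (g (E i)) \<le> E (Suc i)" by (simp add: E)
  also have "\<dots> \<le> E j" using ij(1) by (intro mono) simp
  finally show False using g(2)[OF g(1)] ij(2) by blast
qed

text \<open>A uniform bound for an arbitrary family of monomial ideals.  Without a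
  bound there would be members \<open>J\<^sub>D\<close> with at least \<open>H e\<close> monomials in each degree \<open>e \<le> D\<close>, but with
  fewer in some degree.  A diagonal subsequence converges, in every degree, to an ideal \<open>L\<close> with at
  least \<open>H e\<close> monomials in every degree \<open>e\<close>.  By Dickson's lemma \<open>L\<close> is generated in bounded degree,
  so far out in the subsequence \<open>L \<subseteq> J\<^sub>D\<close>, a contradiction.\<close>

lemma up_closed_uniform_degree_bound:
  assumes up: "\<And>J. J \<in> X \<Longrightarrow> up_closed n J"
  shows "\<exists>D. \<forall>J\<in>X. (\<forall>e\<le>D. H e \<le> card (J \<inter> monomials_of_degree n e)) \<longrightarrow>
    (\<forall>e. H e \<le> card (J \<inter> monomials_of_degree n e))"
proof (rule ccontr)
  let ?M = "\<lambda>e. monomials_of_degree n e"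
  assume "\<not> ?thesis"
  then have "\<forall>D. \<exists>J. J \<in> X \<and> (\<forall>e\<le>D. H e \<le> card (J \<inter> ?M e)) \<and> (\<exists>e. card (J \<inter> ?M e) < H e)"
    by (meson not_le)
  then obtain J where J: "\<And>D. J D \<in> X" "\<And>D e. e \<le> D \<Longrightarrow> H e \<le> card (J D \<inter> ?M e)"
    "\<And>D. \<exists>e. card (J D \<inter> ?M e) < H e" by metis
  \<comment> \<open>along \<open>s\<close>, the ideals agree up to degree \<open>k\<close>; finitely many patterns exist there\<close>
  define P where "P k s \<longleftrightarrow> (\<forall>i j. J (s i) \<inter> (\<Union>e\<le>k. ?M e) = J (s j) \<inter> (\<Union>e\<le>k. ?M e))"
    for k and s :: "nat \<Rightarrow> nat"
  interpret subseqs P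
  proof
    fix k and s :: "nat \<Rightarrow> nat"
    let ?g = "\<lambda>i. J (s i) \<inter> (\<Union>e\<le>k. ?M e)"
    have "finite (range ?g)"
      by (rule finite_subset[of _ "Pow (\<Union>e\<le>k. ?M e)"]) (auto simp: finite_monomials_of_degree)
    then obtain a where a: "infinite {i \<in> UNIV. ?g i = ?g a}"
      using pigeonhole_infinite[of UNIV ?g] by auto
    then obtain r :: "nat \<Rightarrow> nat" where r: "strict_mono r" "\<forall>i. r i \<in> {i \<in> UNIV. ?g i = ?g a}"
      using infinite_enumerate[OF a] by blast
    then show "\<exists>r. strict_mono r \<and> P k (s \<circ> r)"
      unfolding P_def by (intro exI[of _ r]) auto
  qed
  define q where "q = diagseq"
  have q: "strict_mono q" unfolding q_def by (rule subseq_diagseq)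
  have diag: "P k (q \<circ> (+) (Suc k))" for k
    unfolding q_def by (rule diagseq_holds) (auto simp: P_def)
  have stable: "m \<in> J (q i) \<longleftrightarrow> m \<in> J (q j)" if "m \<in> ?M k" "k < i" "k < j" for m k i j
  proof -
    have "J (q (Suc k + (i - Suc k))) \<inter> (\<Union>e\<le>k. ?M e) = J (q (Suc k + (j - Suc k))) \<inter> (\<Union>e\<le>k. ?M e)"
      using diag[of k] unfolding P_def comp_def by blast
    then show ?thesis using that by auto
  qed
  define L where "L = {m. \<exists>i0. \<forall>i\<ge>i0. m \<in> J (q i)}"
  have L: "m \<in> L \<longleftrightarrow> m \<in> J (q i)" if "m \<in> ?M k" "k < i" for m k i
  proof
    assume "m \<in> L"
    then obtain i0 where "\<forall>i\<ge>i0. m \<in> J (q i)" by (auto simp: L_def)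
    then have "m \<in> J (q (max i0 i))" by simp
    moreover have "k < max i0 i" using that(2) by simp
    ultimately show "m \<in> J (q i)" using stable[OF that(1) _ that(2)] by blast
  next
    assume "m \<in> J (q i)"
    then have "\<forall>j\<ge>i. m \<in> J (q j)"
      using stable[OF that(1,2)] less_le_trans[OF that(2)] by blast
    then show "m \<in> L" by (auto simp: L_def)
  qed
  have upJ: "up_closed n (J i)" for i using up J(1) by blast
  have upL: "up_closed n L"
    unfolding up_closed_def
  proof (intro conjI ballI allI impI)
    fix m assume "m \<in> L"
    then obtain i0 where i0: "\<forall>i\<ge>i0. m \<in> J (q i)" by (auto simp: L_def)
    then show "supp m \<subseteq> {..n}" using upJ unfolding up_closed_def by blast
    fix c :: monom assume "supp c \<subseteq> {..n}"
    then have "\<forall>i\<ge>i0. c + m \<in> J (q i)" using i0 upJ unfolding up_closed_def by blast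
    then show "c + m \<in> L" by (auto simp: L_def)
  qed
  then obtain D where D: "\<forall>m\<in>L. \<exists>m'\<in>L. monom_degree m' \<le> D \<and> (\<forall>x. coef m' x \<le> coef m x)"
    using up_closed_bounded_generators by blast
  have sub: "L \<subseteq> J (q (Suc D))"
  proof
    fix m assume m: "m \<in> L"
    then obtain m' where m': "m' \<in> L" "monom_degree m' \<le> D" "\<forall>x. coef m' x \<le> coef m x"
      using D by blast
    have "m' \<in> ?M (monom_degree m')" "supp m \<subseteq> {..n}"
      using upL m m'(1) by (auto simp: up_closed_def monomials_of_degree_def)
    then have "m' \<in> J (q (Suc D))" using L[of m' "monom_degree m'" "Suc D"] m' by auto
    then show "m \<in> J (q (Suc D))"
      using up_closed_upward[OF upJ] \<open>supp m \<subseteq> {..n}\<close> m'(3) by blast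
  qed
  obtain e where e: "card (J (q (Suc D)) \<inter> ?M e) < H e" using J(3) by blast
  have "e \<le> q (Suc e)" using seq_suble[OF q, of "Suc e"] by simp
  then have "H e \<le> card (J (q (Suc e)) \<inter> ?M e)" by (rule J(2))
  also have "J (q (Suc e)) \<inter> ?M e = L \<inter> ?M e" using L[of _ e "Suc e"] by auto
  also have "card \<dots> \<le> card (J (q (Suc D)) \<inter> ?M e)"
    using sub by (intro card_mono) (auto simp: finite_monomials_of_degree)
  finally show False using e by simp
qed

section \<open>Leading monomials of an ideal\<close>

lemma coef_single_mult:
  fixes f :: "'k::field mpoly"
  shows "coef (Poly_Mapping.single c a * f) (c + m) = a * coef f m"
    and "(\<And>m. x \<noteq> c + m) \<Longrightarrow> coef (Poly_Mapping.single c a * f) x = 0"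
proof -
  have "Poly_Mapping.single c a * f = Poly_Mapping.single c a * (\<Sum>m\<in>supp f. Poly_Mapping.single m (coef f m))"
    by (subst poly_mapping_eq_sum_single[of "supp f" f]) auto
  also have "\<dots> = (\<Sum>m\<in>supp f. Poly_Mapping.single (c + m) (a * coef f m))"
    by (simp add: sum_distrib_left mult_single)
  finally have *: "coef (Poly_Mapping.single c a * f) x =
      (\<Sum>m'\<in>supp f. if c + m' = x then a * coef f m' else 0)" for x
    by (simp add: lookup_sum lookup_single when_def)
  show "coef (Poly_Mapping.single c a * f) (c + m) = a * coef f m"
    unfolding * by (auto simp: in_keys_iff)
  show "coef (Poly_Mapping.single c a * f) x = 0" if "\<And>m. x \<noteq> c + m" for x
    unfolding * using that by (intro sum.neutral) auto
qed

text \<open>This is where the order on monomials has to be compatible with multiplication.\<close>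

lemma lead_single_mult:
  fixes f :: "'k::field mpoly"
  assumes "a \<noteq> 0" "f \<noteq> 0"
  shows "lead (Poly_Mapping.single c a * f) = c + lead f"
proof (rule lead_eqI)
  show "coef (Poly_Mapping.single c a * f) (c + lead f) \<noteq> 0"
    using coef_lead[OF assms(2)] assms(1) by (simp add: coef_single_mult(1))
  fix y assume y: "y > c + lead f"
  show "coef (Poly_Mapping.single c a * f) y = 0"
  proof (cases "\<exists>m. y = c + m")
    case True
    then obtain m where m: "y = c + m" by blast
    then show ?thesis using y coef_gt_lead[of f m] by (simp add: coef_single_mult(1))
  next
    case False
    then show ?thesis by (intro coef_single_mult(2)) blast
  qed
qed

definition lead_monomials :: "nat \<Rightarrow> 'k::field mpoly set \<Rightarrow> monom set" where
  "lead_monomials n A = (\<Union>e. leads (A \<inter> forms n e))"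

lemma lead_monomials_Int_degree:
  assumes "poly_ideal n A"
  shows "lead_monomials n A \<inter> monomials_of_degree n e = leads (A \<inter> forms n e)"
proof -
  have sub: "leads (A \<inter> forms n d) \<subseteq> monomials_of_degree n d" for d
    by (rule leads_subset[OF lin_subspace_ideal[OF assms]])
  moreover have "monomials_of_degree n d \<inter> monomials_of_degree n e = {}" if "d \<noteq> e" for d
    using that by (auto simp: monomials_of_degree_def)
  ultimately have "leads (A \<inter> forms n d) \<inter> monomials_of_degree n e = {}" if "d \<noteq> e" for d
    using that by blast
  then have "x \<in> leads (A \<inter> forms n e)"
    if "x \<in> leads (A \<inter> forms n d)" "x \<in> monomials_of_degree n e" for x d
    using that by (cases "d = e") blast+
  then show ?thesis using sub[of e] unfolding lead_monomials_def by blast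
qed

lemma hilb_eq_card_lead_monomials:
  "poly_ideal n A \<Longrightarrow> hilb n A e = card (lead_monomials n A \<inter> monomials_of_degree n e)"
  by (simp add: lead_monomials_Int_degree hilb_def)

lemma up_closed_lead_monomials:
  assumes A: "poly_ideal n A"
  shows "up_closed n (lead_monomials n A)"
  unfolding up_closed_def
proof (intro conjI ballI allI impI)
  fix m assume "m \<in> lead_monomials n A"
  then obtain e where "m \<in> leads (A \<inter> forms n e)" by (auto simp: lead_monomials_def)
  then obtain f where f: "f \<in> A \<inter> forms n e" "f \<noteq> 0" "m = lead f" by (rule leadsE)
  show "supp m \<subseteq> {..n}"
    using lead_in_supp[OF f(2)] f(1,3) by (auto simp: forms_def monomials_of_degree_def)
  fix c :: monom assume c: "supp c \<subseteq> {..n}"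
  let ?g = "Poly_Mapping.single c 1 * f"
  have "c \<in> monomials_of_degree n (monom_degree c)" using c by (simp add: monomials_of_degree_def)
  then have "?g \<in> forms n (monom_degree c + e)"
    using forms_mult[OF forms_single] f(1) by blast
  moreover have "?g \<in> A" using poly_idealD(4)[OF A polys_single[OF c]] f(1) by blast
  moreover have "?g \<noteq> 0"
  proof
    assume "?g = 0"
    then have "coef ?g (c + lead f) = 0" by (simp only: lookup_zero)
    then show False using coef_lead[OF f(2)] coef_single_mult(1)[of c 1 f "lead f"] by simp
  qed
  moreover have "lead ?g = c + m" using lead_single_mult[of 1 f c] f(2,3) by simp
  ultimately have "c + m \<in> leads (A \<inter> forms n (monom_degree c + e))"
    unfolding leads_def by (metis (no_types, lifting) DiffI IntI imageI singletonD)
  then show "c + m \<in> lead_monomials n A" unfolding lead_monomials_def by blast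
qed

text \<open>The ascending chain condition passes from monomial ideals to graded ideals, since a graded ideal
  inside another one with the same leading monomials is equal to it.\<close>

lemma graded_ideal_ascending_stabilizes:
  assumes A: "\<And>i::nat. graded_ideal n (A i)" and asc: "\<And>i. A i \<subseteq> A (Suc i)"
  shows "\<exists>i. A (Suc i) = A i"
proof -
  have "lead_monomials n (A i) \<subseteq> lead_monomials n (A (Suc i))" for i
    unfolding lead_monomials_def by (intro UN_mono leads_mono subset_refl) (use asc[of i] in auto)
  then obtain i where i: "lead_monomials n (A (Suc i)) = lead_monomials n (A i)"
    using up_closed_ascending_stabilizes[of n "\<lambda>i. lead_monomials n (A i)"]
      up_closed_lead_monomials[OF graded_idealD(1)[OF A]] by blast
  have "A i = A (Suc i)"
    by (rule graded_ideal_eqI_hilb[OF A A asc])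
      (simp add: hilb_eq_card_lead_monomials[OF graded_idealD(1)[OF A]] i)
  then show ?thesis by metis
qed

section \<open>Regular pairs and Hilbert functions\<close>

lemma hilb_polys: "hilb n (polys n :: 'k::field mpoly set) e = card (monomials_of_degree n e)"
proof -
  have "polys n \<inter> forms n e = (forms n e :: 'k mpoly set)" using forms_polys by blast
  moreover have "leads (forms n e :: 'k mpoly set) = monomials_of_degree n e"
  proof
    show "leads (forms n e :: 'k mpoly set) \<subseteq> monomials_of_degree n e"
      by (rule leads_subset[OF lin_subspace_forms])
    show "monomials_of_degree n e \<subseteq> leads (forms n e :: 'k mpoly set)"
    proof
      fix m assume "m \<in> monomials_of_degree n e"
      then have "Poly_Mapping.single m (1::'k) \<in> forms n e - {0}"
        by (auto intro: forms_single simp: poly_mapping_eq_iff fun_eq_iff lookup_single when_def)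
      moreover have "lead (Poly_Mapping.single m (1::'k)) = m" by (simp add: lead_def)
      ultimately show "m \<in> leads (forms n e :: 'k mpoly set)" unfolding leads_def by (metis imageI)
    qed
  qed
  ultimately show ?thesis by (simp add: hilb_def)
qed

text \<open>If \<open>h\<close> is the Hilbert function of an ideal \<open>A\<close>, this is the one of \<open>A + (g)\<close> for a form \<open>g\<close> of
  degree \<open>d\<close> that is regular modulo \<open>A\<close>.\<close>

definition hilb_regular :: "nat \<Rightarrow> nat \<Rightarrow> (nat \<Rightarrow> nat) \<Rightarrow> nat \<Rightarrow> nat" where
  "hilb_regular n d h e =
     (if e < d then h e else h e + card (monomials_of_degree n (e - d)) - h (e - d))"

lemma hilb_le: "poly_ideal n A \<Longrightarrow> hilb n A e \<le> card (monomials_of_degree n e)"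
  unfolding hilb_def
  by (rule card_mono[OF finite_monomials_of_degree leads_subset[OF lin_subspace_ideal]])

lemma hilb_ideal_adjoin_le:
  assumes A: "graded_ideal n A" and g: "g \<in> forms n d"
  shows "hilb n (ideal_adjoin n A g) e \<le> hilb_regular n d (hilb n A) e"
proof (cases "e < d")
  case True
  then show ?thesis using hilb_ideal_adjoin_less[OF A g] by (simp add: hilb_regular_def)
next
  case False
  have "hilb n A (e - d) \<le> hilb n (colon n A g) (e - d)"
    using graded_idealD(1)[OF A] forms_polys[OF g]
    by (intro hilb_mono poly_ideal_colon colon_superset)
  then show ?thesis
    using hilb_ideal_adjoin[OF A g, of e] False unfolding hilb_polys by (simp add: hilb_regular_def)
qed

text \<open>The defect in degree \<open>e\<close> is the dimension of \<open>(A : g) / A\<close> in degree \<open>e - d\<close>.\<close>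

lemma hilb_ideal_adjoin_eq_iff:
  assumes A: "graded_ideal n A" and g: "g \<in> forms n d"
  shows "colon n A g = A \<longleftrightarrow> (\<forall>e. hilb_regular n d (hilb n A) e \<le> hilb n (ideal_adjoin n A g) e)"
proof
  note I = graded_idealD(1)[OF A]
  show "\<forall>e. hilb_regular n d (hilb n A) e \<le> hilb n (ideal_adjoin n A g) e" if c: "colon n A g = A"
  proof
    fix e
    show "hilb_regular n d (hilb n A) e \<le> hilb n (ideal_adjoin n A g) e"
    proof (cases "e < d")
      case True
      then show ?thesis using hilb_ideal_adjoin_less[OF A g] by (simp add: hilb_regular_def)
    next
      case False
      then show ?thesis using hilb_ideal_adjoin[OF A g, of e]
        unfolding hilb_polys c by (simp add: hilb_regular_def)
    qed
  qed
  assume le: "\<forall>e. hilb_regular n d (hilb n A) e \<le> hilb n (ideal_adjoin n A g) e"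
  have "A = colon n A g"
  proof (rule graded_ideal_eqI_hilb[OF A graded_ideal_colon[OF A g]
        colon_superset[OF I forms_polys[OF g]]])
    fix e
    have "hilb n A e \<le> card (monomials_of_degree n e)" by (rule hilb_le[OF I])
    then show "hilb n (colon n A g) e \<le> hilb n A e"
      using hilb_ideal_adjoin[OF A g, of "e + d"] le[rule_format, of "e + d"]
      unfolding hilb_polys by (simp add: hilb_regular_def)
  qed
  then show "colon n A g = A" ..
qed

text \<open>The relations that make \<open>f\<close>, \<open>g\<close> a regular sequence in \<open>S / P\<close>, pulled back to \<open>S\<close>.\<close>

definition regular_pair :: "nat \<Rightarrow> 'k::field mpoly set \<Rightarrow> 'k mpoly \<Rightarrow> 'k mpoly \<Rightarrow> bool" where
  "regular_pair n P f g \<longleftrightarrow> colon n P f = P \<and> colon n (ideal_adjoin n P f) g = ideal_adjoin n P f"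

definition prime_graded :: "nat \<Rightarrow> 'k::field mpoly set \<Rightarrow> bool" where
  "prime_graded n P \<longleftrightarrow> graded_ideal n P \<and> P \<noteq> polys n \<and>
     (\<forall>a\<in>polys n. \<forall>b\<in>polys n. a * b \<in> P \<longrightarrow> a \<in> P \<or> b \<in> P)"

lemma one_notin_ideal: "poly_ideal n A \<Longrightarrow> A \<noteq> polys n \<Longrightarrow> 1 \<notin> A"
proof
  assume A: "poly_ideal n A" "A \<noteq> polys n" and "1 \<in> A"
  then have "s \<in> A" if "s \<in> polys n" for s using poly_idealD(4)[OF A(1) that, of 1] by simp
  then show False using A poly_idealD(1)[OF A(1)] by blast
qed

lemma monomials_of_degree_0: "monomials_of_degree n 0 = {0}"
  by (auto simp: monomials_of_degree_def monom_degree_eq_0_iff)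

text \<open>A nonzero form of degree \<open>0\<close> is a unit.\<close>

lemma proper_ideal_Int_forms_0:
  assumes A: "poly_ideal n A" "A \<noteq> polys n"
  shows "A \<inter> forms n 0 \<subseteq> {0}"
proof
  fix f assume f: "f \<in> A \<inter> forms n 0"
  show "f \<in> {0}"
  proof (rule ccontr)
    assume "f \<notin> {0}"
    then have n: "f \<noteq> 0" by simp
    then have "supp f \<noteq> {}" by (simp add: poly_mapping_eq_iff fun_eq_iff)
    moreover have "supp f \<subseteq> {0}" using f by (simp add: forms_def monomials_of_degree_0)
    ultimately have s0: "supp f = {0}" by blast
    have c: "coef f 0 \<noteq> 0" by (simp add: in_keys_iff[symmetric] s0)
    have c': "coef f m = 0" if "m \<noteq> 0" for m
      using that by (simp add: not_in_keys_iff_lookup_eq_zero[symmetric] s0)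
    have "scal (1 / coef f 0) f = 1"
    proof (rule poly_mapping_eqI)
      fix m show "coef (scal (1 / coef f 0) f) m = coef 1 m"
        using c c' by (cases "m = 0") (simp_all add: lookup_one when_def)
    qed
    then have "1 \<in> A" using poly_idealD(7)[OF A(1), of f "1 / coef f 0"] f by simp
    then show False using one_notin_ideal[OF A] by simp
  qed
qed

lemma hilb_0:
  fixes A :: "'k::field mpoly set"
  assumes A: "poly_ideal n A" "A \<noteq> polys n"
  shows "hilb n A 0 = 0"
proof -
  have "leads (A \<inter> forms n 0) \<subseteq> leads {0 :: 'k mpoly}"
    by (rule leads_mono[OF proper_ideal_Int_forms_0[OF A]])
  then show ?thesis by (simp add: hilb_def)
qed

text \<open>The Hilbert function of \<open>P + (f, g)\<close> for a regular pair of forms of degree \<open>d\<close>.  It does not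
  depend on the pair.\<close>

definition hilb_regular_pair :: "nat \<Rightarrow> nat \<Rightarrow> 'k::field mpoly set \<Rightarrow> nat \<Rightarrow> nat" where
  "hilb_regular_pair n d P = hilb_regular n d (hilb_regular n d (hilb n P))"

text \<open>Regularity of \<open>(f, g)\<close> is maximality of the Hilbert function of \<open>P + (f, g)\<close>.  The inequality also
  forces \<open>f \<notin> P\<close>, by its instance in degree \<open>d\<close>: if \<open>f \<in> P\<close>, then \<open>P + (f, g)\<close> has at most one
  dimension more than \<open>P\<close> there, but two are asked for.\<close>

lemma regular_pair_iff_hilb:
  assumes P: "prime_graded n P" and f: "f \<in> forms n d" and g: "g \<in> forms n d" and d: "d > 0"
  shows "regular_pair n P f g \<longleftrightarrow>
    (\<forall>e. hilb_regular_pair n d P e \<le> hilb n (ideal_adjoin n (ideal_adjoin n P f) g) e)"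
proof -
  have G: "graded_ideal n P" and ne: "P \<noteq> polys n" using P by (auto simp: prime_graded_def)
  note I = graded_idealD(1)[OF G]
  let ?A = "ideal_adjoin n P f"
  have A: "graded_ideal n ?A" by (rule graded_ideal_adjoin[OF G f])
  show ?thesis
  proof (cases "f \<in> P")
    case True
    then have "?A = P" by (rule ideal_adjoin_absorb[OF I])
    have "colon n P f = polys n"
      using poly_idealD(4)[OF I _ True] by (auto simp: colon_def)
    then have "\<not> regular_pair n P f g" using ne by (auto simp: regular_pair_def)
    moreover have "hilb n (ideal_adjoin n ?A g) d < hilb_regular_pair n d P d"
    proof -
      have "hilb n (ideal_adjoin n ?A g) d \<le> hilb_regular n d (hilb n P) d"
        unfolding \<open>?A = P\<close> by (rule hilb_ideal_adjoin_le[OF G g])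
      then show ?thesis
        using d by (simp add: hilb_regular_pair_def hilb_regular_def monomials_of_degree_0 hilb_0[OF I ne])
    qed
    ultimately show ?thesis by (meson not_le)
  next
    case False
    then have c: "colon n P f = P"
      using P forms_polys[OF f] colon_superset[OF I forms_polys[OF f]]
      by (auto simp: colon_def prime_graded_def)
    have "hilb_regular n d (hilb n P) e = hilb n ?A e" for e
      using hilb_ideal_adjoin_eq_iff[OF G f] hilb_ideal_adjoin_le[OF G f, of e] c
      by (auto intro: le_antisym)
    then have "hilb_regular_pair n d P = hilb_regular n d (hilb n ?A)"
      unfolding hilb_regular_pair_def by (intro arg_cong[of _ _ "hilb_regular n d"] ext)
    then show ?thesis
      unfolding regular_pair_def using c hilb_ideal_adjoin_eq_iff[OF A g] by simp
  qed
qed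

text \<open>One bound for all pairs: the numbers \<open>H e\<close> do not depend on the pair, so the uniform bound applies
  to the family of the leading monomial ideals of all \<open>P + (f, g)\<close>.\<close>

lemma regular_pair_uniform_degree_bound:
  fixes P :: "'k::field mpoly set"
  assumes P: "prime_graded n P" and d: "d > 0"
  shows "\<exists>D. \<forall>f\<in>forms n d. \<forall>g\<in>forms n d. regular_pair n P f g \<longleftrightarrow>
    (\<forall>e\<le>D. hilb_regular_pair n d P e \<le> hilb n (ideal_adjoin n (ideal_adjoin n P f) g) e)"
proof -
  let ?I = "\<lambda>f g. ideal_adjoin n (ideal_adjoin n P f) g"
  define X where "X = {lead_monomials n (?I f g) | f g. f \<in> forms n d \<and> g \<in> forms n d}"
  have G: "graded_ideal n P" using P by (simp add: prime_graded_def)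
  have I: "poly_ideal n (?I f g)" if "f \<in> forms n d" "g \<in> forms n d" for f g :: "'k mpoly"
    by (rule graded_idealD(1)[OF graded_ideal_adjoin[OF graded_ideal_adjoin[OF G that(1)] that(2)]])
  have "up_closed n J" if "J \<in> X" for J
    using that up_closed_lead_monomials[OF I] by (auto simp: X_def)
  then obtain D where D: "\<And>J. J \<in> X \<Longrightarrow>
      (\<forall>e\<le>D. hilb_regular_pair n d P e \<le> card (J \<inter> monomials_of_degree n e)) \<Longrightarrow>
      (\<forall>e. hilb_regular_pair n d P e \<le> card (J \<inter> monomials_of_degree n e))"
    using up_closed_uniform_degree_bound[of X n "hilb_regular_pair n d P"] by blast
  show ?thesis
  proof (intro exI[of _ D] ballI)
    fix f g :: "'k mpoly" assume fg: "f \<in> forms n d" "g \<in> forms n d"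
    then have "lead_monomials n (?I f g) \<in> X" by (auto simp: X_def)
    from D[OF this] show "regular_pair n P f g \<longleftrightarrow>
        (\<forall>e\<le>D. hilb_regular_pair n d P e \<le> hilb n (?I f g) e)"
      unfolding regular_pair_iff_hilb[OF P fg d] hilb_eq_card_lead_monomials[OF I[OF fg]] by blast
  qed
qed

section \<open>Polynomial functions of the coefficients\<close>

definition eval_monom :: "monom \<Rightarrow> 'k::field vec \<Rightarrow> 'k" where
  "eval_monom m v = (\<Prod>i\<in>supp m. (v $ i) ^ coef m i)"

lemma eval_monom_eq:
  "finite A \<Longrightarrow> supp m \<subseteq> A \<Longrightarrow> eval_monom m v = (\<Prod>i\<in>A. (v $ i) ^ coef m i)"
  unfolding eval_monom_def by (rule prod.mono_neutral_left) (auto simp: in_keys_iff)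

lemma eval_monom_add: "eval_monom (a + b) v = eval_monom a v * eval_monom b v"
proof -
  let ?A = "supp a \<union> supp b"
  have "eval_monom (a + b) v = (\<Prod>i\<in>?A. (v $ i) ^ coef (a + b) i)"
    by (rule eval_monom_eq) (auto simp: supp_add_nat)
  also have "\<dots> = (\<Prod>i\<in>?A. (v $ i) ^ coef a i) * (\<Prod>i\<in>?A. (v $ i) ^ coef b i)"
    by (simp add: lookup_add power_add prod.distrib)
  also have "\<dots> = eval_monom a v * eval_monom b v"
    by (subst (1 2) eval_monom_eq[of ?A]) auto
  finally show ?thesis .
qed

lemma eval_mpoly_eq:
  assumes "finite A" "supp f \<subseteq> A"
  shows "eval_mpoly f v = (\<Sum>m\<in>A. coef f m * eval_monom m v)"
proof -
  have "eval_mpoly f v = (\<Sum>m\<in>supp f. coef f m * eval_monom m v)"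
    by (simp add: eval_mpoly_def eval_monom_def)
  also have "\<dots> = (\<Sum>m\<in>A. coef f m * eval_monom m v)"
    using assms by (intro sum.mono_neutral_left) (auto simp: in_keys_iff)
  finally show ?thesis .
qed

lemma eval_mpoly_single [simp]: "eval_mpoly (Poly_Mapping.single m c) v = c * eval_monom m v"
  by (subst eval_mpoly_eq[of "{m}"]) auto

lemma eval_mpoly_add [simp]: "eval_mpoly (f + g) v = eval_mpoly f v + eval_mpoly g v"
proof -
  let ?A = "supp f \<union> supp g"
  have "supp (f + g) \<subseteq> ?A" by (rule Poly_Mapping.keys_add)
  then have "eval_mpoly (f + g) v = (\<Sum>m\<in>?A. coef (f + g) m * eval_monom m v)"
    by (intro eval_mpoly_eq) auto
  also have "\<dots> = (\<Sum>m\<in>?A. coef f m * eval_monom m v) + (\<Sum>m\<in>?A. coef g m * eval_monom m v)"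
    by (simp add: lookup_add distrib_right sum.distrib)
  also have "\<dots> = eval_mpoly f v + eval_mpoly g v"
    by (subst (1 2) eval_mpoly_eq[of ?A]) auto
  finally show ?thesis .
qed

lemma eval_mpoly_zero [simp]: "eval_mpoly 0 v = 0"
  by (simp add: eval_mpoly_def)

lemma eval_mpoly_sum: "eval_mpoly (sum f A) v = (\<Sum>i\<in>A. eval_mpoly (f i) v)"
  by (induction A rule: infinite_finite_induct) auto

lemma eval_mpoly_mult [simp]:
  fixes f g :: "'k::field mpoly"
  shows "eval_mpoly (f * g) v = eval_mpoly f v * eval_mpoly g v"
proof -
  have fg: "f * g = (\<Sum>a\<in>supp f. Poly_Mapping.single a (coef f a)) *
      (\<Sum>b\<in>supp g. Poly_Mapping.single b (coef g b))"
    by (rule arg_cong2[of _ _ _ _ "(*)"]; rule poly_mapping_eq_sum_single) auto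
  show ?thesis
    unfolding fg sum_product mult_single eval_mpoly_sum eval_mpoly_single eval_monom_add
    by (subst (1 2) eval_mpoly_eq[OF finite_keys order_refl])
      (simp add: sum_product mult.assoc mult.left_commute)
qed

lemma eval_mpoly_one [simp]: "eval_mpoly 1 v = 1"
proof -
  have "(1 :: 'a mpoly) = Poly_Mapping.single 0 1" by simp
  then have "eval_mpoly 1 v = eval_mpoly (Poly_Mapping.single 0 1) v" by (simp only:)
  then show ?thesis by (simp add: eval_monom_def del: single_one)
qed

lemma comm_ring_hom_eval_mpoly: "comm_ring_hom (\<lambda>f :: 'k::field mpoly. eval_mpoly f v)"
  by unfold_locales auto

lemma forms_prod:
  "(\<And>i. i \<in> A \<Longrightarrow> f i \<in> forms n (d i)) \<Longrightarrow> prod f A \<in> forms n (sum d A)"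
proof (induction A rule: infinite_finite_induct)
  case (insert x A)
  then show ?case using forms_mult[of "f x" n "d x" "prod f A" "sum d A"] by simp
qed (auto simp: forms_def monomials_of_degree_0)

text \<open>A polynomial that depends on a point, its coefficients being forms of degree \<open>\<delta>\<close> in the
  coordinates of the point.\<close>

definition form_family :: "nat \<Rightarrow> nat \<Rightarrow> ('k::field vec \<Rightarrow> 'k mpoly) \<Rightarrow> bool" where
  "form_family r \<delta> w \<longleftrightarrow> (\<forall>t. \<exists>h\<in>forms r \<delta>. \<forall>v. eval_mpoly h v = coef (w v) t)"

text \<open>Each term of the determinant has one factor from every row, so the degrees of the rows add up.\<close>

lemma form_family_det:
  fixes w :: "nat \<Rightarrow> 'k::field vec \<Rightarrow> 'k mpoly"
  assumes "\<And>i. i < k \<Longrightarrow> form_family r (\<delta> i) (w i)"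
  shows "\<exists>h\<in>forms r (\<Sum>i<k. \<delta> i). \<forall>v. eval_mpoly h v = det (coef_mat k t (\<lambda>i. w i v))"
proof -
  have "\<forall>i. \<forall>m. \<exists>h. i < k \<longrightarrow> h \<in> forms r (\<delta> i) \<and> (\<forall>v. eval_mpoly h v = coef (w i v) m)"
    using assms unfolding form_family_def by blast
  then obtain h where h: "\<And>i m. i < k \<Longrightarrow> h i m \<in> forms r (\<delta> i)"
    "\<And>i m v. i < k \<Longrightarrow> eval_mpoly (h i m) v = coef (w i v) m" by metis
  define B where "B = mat k k (\<lambda>(i, j). h i (t j))"
  have B: "B \<in> carrier_mat k k" by (simp add: B_def)
  have "det B \<in> forms r (\<Sum>i<k. \<delta> i)"
    unfolding det_def'[OF B]
  proof (rule forms_sum)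
    fix p assume "p \<in> {p. p permutes {0..<k}}"
    then have p: "p i < k" if "i < k" for i using that permutes_in_image[of p "{0..<k}" i] by auto
    have pr: "(\<Prod>i = 0..<k. B $$ (i, p i)) \<in> forms r (\<Sum>i<k. \<delta> i)"
      unfolding lessThan_atLeast0
      by (rule forms_prod) (use p h(1) in \<open>auto simp: B_def\<close>)
    then show "signof p * (\<Prod>i = 0..<k. B $$ (i, p i)) \<in> forms r (\<Sum>i<k. \<delta> i)"
      using lin_subspaceD(5)[OF lin_subspace_forms pr] by (auto simp: sign_def)
  qed
  moreover have "eval_mpoly (det B) v = det (coef_mat k t (\<lambda>i. w i v))" for v
  proof -
    interpret comm_ring_hom "\<lambda>f :: 'k mpoly. eval_mpoly f v" by (rule comm_ring_hom_eval_mpoly)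
    have "map_mat (\<lambda>f. eval_mpoly f v) B = coef_mat k t (\<lambda>i. w i v)"
      by (rule eq_matI) (use h(2) in \<open>auto simp: B_def coef_mat_def\<close>)
    then show ?thesis by (metis hom_det)
  qed
  ultimately show ?thesis by blast
qed

section \<open>Open conditions\<close>

text \<open>The point \<open>v0\<close> has a basic open neighbourhood, given by one form \<open>h\<close>, on which \<open>Z\<close> holds.\<close>

definition open_near :: "nat \<Rightarrow> ('k::field vec \<Rightarrow> bool) \<Rightarrow> 'k vec \<Rightarrow> bool" where
  "open_near r Z v0 \<longleftrightarrow> (\<exists>e. \<exists>h\<in>forms r e. eval_mpoly h v0 \<noteq> 0 \<and>
     (\<forall>v\<in>carrier_vec (r + 1). eval_mpoly h v \<noteq> 0 \<longrightarrow> Z v))"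

lemma open_near_bounded_all:
  fixes D :: nat
  assumes "\<And>e. e < D \<Longrightarrow> open_near r (Z e) v0"
  shows "open_near r (\<lambda>v. \<forall>e<D. Z e v) v0"
  using assms
proof (induction D)
  case 0
  have "(1 :: 'a mpoly) \<in> forms r 0" by (auto simp: forms_def monomials_of_degree_0)
  then show ?case unfolding open_near_def by (intro exI[of _ 0] bexI[of _ 1]) auto
next
  case (Suc D)
  then have "open_near r (\<lambda>v. \<forall>e<D. Z e v) v0" "open_near r (Z D) v0" by auto
  then obtain e1 h1 e2 h2 where h: "h1 \<in> forms r e1" "eval_mpoly h1 v0 \<noteq> 0"
    "\<And>v. v \<in> carrier_vec (r + 1) \<Longrightarrow> eval_mpoly h1 v \<noteq> 0 \<Longrightarrow> \<forall>e<D. Z e v"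
    "h2 \<in> forms r e2" "eval_mpoly h2 v0 \<noteq> 0"
    "\<And>v. v \<in> carrier_vec (r + 1) \<Longrightarrow> eval_mpoly h2 v \<noteq> 0 \<Longrightarrow> Z D v"
    unfolding open_near_def by blast
  show ?case
    unfolding open_near_def
    by (intro exI[of _ "e1 + e2"] bexI[of _ "h1 * h2"] forms_mult h)
      (use h in \<open>auto simp: less_Suc_eq\<close>)
qed

text \<open>The complement is cut out by all forms that vanish wherever \<open>Z\<close> fails.\<close>

lemma zariski_openI:
  fixes U :: "'k::field vec set set"
  assumes U: "U = {Q \<in> proj_space r. \<exists>v\<in>Q. Z v}"
    and op: "\<And>v. v \<in> carrier_vec (r + 1) \<Longrightarrow> Z v \<Longrightarrow> open_near r Z v"
  shows "zariski_open r U"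
proof -
  define F where "F = {f :: 'k mpoly. (\<exists>e. f \<in> forms r e) \<and>
      (\<forall>v\<in>carrier_vec (r + 1). \<not> Z v \<longrightarrow> eval_mpoly f v = 0)}"
  have Qc: "v \<in> carrier_vec (r + 1)" if "Q \<in> proj_space r" "v \<in> Q" for Q and v :: "'k vec"
    using that unfolding proj_space_def quotient_def by auto
  have "U = proj_space r - proj_zero_locus r F"
  proof (intro equalityI subsetI)
    fix Q assume "Q \<in> U"
    then obtain v where Q: "Q \<in> proj_space r" "v \<in> Q" "Z v" using U by blast
    obtain e h where h: "h \<in> forms r e" "eval_mpoly h v \<noteq> 0"
      "\<And>v. v \<in> carrier_vec (r + 1) \<Longrightarrow> eval_mpoly h v \<noteq> 0 \<Longrightarrow> Z v"
      using op[OF Qc[OF Q(1,2)] Q(3)] unfolding open_near_def by blast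
    then have "h \<in> F" unfolding F_def by blast
    then show "Q \<in> proj_space r - proj_zero_locus r F"
      using Q h(2) unfolding proj_zero_locus_def by blast
  next
    fix Q assume Q: "Q \<in> proj_space r - proj_zero_locus r F"
    then obtain f v where fv: "f \<in> F" "v \<in> Q" "eval_mpoly f v \<noteq> 0"
      unfolding proj_zero_locus_def by blast
    then have "Z v" using Qc Q unfolding F_def by blast
    then show "Q \<in> U" using U Q fv(2) by blast
  qed
  moreover have "F \<subseteq> carrier (poly_ring r)" "\<forall>f\<in>F. \<exists>e. homogeneous_of_degree e f"
    by (auto simp: F_def forms_iff)
  ultimately show ?thesis unfolding zariski_open_def by blast
qed

section \<open>The pair of forms with given coefficients\<close>

text \<open>A point of the parameter space is one vector of length \<open>2 N\<close>; the offset \<open>s\<close> (\<open>0\<close> or \<open>N\<close>) selects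
  the half with the coefficients.\<close>

definition form_at :: "nat \<Rightarrow> nat \<Rightarrow> (nat \<Rightarrow> monom) \<Rightarrow> 'k::field vec \<Rightarrow> 'k mpoly" where
  "form_at s N M v = (\<Sum>i<N. Poly_Mapping.single (M i) (v $ (s + i)))"

lemma form_at_forms:
  assumes "\<And>i. i < N \<Longrightarrow> M i \<in> monomials_of_degree n d"
  shows "form_at s N M v \<in> forms n d"
  unfolding form_at_def by (rule forms_sum) (use assms in \<open>auto intro: forms_single\<close>)

lemma form_family_form_at:
  assumes "s + N \<le> Suc r"
  shows "form_family r 1 (\<lambda>v :: 'k::field vec. Poly_Mapping.single c 1 * form_at s N M v)"
  unfolding form_family_def
proof
  fix t
  define I where "I = {i \<in> {..<N}. c + M i = t}"
  let ?h = "\<Sum>i\<in>I. Poly_Mapping.single (Poly_Mapping.single (s + i) 1) (1::'k)"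
  have "?h \<in> forms r 1"
    using assms by (intro forms_sum forms_single) (auto simp: I_def monomials_of_degree_def)
  moreover have "eval_mpoly ?h v = coef (Poly_Mapping.single c 1 * form_at s N M v) t" for v :: "'k vec"
  proof -
    have "Poly_Mapping.single c 1 * form_at s N M v =
        (\<Sum>i<N. Poly_Mapping.single (c + M i) (v $ (s + i)))"
      by (simp add: form_at_def sum_distrib_left mult_single)
    then have "coef (Poly_Mapping.single c 1 * form_at s N M v) t =
        (\<Sum>i<N. if c + M i = t then v $ (s + i) else 0)"
      by (simp add: lookup_sum lookup_single when_def)
    also have "\<dots> = (\<Sum>i\<in>I. v $ (s + i))"
      unfolding I_def by (rule sum.inter_filter[symmetric]) simp
    finally show ?thesis by (simp add: eval_mpoly_sum eval_monom_def)
  qed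
  ultimately show "\<exists>h\<in>forms r 1. \<forall>v :: 'k vec. eval_mpoly h v =
      coef (Poly_Mapping.single c 1 * form_at s N M v) t"
    by (intro bexI[of _ ?h] allI)
qed

lemma form_family_const: "form_family r 0 (\<lambda>v. p)"
  unfolding form_family_def
proof
  fix t
  show "\<exists>h\<in>forms r 0. \<forall>v. eval_mpoly h v = coef p t"
    by (rule bexI[of _ "Poly_Mapping.single 0 (coef p t)"])
      (auto simp: eval_monom_def monomials_of_degree_0 intro!: forms_single simp del: single_zero)
qed

text \<open>In each degree, a large Hilbert function is an open condition: choose a basis of \<open>P + (f, g)\<close> in
  degree \<open>e\<close> among the elements of \<open>P\<close> and the products of \<open>f\<close> and \<open>g\<close> with monomials.  When \<open>f\<close> and
  \<open>g\<close> vary, these stay independent as long as a certain minor does not vanish.  A row of that minor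
  is constant or linear in the coefficients of \<open>f\<close> and \<open>g\<close>, so the minor is a form in them.\<close>

lemma hilb_open_near:
  fixes P :: "'k::field mpoly set"
  assumes P: "graded_ideal n P" and M: "\<And>i. i < N \<Longrightarrow> M i \<in> monomials_of_degree n d"
    and N: "2 * N \<le> Suc r"
    and H: "H \<le> hilb n (ideal_adjoin n (ideal_adjoin n P (form_at 0 N M v0)) (form_at N N M v0)) e"
  shows "open_near r (\<lambda>v. H \<le>
    hilb n (ideal_adjoin n (ideal_adjoin n P (form_at 0 N M v)) (form_at N N M v)) e) v0"
proof -
  let ?f = "form_at 0 N M :: 'k vec \<Rightarrow> 'k mpoly" and ?g = "form_at N N M :: 'k vec \<Rightarrow> 'k mpoly"
  let ?A = "\<lambda>v. ideal_adjoin n P (?f v)"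
  let ?I = "\<lambda>v. ideal_adjoin n (?A v) (?g v)"
  let ?X = "monomials_of_degree n e"
  have f: "?f v \<in> forms n d" and g: "?g v \<in> forms n d" for v :: "'k vec"
    by (rule form_at_forms[OF M], assumption)+
  have gA: "graded_ideal n (?A v)" for v by (rule graded_ideal_adjoin[OF P f])
  have gI: "graded_ideal n (?I v)" for v by (rule graded_ideal_adjoin[OF gA g])
  note iP = graded_idealD(1)[OF P] and iA = graded_idealD(1)[OF gA] and iI = graded_idealD(1)[OF gI]
  let ?V = "\<lambda>v. ?I v \<inter> forms n e"
  have V: "lin_subspace ?X (?V v)" for v by (rule lin_subspace_ideal[OF iI])
  define C where "C = (if d \<le> e then monomials_of_degree n (e - d) else {})"
  \<comment> \<open>generators of \<open>P + (f, g)\<close> in degree \<open>e\<close>, as functions of the point\<close>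
  define \<Omega> where "\<Omega> = (\<lambda>p v. p) ` (P \<inter> forms n e) \<union>
      (\<lambda>c v. Poly_Mapping.single c 1 * ?f v) ` C \<union> (\<lambda>c v. Poly_Mapping.single c 1 * ?g v) ` C"
  have mul: "s * ?f v \<in> forms n e" "s * ?g v \<in> forms n e"
    if "d \<le> e" "s \<in> forms n (e - d)" for s v
    using forms_mult[OF that(2) f[of v]] forms_mult[OF that(2) g[of v]] that(1) by auto
  have \<Omega>V: "\<omega> v \<in> ?V v" if \<omega>: "\<omega> \<in> \<Omega>" for \<omega> v
  proof -
    consider p where "p \<in> P \<inter> forms n e" "\<omega> v = p"
      | c where "c \<in> C" "\<omega> v = Poly_Mapping.single c 1 * ?f v"
      | c where "c \<in> C" "\<omega> v = Poly_Mapping.single c 1 * ?g v"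
      using \<omega> unfolding \<Omega>_def by blast
    then show ?thesis
    proof cases
      case 1
      then show ?thesis using ideal_adjoin_superset[of P n "?f v"] ideal_adjoin_superset[of "?A v" n "?g v"]
        by blast
    next
      case 2
      then have c: "d \<le> e" "Poly_Mapping.single c (1::'k) \<in> forms n (e - d)"
        by (auto simp: C_def forms_single split: if_splits)
      have "Poly_Mapping.single c 1 * ?f v \<in> ?A v"
        by (rule poly_idealD(4)[OF iA forms_polys[OF c(2)] ideal_adjoin_self[OF iP]])
      then show ?thesis using 2(2) mul(1)[OF c] ideal_adjoin_superset[of "?A v" n "?g v"] by auto
    next
      case 3
      then have c: "d \<le> e" "Poly_Mapping.single c (1::'k) \<in> forms n (e - d)"
        by (auto simp: C_def forms_single split: if_splits)
      have "Poly_Mapping.single c 1 * ?g v \<in> ?I v"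
        by (rule poly_idealD(4)[OF iI forms_polys[OF c(2)] ideal_adjoin_self[OF iA]])
      then show ?thesis using 3(2) mul(2)[OF c] by auto
    qed
  qed
  define r' where "r' = card (leads (?V v0))"
  have gen: "?V v0 \<subseteq> U" if U: "lin_subspace ?X U" and sub: "(\<lambda>\<omega>. \<omega> v0) ` \<Omega> \<subseteq> U" for U
  proof -
    note UD = lin_subspaceD[OF U]
    have U0: "p \<in> U" if "p \<in> P \<inter> forms n e" for p
      using sub that unfolding \<Omega>_def by auto
    have Um: "s * x \<in> U" if "d \<le> e" "s \<in> forms n (e - d)"
      and xU: "\<And>c. c \<in> C \<Longrightarrow> Poly_Mapping.single c 1 * x \<in> U" for s x
    proof -
      have "s * x = (\<Sum>c\<in>supp s. Poly_Mapping.single c (coef s c)) * x"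
        by (subst poly_mapping_eq_sum_single[of "supp s" s]) auto
      also have "\<dots> = (\<Sum>c\<in>supp s. scal (coef s c) (Poly_Mapping.single c 1 * x))"
        by (simp add: sum_distrib_right scal_eq_mult mult.assoc[symmetric] mult_single)
      also have "\<dots> \<in> U"
      proof -
        have "scal (coef s c) (Poly_Mapping.single c 1 * x) \<in> U" if "c \<in> supp s" for c
          using that \<open>s \<in> forms n (e - d)\<close> \<open>d \<le> e\<close> by (intro UD(4) xU) (auto simp: C_def forms_def)
        then show ?thesis
          by (induction rule: finite_induct[OF finite_keys[of s]]) (use UD(2,3) in auto)
      qed
      finally show ?thesis .
    qed
    have fU: "Poly_Mapping.single c 1 * ?f v0 \<in> U" "Poly_Mapping.single c 1 * ?g v0 \<in> U"
      if "c \<in> C" for c using sub that unfolding \<Omega>_def by auto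
    have AU: "?A v0 \<inter> forms n e \<subseteq> U"
    proof
      fix x assume "x \<in> ?A v0 \<inter> forms n e"
      then have x: "x \<in> (if d \<le> e then {a + s * ?f v0 | a s. a \<in> P \<inter> forms n e \<and> s \<in> forms n (e - d)}
          else P \<inter> forms n e)"
        unfolding ideal_adjoin_Int_forms[OF P f] .
      show "x \<in> U"
      proof (cases "d \<le> e")
        case True
        then obtain a s where as: "a \<in> P \<inter> forms n e" "s \<in> forms n (e - d)" "x = a + s * ?f v0"
          using x by auto
        show ?thesis unfolding as(3) by (rule UD(3)[OF U0[OF as(1)] Um[OF True as(2) fU(1)]])
      next
        case False
        then show ?thesis using x U0 by auto
      qed
    qed
    show ?thesis
    proof
      fix x assume "x \<in> ?V v0"
      then have x: "x \<in> (if d \<le> e then {a + s * ?g v0 | a s. a \<in> ?A v0 \<inter> forms n e \<and> s \<in> forms n (e - d)}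
          else ?A v0 \<inter> forms n e)"
        unfolding ideal_adjoin_Int_forms[OF gA g] .
      show "x \<in> U"
      proof (cases "d \<le> e")
        case True
        then obtain a s where as: "a \<in> ?A v0 \<inter> forms n e" "s \<in> forms n (e - d)" "x = a + s * ?g v0"
          using x by auto
        have "a \<in> U" using as(1) AU by blast
        then show ?thesis unfolding as(3) by (rule UD(3)[OF _ Um[OF True as(2) fU(2)]])
      next
        case False
        then show ?thesis using x AU by auto
      qed
    qed
  qed
  have "(\<lambda>\<omega>. \<omega> v0) ` \<Omega> \<subseteq> ?V v0" using \<Omega>V by blast
  then obtain w where w: "\<forall>i<r'. w i \<in> (\<lambda>\<omega>. \<omega> v0) ` \<Omega>" "lin_indep w r'"
    using basis_from_generators[OF V finite_monomials_of_degree _ gen] unfolding r'_def by blast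
  then have "\<forall>i. \<exists>\<omega>. i < r' \<longrightarrow> \<omega> \<in> \<Omega> \<and> w i = \<omega> v0" by blast
  then obtain \<omega> where \<omega>: "\<And>i. i < r' \<Longrightarrow> \<omega> i \<in> \<Omega>" "\<And>i. i < r' \<Longrightarrow> w i = \<omega> i v0" by metis
  \<comment> \<open>columns: the leading monomials at \<open>v0\<close>, which are coordinates on the space at \<open>v0\<close>\<close>
  have fin: "finite (leads (?V v0))"
    by (rule finite_subset[OF leads_subset[OF V] finite_monomials_of_degree])
  obtain t where "bij_betw t {0..<r'} (leads (?V v0))"
    unfolding r'_def using ex_bij_betw_nat_finite[OF fin] by blast
  then have t: "leads (?V v0) \<subseteq> t ` {..<r'}" by (simp add: bij_betw_def lessThan_atLeast0)
  have "\<exists>\<delta>. form_family r \<delta> (\<omega> i)" if "i < r'" for i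
  proof -
    have ff: "form_family r 1 (\<lambda>v :: 'k vec. Poly_Mapping.single c 1 * ?f v)"
      "form_family r 1 (\<lambda>v :: 'k vec. Poly_Mapping.single c 1 * ?g v)" for c
      by (rule form_family_form_at; use N in simp)+
    show ?thesis
      using \<omega>(1)[OF that] unfolding \<Omega>_def
      by (elim UnE imageE; simp only:; blast intro: ff form_family_const)
  qed
  then obtain \<delta> where "\<And>i. i < r' \<Longrightarrow> form_family r (\<delta> i) (\<omega> i)" by metis
  then obtain h where h: "h \<in> forms r (\<Sum>i<r'. \<delta> i)"
    "\<And>v. eval_mpoly h v = det (coef_mat r' t (\<lambda>i. \<omega> i v))"
    using form_family_det[of r' r \<delta> \<omega> t] by blast
  have "coef_mat r' t (\<lambda>i. \<omega> i v0) = coef_mat r' t w"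
    by (rule eq_matI) (use \<omega>(2) in \<open>auto simp: coef_mat_def\<close>)
  moreover have "det (coef_mat r' t w) \<noteq> 0"
    by (rule det_leads_nonzero[OF V _ w(2) t]) (use \<omega> \<Omega>V in auto)
  ultimately have "eval_mpoly h v0 \<noteq> 0" using h(2) by simp
  moreover have "H \<le> hilb n (?I v) e" if "eval_mpoly h v \<noteq> 0" for v
  proof -
    have ind: "lin_indep (\<lambda>i. \<omega> i v) r'"
      using that h(2) by (intro lin_indep_if_det_nonzero) simp
    have mem: "\<omega> i v \<in> ?V v" if "i < r'" for i using \<Omega>V[OF \<omega>(1)[OF that]] .
    have "H \<le> r'" using H unfolding r'_def hilb_def .
    also have "r' = card (leads (lspan (\<lambda>i. \<omega> i v) r'))"
      by (rule card_leads_lspan[OF finite_monomials_of_degree _ ind, symmetric])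
        (rule lin_subspaceD(1)[OF V mem])
    also have "\<dots> \<le> hilb n (?I v) e"
      unfolding hilb_def
      by (rule card_leads_mono[OF V finite_monomials_of_degree lspan_least[OF V mem]])
    finally show ?thesis .
  qed
  ultimately show ?thesis unfolding open_near_def using h(1) by blast
qed

lemma regular_pair_open_near:
  fixes P :: "'k::field mpoly set"
  assumes P: "prime_graded n P" and M: "\<And>i. i < N \<Longrightarrow> M i \<in> monomials_of_degree n d"
    and N: "2 * N \<le> Suc r" and d: "d > 0"
    and reg: "regular_pair n P (form_at 0 N M v0) (form_at N N M v0)"
  shows "open_near r (\<lambda>v. regular_pair n P (form_at 0 N M v) (form_at N N M v)) v0"
proof -
  have G: "graded_ideal n P" using P by (simp add: prime_graded_def)
  obtain D where D: "\<And>f g :: 'k mpoly. f \<in> forms n d \<Longrightarrow> g \<in> forms n d \<Longrightarrow> regular_pair n P f g \<longleftrightarrow>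
    (\<forall>e\<le>D. hilb_regular_pair n d P e \<le> hilb n (ideal_adjoin n (ideal_adjoin n P f) g) e)"
    using regular_pair_uniform_degree_bound[OF P d] by blast
  have f: "form_at s N M v \<in> forms n d" for s and v :: "'k vec" by (rule form_at_forms[OF M])
  have "open_near r (\<lambda>v. \<forall>e<Suc D. hilb_regular_pair n d P e \<le>
      hilb n (ideal_adjoin n (ideal_adjoin n P (form_at 0 N M v)) (form_at N N M v)) e) v0"
    by (intro open_near_bounded_all hilb_open_near[OF G M N])
      (use reg D[OF f f] in \<open>auto simp: less_Suc_eq_le\<close>)
  then show ?thesis unfolding D[OF f f] less_Suc_eq_le .
qed

section \<open>Finding a regular form over an infinite field\<close>

text \<open>Let \<open>x \<in> V\<close> lie in \<open>W\<close> only and let \<open>y \<in> V\<close> lie outside \<open>W\<close>.  Of the infinitely many vectors \<open>y + c x\<close>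
  two lie in the same member of the family.  It contains \<open>x\<close>, so it is \<open>W\<close>, and then \<open>y \<in> W\<close>.\<close>

lemma subspace_covered_by_finitely_many:
  fixes V :: "('x \<Rightarrow>\<^sub>0 'k::field) set"
  assumes k: "infinite (UNIV :: 'k set)" and V: "lin_subspace X V"
    and F: "finite F" "\<And>W. W \<in> F \<Longrightarrow> lin_subspace X W" "V \<subseteq> \<Union>F"
  shows "\<exists>W\<in>F. V \<subseteq> W"
  using F
proof (induction F rule: finite_induct)
  case empty
  then show ?case using lin_subspaceD(2)[OF V] by blast
next
  case (insert W F)
  show ?case
  proof (rule ccontr)
    assume no: "\<not> ?case"
    then have "\<not> V \<subseteq> \<Union>F" using insert by blast
    then obtain x where x: "x \<in> V" "x \<in> W" "\<And>W'. W' \<in> F \<Longrightarrow> x \<notin> W'" using insert.prems(2) by blast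
    obtain y where y: "y \<in> V" "y \<notin> W" using no by blast
    have "\<exists>W'. W' \<in> insert W F \<and> y + scal c x \<in> W'" for c
      using lin_subspaceD(3)[OF V y(1) lin_subspaceD(4)[OF V x(1)]] insert.prems(2) by blast
    then obtain \<phi> where \<phi>: "\<And>c. \<phi> c \<in> insert W F" "\<And>c. y + scal c x \<in> \<phi> c" by metis
    have "\<not> inj \<phi>"
    proof
      assume "inj \<phi>"
      moreover have "finite (range \<phi>)"
        by (rule finite_subset[of _ "insert W F"]) (use \<phi>(1) insert.hyps(1) in auto)
      ultimately show False using k finite_imageD by blast
    qed
    then obtain c c' where c: "\<phi> c = \<phi> c'" "c \<noteq> c'" by (auto simp: inj_def)
    note D = lin_subspaceD[OF insert.prems(1)[OF \<phi>(1)[of c]]]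
    have "y + scal c' x \<in> \<phi> c" using \<phi>(2)[of c'] c(1) by simp
    then have "(y + scal c x) - (y + scal c' x) \<in> \<phi> c" by (rule D(6)[OF \<phi>(2)])
    moreover have "(y + scal c x) - (y + scal c' x) = scal (c - c') x" by (simp add: scal_distribs)
    ultimately have "scal (c - c') x \<in> \<phi> c" by (simp only:)
    then have "scal (1 / (c - c')) (scal (c - c') x) \<in> \<phi> c" by (rule D(4))
    then have "x \<in> \<phi> c" using c(2) by simp
    then have W: "\<phi> c = W" using \<phi>(1)[of c] x(3) by auto
    have "(y + scal c x) - scal c x \<in> \<phi> c"
      by (rule D(6)[OF \<phi>(2) D(4)[OF \<open>x \<in> \<phi> c\<close>]])
    then show False using y(2) W by simp
  qed
qed

lemma var_mult_single:
  "var i * Poly_Mapping.single c (a :: 'k::field) = Poly_Mapping.single (Poly_Mapping.single i 1 + c) a"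
  by (simp add: var_def mult_single)

lemma var_forms: "i \<le> n \<Longrightarrow> var i \<in> forms n 1"
  unfolding var_def by (rule forms_single) (simp add: monomials_of_degree_def)

lemma monom_split_var:
  fixes c :: monom
  assumes "c \<noteq> 0" "supp c \<subseteq> {..n}"
  obtains i c' where "i \<le> n" "c = Poly_Mapping.single i 1 + c'" "supp c' \<subseteq> {..n}"
proof -
  have "supp c \<noteq> {}" using assms(1) by (simp add: poly_mapping_eq_iff fun_eq_iff)
  then obtain i where i: "i \<in> supp c" by blast
  have "c = Poly_Mapping.single i 1 + (c - Poly_Mapping.single i 1)"
  proof (rule poly_mapping_eqI)
    fix x show "coef c x = coef (Poly_Mapping.single i 1 + (c - Poly_Mapping.single i 1)) x"
      using i by (auto simp: lookup_add lookup_minus lookup_single when_def in_keys_iff)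
  qed
  moreover have "supp (c - Poly_Mapping.single i 1) \<subseteq> supp c"
    by (auto simp: in_keys_iff lookup_minus)
  ultimately show ?thesis using that[of i "c - Poly_Mapping.single i 1"] i assms(2) by blast
qed

definition irrelevant :: "nat \<Rightarrow> 'k::field mpoly set" where
  "irrelevant n = {f \<in> polys n. coef f 0 = 0}"

lemma irrelevant_mult_mem:
  assumes A: "poly_ideal n A" and u: "u \<in> polys n" "\<And>i. i \<le> n \<Longrightarrow> var i * u \<in> A"
    and f: "f \<in> irrelevant n"
  shows "f * u \<in> A"
proof -
  have "f * u = (\<Sum>c\<in>supp f. Poly_Mapping.single c (coef f c)) * u"
    by (subst poly_mapping_eq_sum_single[of "supp f" f]) auto
  also have "\<dots> = (\<Sum>c\<in>supp f. Poly_Mapping.single c (coef f c) * u)"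
    by (simp add: sum_distrib_right)
  also have "\<dots> \<in> A"
  proof (rule poly_ideal_sum[OF A])
    fix c assume c: "c \<in> supp f"
    have "c \<noteq> 0"
    proof
      assume "c = 0"
      then show False using c f by (simp add: irrelevant_def in_keys_iff)
    qed
    moreover have "supp c \<subseteq> {..n}" using f c by (auto simp: irrelevant_def polys_iff)
    ultimately obtain i c' where i: "i \<le> n" "c = Poly_Mapping.single i 1 + c'" "supp c' \<subseteq> {..n}"
      by (rule monom_split_var)
    have "Poly_Mapping.single c' (coef f c) * (var i * u) \<in> A"
      by (rule poly_idealD(4)[OF A polys_single[OF i(3)] u(2)[OF i(1)]])
    also have "Poly_Mapping.single c' (coef f c) * (var i * u) = Poly_Mapping.single c (coef f c) * u"
      unfolding mult.assoc[symmetric] mult.commute[of _ "var i"] var_mult_single i(2)[symmetric] ..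
    finally show "Poly_Mapping.single c (coef f c) * u \<in> A" .
  qed
  finally show ?thesis .
qed

text \<open>That the irrelevant ideal is not associated to \<open>S / A\<close>.\<close>

definition saturated :: "nat \<Rightarrow> 'k::field mpoly set \<Rightarrow> bool" where
  "saturated n A \<longleftrightarrow> (\<forall>u\<in>polys n. (\<forall>i\<le>n. var i * u \<in> A) \<longrightarrow> u \<in> A)"

text \<open>The maximal ideals of the form \<open>(A : u)\<close> with a form \<open>u \<notin> A\<close>.  They are the maximal associated
  primes of \<open>A\<close>.\<close>

definition max_colons :: "nat \<Rightarrow> 'k::field mpoly set \<Rightarrow> 'k mpoly set set" where
  "max_colons n A = {Q. (\<exists>e. \<exists>u\<in>forms n e. u \<notin> A \<and> Q = colon n A u) \<and>
     (\<forall>e. \<forall>u\<in>forms n e. u \<notin> A \<longrightarrow> Q \<subseteq> colon n A u \<longrightarrow> Q = colon n A u)}"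

lemma max_colonsE:
  assumes "Q \<in> max_colons n A"
  obtains e u where "u \<in> forms n e" "u \<notin> A" "Q = colon n A u"
  using assms unfolding max_colons_def by blast

lemma max_colons_maximal:
  assumes "Q \<in> max_colons n A" "u \<in> forms n e" "u \<notin> A" "Q \<subseteq> colon n A u"
  shows "Q = colon n A u"
  using assms unfolding max_colons_def by blast

text \<open>By the ascending chain condition for graded ideals.\<close>

lemma colon_subset_max_colon:
  assumes A: "graded_ideal n A" and u: "u \<in> forms n e" "u \<notin> A"
  shows "\<exists>Q\<in>max_colons n A. colon n A u \<subseteq> Q"
proof -
  define R where "R = {(Y, X). X \<subset> Y \<and> graded_ideal n X \<and> graded_ideal n (Y :: 'a mpoly set)}"
  have "wf R"
    unfolding wf_iff_no_infinite_down_chain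
  proof
    assume "\<exists>f. \<forall>i. (f (Suc i), f i) \<in> R"
    then obtain f where f: "\<And>i. (f (Suc i), f i) \<in> R" by blast
    then have "\<And>i. graded_ideal n (f i)" "\<And>i. f i \<subseteq> f (Suc i)" by (auto simp: R_def)
    from graded_ideal_ascending_stabilizes[of n f, OF this] obtain i where "f (Suc i) = f i" by blast
    then show False using f[of i] by (simp add: R_def)
  qed
  define H where "H = {colon n A v | v e. v \<in> forms n e \<and> v \<notin> A \<and> colon n A u \<subseteq> colon n A v}"
  have "colon n A u \<in> H" using u by (auto simp: H_def)
  then obtain Q where Q: "Q \<in> H" "\<And>Y. (Y, Q) \<in> R \<Longrightarrow> Y \<notin> H"
    using \<open>wf R\<close> unfolding wf_eq_minimal by metis
  obtain v e' where v: "v \<in> forms n e'" "v \<notin> A" "colon n A u \<subseteq> colon n A v" "Q = colon n A v"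
    using Q(1) by (auto simp: H_def)
  have "Q = colon n A w" if w: "w \<in> forms n i" "w \<notin> A" "Q \<subseteq> colon n A w" for w i
  proof (rule ccontr)
    assume "Q \<noteq> colon n A w"
    then have "(colon n A w, Q) \<in> R"
      using w v graded_ideal_colon[OF A] by (auto simp: R_def)
    moreover have "colon n A w \<in> H" using w v by (auto simp: H_def)
    ultimately show False using Q(2) by blast
  qed
  then have "Q \<in> max_colons n A" unfolding max_colons_def using v by blast
  then show ?thesis using v by blast
qed

text \<open>For \<open>y \<notin> (A : u)\<close> the ideal \<open>(A : y u)\<close> contains \<open>(A : u)\<close>, so by maximality both are equal.\<close>

lemma max_colon_prime:
  assumes A: "graded_ideal n A" and Q: "Q \<in> max_colons n A"
    and y: "y \<in> forms n i" "y \<notin> Q" and x: "x \<in> polys n" "x * y \<in> Q"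
  shows "x \<in> Q"
proof -
  obtain e u where u: "u \<in> forms n e" "u \<notin> A" "Q = colon n A u" by (rule max_colonsE[OF Q])
  note D = poly_idealD[OF graded_idealD(1)[OF A]]
  have yu: "y * u \<notin> A" using y u(3) forms_polys by (auto simp: colon_def)
  have "Q \<subseteq> colon n A (y * u)"
  proof
    fix s assume "s \<in> Q"
    then have "s \<in> polys n" "y * (s * u) \<in> A" using u(3) D(4)[OF forms_polys[OF y(1)]] by (auto simp: colon_def)
    then show "s \<in> colon n A (y * u)" by (simp add: colon_def mult.left_commute)
  qed
  then have "Q = colon n A (y * u)" by (rule max_colons_maximal[OF Q forms_mult[OF y(1) u(1)] yu])
  moreover have "x * (y * u) \<in> A" using x(2) u(3) by (simp add: colon_def mult.assoc)
  ultimately show ?thesis using x(1) by (simp add: colon_def)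
qed

lemma graded_ideal_max_colon:
  assumes "graded_ideal n A" "Q \<in> max_colons n A"
  shows "graded_ideal n Q"
  by (rule max_colonsE[OF assms(2)]) (simp add: graded_ideal_colon[OF assms(1)])

text \<open>With infinitely many maximal ideals \<open>Q\<^sub>i = (A : u\<^sub>i)\<close>, the ideals \<open>A + (u\<^sub>0, \<dots>, u\<^sub>i\<^sub>-\<^sub>1)\<close> would become
  stationary, so some \<open>u\<^sub>i\<close> would lie in the ideal before it.  Then \<open>Q\<^sub>0 \<inter> \<dots> \<inter> Q\<^sub>i\<^sub>-\<^sub>1 \<subseteq> Q\<^sub>i\<close>, and as \<open>Q\<^sub>i\<close> is
  prime, it contains, hence equals, one of the others.\<close>

lemma finite_max_colons:
  assumes A: "graded_ideal n A"
  shows "finite (max_colons n A)"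
proof (rule ccontr)
  assume "infinite (max_colons n A)"
  then obtain Q :: "nat \<Rightarrow> 'a mpoly set" where Q: "inj Q" "range Q \<subseteq> max_colons n A"
    using infinite_countable_subset by blast
  have Qm: "Q i \<in> max_colons n A" for i using Q(2) by blast
  have "\<exists>u. (\<exists>e. u \<in> forms n e) \<and> u \<notin> A \<and> Q i = colon n A u" for i
    using max_colonsE[OF Qm] by metis
  then obtain u where u: "\<And>i. \<exists>e. u i \<in> forms n e" "\<And>i. u i \<notin> A" "\<And>i. Q i = colon n A (u i)"
    by metis
  \<comment> \<open>\<open>B i\<close> is the ideal \<open>A + (u\<^sub>0, \<dots>, u\<^sub>i\<^sub>-\<^sub>1)\<close>\<close>
  define B where "B = rec_nat A (\<lambda>i B. ideal_adjoin n B (u i))"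
  have B: "B 0 = A" "\<And>i. B (Suc i) = ideal_adjoin n (B i) (u i)" by (simp_all add: B_def)
  have gB: "graded_ideal n (B i)" for i
  proof (induction i)
    case (Suc i)
    obtain e where "u i \<in> forms n e" using u(1) by blast
    then show ?case unfolding B(2) by (rule graded_ideal_adjoin[OF Suc])
  qed (simp add: B A)
  have "\<exists>i. B (Suc i) = B i"
    by (rule graded_ideal_ascending_stabilizes[OF gB]) (simp add: B ideal_adjoin_superset)
  then obtain i where i: "B (Suc i) = B i" by blast
  have ui: "u i \<in> B i"
    using ideal_adjoin_self[OF graded_idealD(1)[OF gB[of i]], of "u i"] i B(2)[of i] by simp
  note D = poly_idealD[OF graded_idealD(1)[OF A]]
  have kill: "\<forall>b\<in>B j. x * b \<in> A" if "\<forall>l<j. x \<in> Q l" "x \<in> polys n" for x j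
    using that(1)
  proof (induction j)
    case 0
    then show ?case using D(4)[OF that(2)] by (simp add: B)
  next
    case (Suc j)
    show ?case
    proof
      fix b assume "b \<in> B (Suc j)"
      then obtain b' s where b: "b' \<in> B j" "s \<in> polys n" "b = b' + s * u j"
        unfolding B(2) ideal_adjoin_def by blast
      have "x * b' \<in> A" using Suc b(1) by auto
      moreover have "x * u j \<in> A" using Suc.prems u(3)[of j] by (auto simp: colon_def)
      then have "s * (x * u j) \<in> A" by (rule D(4)[OF b(2)])
      ultimately have "x * b' + s * (x * u j) \<in> A" by (rule D(3))
      then show "x * b \<in> A" unfolding b(3) by (simp add: algebra_simps)
    qed
  qed
  have gQ: "graded_ideal n (Q j)" for j by (rule graded_ideal_max_colon[OF A Qm])
  have "\<exists>y. (\<exists>e. y \<in> forms n e) \<and> y \<in> Q j \<and> y \<notin> Q i" if "j < i" for j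
  proof -
    have "\<not> Q j \<subseteq> Q i"
    proof
      assume "Q j \<subseteq> Q i"
      moreover obtain e where "u i \<in> forms n e" using u(1) by blast
      ultimately have "Q j = Q i" unfolding u(3)[of i] using max_colons_maximal[OF Qm _ u(2)] by blast
      then show False using Q(1) that by (auto simp: inj_def)
    qed
    then obtain x where x: "x \<in> Q j" "x \<notin> Q i" by blast
    then obtain e where "homogeneous_component e x \<notin> Q i" using graded_ideal_memI[OF gQ] by blast
    then show ?thesis
      using graded_idealD(2)[OF gQ x(1)] x(1)
        homogeneous_component_forms[OF poly_idealD(1)[OF graded_idealD(1)[OF gQ]]] by blast
  qed
  then obtain y where y: "\<And>j. j < i \<Longrightarrow> \<exists>e. y j \<in> forms n e" "\<And>j. j < i \<Longrightarrow> y j \<in> Q j"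
    "\<And>j. j < i \<Longrightarrow> y j \<notin> Q i" by metis
  have yp: "y j \<in> polys n" if "j < i" for j using y(1)[OF that] forms_polys by blast
  have prod: "(\<Prod>l<j. y l) \<in> polys n \<and> (\<Prod>l<j. y l) \<notin> Q i \<and> (\<forall>l<j. (\<Prod>l<j. y l) \<in> Q l)"
    if "j \<le> i" for j
    using that
  proof (induction j)
    case 0
    have "1 \<notin> Q i" using u(2)[of i] u(3)[of i] by (simp add: colon_def)
    then show ?case by simp
  next
    case (Suc j)
    let ?p = "\<Prod>l<j. y l"
    have p: "?p \<in> polys n" "?p \<notin> Q i" "\<forall>l<j. ?p \<in> Q l" using Suc by auto
    have j: "j < i" using Suc.prems by simp
    obtain e where e: "y j \<in> forms n e" using y(1)[OF j] by blast
    have "?p * y j \<notin> Q i" using max_colon_prime[OF A Qm e y(3)[OF j] p(1)] p(2) by blast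
    moreover have "?p * y j \<in> Q l" if "l < Suc j" for l
    proof (cases "l = j")
      case True
      then show ?thesis using poly_idealD(4)[OF graded_idealD(1)[OF gQ] p(1) y(2)[OF j]] by simp
    next
      case False
      then have "?p \<in> Q l" using p(3) that by auto
      then have "y j * ?p \<in> Q l" by (rule poly_idealD(4)[OF graded_idealD(1)[OF gQ] yp[OF j]])
      then show ?thesis by (simp add: mult.commute)
    qed
    ultimately show ?case using p(1) yp[OF j] by simp
  qed
  have "(\<Prod>l<i. y l) * u i \<in> A" using kill[of i] prod[of i] ui by auto
  then have "(\<Prod>l<i. y l) \<in> Q i" using prod[of i] by (simp add: u(3)[of i] colon_def)
  then show False using prod[of i] by simp
qed

text \<open>If every form of degree \<open>d\<close> were a zero divisor modulo \<open>A\<close>, then the forms of degree \<open>d\<close> would be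
  covered by finitely many ideals \<open>(A : u)\<close> with \<open>u \<notin> A\<close>.  As the field is infinite, a single one
  would contain all of them, and a power of the irrelevant ideal would kill \<open>u\<close>.\<close>

lemma exists_regular_form:
  fixes A :: "'k::field mpoly set"
  assumes k: "infinite (UNIV :: 'k set)" and A: "graded_ideal n A" and sat: "saturated n A"
  shows "\<exists>g\<in>forms n d. colon n A g = A"
proof (rule ccontr)
  assume no: "\<not> ?thesis"
  have I: "poly_ideal n A" by (rule graded_idealD(1)[OF A])
  let ?F = "(\<lambda>Q. Q \<inter> forms n d) ` max_colons n A"
  have "\<exists>W\<in>?F. forms n d \<subseteq> W"
  proof (rule subspace_covered_by_finitely_many[OF k lin_subspace_forms])
    show "finite ?F" using finite_max_colons[OF A] by simp
    show "lin_subspace (monomials_of_degree n d) W" if "W \<in> ?F" for W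
      using that lin_subspace_ideal[OF graded_idealD(1)[OF graded_ideal_max_colon[OF A]]] by blast
    show "forms n d \<subseteq> \<Union>?F"
    proof
      fix g :: "'k mpoly" assume g: "g \<in> forms n d"
      have gc: "graded_ideal n (colon n A g)" by (rule graded_ideal_colon[OF A g])
      obtain x where x: "x \<in> colon n A g" "x \<notin> A"
        using no g colon_superset[OF I forms_polys[OF g]] by blast
      then obtain e where e: "homogeneous_component e x \<notin> A" using graded_ideal_memI[OF A] by blast
      let ?x = "homogeneous_component e x"
      have xc: "?x \<in> colon n A g" by (rule graded_idealD(2)[OF gc x(1)])
      have xf: "?x \<in> forms n e"
        using x(1) by (intro homogeneous_component_forms) (simp add: colon_def)
      obtain Q where Q: "Q \<in> max_colons n A" "colon n A ?x \<subseteq> Q"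
        using colon_subset_max_colon[OF A xf e] by blast
      have "g \<in> colon n A ?x" using xc forms_polys[OF g] by (simp add: colon_def mult.commute)
      then show "g \<in> \<Union>?F" using Q g by blast
    qed
  qed
  then obtain Q where Q: "Q \<in> max_colons n A" "forms n d \<subseteq> Q" by blast
  obtain e u where u: "u \<in> forms n e" "u \<notin> A" "Q = colon n A u" by (rule max_colonsE[OF Q(1)])
  note up = forms_polys[OF u(1)]
  \<comment> \<open>saturation lowers the degree of the monomials that kill \<open>u\<close>, down to \<open>0\<close>\<close>
  have "\<forall>c\<in>monomials_of_degree n (d - j). Poly_Mapping.single c 1 * u \<in> A" for j
  proof (induction j)
    case 0
    show ?case
    proof
      fix c assume "c \<in> monomials_of_degree n (d - 0)"
      then have "Poly_Mapping.single c (1::'k) \<in> Q" using Q(2) forms_single by fastforce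
      then show "Poly_Mapping.single c 1 * u \<in> A" by (simp add: u(3) colon_def)
    qed
  next
    case (Suc j)
    show ?case
    proof (cases "d - j = 0")
      case True
      then show ?thesis using Suc by simp
    next
      case False
      then have dj: "d - j = Suc (d - Suc j)" by simp
      show ?thesis
      proof
        fix c assume c: "c \<in> monomials_of_degree n (d - Suc j)"
        have "var i * (Poly_Mapping.single c 1 * u) \<in> A" if "i \<le> n" for i
        proof -
          have "Poly_Mapping.single i 1 + c \<in> monomials_of_degree n (d - j)"
            using c that unfolding dj by (auto simp: monomials_of_degree_def supp_add_nat)
          then have "Poly_Mapping.single (Poly_Mapping.single i 1 + c) 1 * u \<in> A" using Suc by blast
          then show ?thesis by (simp add: mult.assoc[symmetric] var_mult_single)
        qed
        moreover have "Poly_Mapping.single c 1 * u \<in> polys n"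
          using forms_polys[OF forms_single[OF c]] up by blast
        ultimately show "Poly_Mapping.single c 1 * u \<in> A" using sat unfolding saturated_def by blast
      qed
    qed
  qed
  from this[of d] have "Poly_Mapping.single 0 1 * u \<in> A" by (simp add: monomials_of_degree_0)
  then show False using u(2) by simp
qed

text \<open>If some regular sequence \<open>r1, r2\<close> in the irrelevant ideal exists, then for no \<open>f \<notin> P\<close> the
  irrelevant ideal kills a nonzero class modulo \<open>P + (f)\<close>.  Let it kill \<open>u\<close>: from \<open>r1 u = v1 f\<close> and
  \<open>r2 u = v2 f\<close> modulo \<open>P\<close> follows \<open>r1 v2 = r2 v1\<close>, so \<open>r1\<close> divides \<open>v1\<close> and \<open>f\<close> divides \<open>u\<close>.\<close>

lemma saturated_adjoin:
  assumes P: "prime_graded n P" and f: "f \<in> polys n" "f \<notin> P"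
    and r: "r1 \<in> irrelevant n" "r2 \<in> irrelevant n"
    and reg: "colon n P r1 \<subseteq> P" "colon n (ideal_adjoin n P r1) r2 \<subseteq> ideal_adjoin n P r1"
  shows "saturated n (ideal_adjoin n P f)"
  unfolding saturated_def
proof (intro ballI impI)
  fix u assume u: "u \<in> polys n" "\<forall>i\<le>n. var i * u \<in> ideal_adjoin n P f"
  have I: "poly_ideal n P" and pr: "\<And>a b. a \<in> polys n \<Longrightarrow> b \<in> polys n \<Longrightarrow> a * b \<in> P \<Longrightarrow> a \<in> P \<or> b \<in> P"
    using P by (auto simp: prime_graded_def graded_ideal_def)
  note D = poly_idealD[OF I]
  have rp: "r1 \<in> polys n" "r2 \<in> polys n" using r by (auto simp: irrelevant_def)
  have "r1 * u \<in> ideal_adjoin n P f" "r2 * u \<in> ideal_adjoin n P f"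
    using irrelevant_mult_mem[OF poly_ideal_adjoin[OF I f(1)] u(1)] u(2) r by blast+
  then obtain p1 v1 p2 v2 where v: "p1 \<in> P" "v1 \<in> polys n" "r1 * u = p1 + v1 * f"
    "p2 \<in> P" "v2 \<in> polys n" "r2 * u = p2 + v2 * f"
    unfolding ideal_adjoin_def by blast
  have "f * (r1 * v2 - r2 * v1) = r1 * (r2 * u - p2) - r2 * (r1 * u - p1)"
    unfolding v(3,6) by (simp add: algebra_simps)
  also have "\<dots> = r2 * p1 - r1 * p2" by (simp add: algebra_simps)
  also have "\<dots> \<in> P" using D(4,6) rp v(1,4) by blast
  finally have "f * (r1 * v2 - r2 * v1) \<in> P" .
  moreover have "r1 * v2 - r2 * v1 \<in> polys n" using rp v(2,5) by simp
  ultimately have "r1 * v2 - r2 * v1 \<in> P" using pr[OF f(1)] f(2) by blast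
  then have "- (r1 * v2 - r2 * v1) \<in> P" by (rule D(5))
  moreover have "v1 * r2 = - (r1 * v2 - r2 * v1) + v2 * r1" by (simp add: algebra_simps)
  ultimately have "v1 * r2 \<in> ideal_adjoin n P r1"
    unfolding ideal_adjoin_def using v(5) by (intro CollectI exI conjI)
  then have "v1 \<in> ideal_adjoin n P r1" using reg(2) v(2) by (auto simp: colon_def)
  then obtain p w where w: "p \<in> P" "w \<in> polys n" "v1 = p + w * r1" by (auto simp: ideal_adjoin_def)
  have "(u - w * f) * r1 = p1 + f * p"
    using v(3) unfolding w(3) by (simp add: algebra_simps)
  also have "\<dots> \<in> P" using D(3,4) f(1) v(1) w(1) by blast
  finally have "u - w * f \<in> P" using reg(1) u(1) w(2) f(1) by (auto simp: colon_def)
  then have "(u - w * f) + w * f \<in> ideal_adjoin n P f" unfolding ideal_adjoin_def using w(2) by blast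
  then show "u \<in> ideal_adjoin n P f" by simp
qed

text \<open>The first form is a power of a variable outside \<open>P\<close>; such a variable exists because \<open>r1\<close> is in the
  irrelevant ideal, but not in \<open>P\<close>.\<close>

lemma exists_regular_pair:
  fixes P :: "'k::field mpoly set"
  assumes k: "infinite (UNIV :: 'k set)" and P: "prime_graded n P"
    and r: "r1 \<in> irrelevant n" "r2 \<in> irrelevant n"
    and reg: "colon n P r1 \<subseteq> P" "colon n (ideal_adjoin n P r1) r2 \<subseteq> ideal_adjoin n P r1"
  shows "\<exists>f\<in>forms n d. \<exists>g\<in>forms n d. regular_pair n P f g"
proof -
  have G: "graded_ideal n P" and I: "poly_ideal n P" and ne: "P \<noteq> polys n"
    and pr: "\<And>a b. a \<in> polys n \<Longrightarrow> b \<in> polys n \<Longrightarrow> a * b \<in> P \<Longrightarrow> a \<in> P \<or> b \<in> P"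
    using P by (auto simp: prime_graded_def graded_ideal_def)
  have "r1 \<notin> P"
  proof
    assume "r1 \<in> P"
    then have "polys n \<subseteq> colon n P r1" using poly_idealD(4)[OF I] by (auto simp: colon_def)
    then show False using reg(1) poly_idealD(1)[OF I] ne by blast
  qed
  have "\<exists>i\<le>n. (var i :: 'k mpoly) \<notin> P"
  proof (rule ccontr)
    assume "\<not> ?thesis"
    then have "var i * 1 \<in> P" if "i \<le> n" for i using that by simp
    then have "r1 * 1 \<in> P" by (rule irrelevant_mult_mem[OF I polys_closed(2) _ r(1)])
    then show False using \<open>r1 \<notin> P\<close> by simp
  qed
  then obtain i where i: "i \<le> n" "(var i :: 'k mpoly) \<notin> P" by blast
  define f where "f = (var i :: 'k mpoly) ^ d"
  have vp: "(var i :: 'k mpoly) \<in> polys n" by (rule forms_polys[OF var_forms[OF i(1)]])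
  have "(var i :: 'k mpoly) ^ j \<in> forms n j \<and> (var i :: 'k mpoly) ^ j \<notin> P" for j
  proof (induction j)
    case 0
    then show ?case using one_notin_ideal[OF I ne] by (simp add: forms_def monomials_of_degree_0)
  next
    case (Suc j)
    then show ?case
      using forms_mult[OF var_forms[OF i(1)], of "var i ^ j" j] pr[OF vp, of "var i ^ j"] i(2)
        forms_polys[of "var i ^ j"] by auto
  qed
  then have f: "f \<in> forms n d" "f \<notin> P" by (auto simp: f_def)
  have c: "colon n P f = P"
    using pr[OF _ forms_polys[OF f(1)]] f(2) colon_superset[OF I forms_polys[OF f(1)]]
    by (auto simp: colon_def)
  have sat: "saturated n (ideal_adjoin n P f)"
    by (rule saturated_adjoin[OF P forms_polys[OF f(1)] f(2) r reg])
  obtain g where "g \<in> forms n d" "colon n (ideal_adjoin n P f) g = ideal_adjoin n P f"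
    using exists_regular_form[OF k graded_ideal_adjoin[OF G f(1)] sat] by blast
  then show ?thesis using f(1) c unfolding regular_pair_def by blast
qed

section \<open>Regular sequences in the quotient ring\<close>

lemma (in cring) coset_eq_ideal_iff:
  assumes J: "ideal J R" and y: "y \<in> carrier R"
  shows "J +> y = J \<longleftrightarrow> y \<in> J"
proof -
  interpret J: ideal J R by (rule J)
  have "y \<ominus> \<zero> \<in> J \<longleftrightarrow> J +> y = J +> \<zero>"
    by (rule quotient_eq_iff_same_a_r_cos[OF J y zero_closed])
  moreover have "J +> \<zero> = J"
    by (rule J.a_rcos_const) (rule additive_subgroup.zero_closed[OF J.additive_subgroup_axioms])
  moreover have "y \<ominus> \<zero> = y" using y by (simp add: a_minus_def)
  ultimately show ?thesis by simp
qed

lemma (in cring) nonzerodivisor_Quot_iff: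
  assumes J: "ideal J R" and r: "r \<in> carrier R"
  shows "nonzerodivisor (R Quot J) (J +> r) \<longleftrightarrow> (\<forall>y\<in>carrier R. r \<otimes> y \<in> J \<longrightarrow> y \<in> J)"
proof -
  interpret J: ideal J R by (rule J)
  have c: "carrier (R Quot J) = (\<lambda>y. J +> y) ` carrier R"
    by (auto simp: FactRing_def A_RCOSETS_def')
  have m: "(J +> r) \<otimes>\<^bsub>R Quot J\<^esub> (J +> y) = J +> (r \<otimes> y)" if "y \<in> carrier R" for y
    using J.rcoset_mult_add[OF r that] by (simp add: FactRing_def)
  have z: "\<zero>\<^bsub>R Quot J\<^esub> = J" by (simp add: FactRing_def)
  show ?thesis
    unfolding nonzerodivisor_def c z using r by (auto simp: m coset_eq_ideal_iff[OF J])
qed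

lemma (in cring) Idl_empty: "Idl {} = {\<zero>}"
proof
  show "Idl {} \<subseteq> {\<zero>}" by (rule genideal_minimal[OF zeroideal]) simp
  have "ideal (Idl {}) R" by (rule genideal_ideal) simp
  then show "{\<zero>} \<subseteq> Idl {}"
    using additive_subgroup.zero_closed[OF ideal.axioms(1)] by blast
qed

lemma (in cring) regular_sequence_first_two:
  assumes "regular_sequence R (r # s # rs)"
  shows "r \<in> carrier R" "s \<in> carrier R"
    "\<And>y. y \<in> carrier R \<Longrightarrow> r \<otimes> y = \<zero> \<Longrightarrow> y = \<zero>"
    "\<And>y. y \<in> carrier R \<Longrightarrow> s \<otimes> y \<in> Idl {r} \<Longrightarrow> y \<in> Idl {r}"
proof -
  show r: "r \<in> carrier R" and s: "s \<in> carrier R"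
    using assms by (auto simp: regular_sequence_def)
  have *: "nonzerodivisor (R Quot Idl (set (take i (r # s # rs))))
      (Idl (set (take i (r # s # rs))) +> ((r # s # rs) ! i))" if "i < 2" for i
    using assms that unfolding regular_sequence_def Let_def by auto
  show "y = \<zero>" if "y \<in> carrier R" "r \<otimes> y = \<zero>" for y
    using *[of 0] that nonzerodivisor_Quot_iff[OF zeroideal r] by (simp add: Idl_empty)
  show "y \<in> Idl {r}" if "y \<in> carrier R" "s \<otimes> y \<in> Idl {r}" for y
    using *[of 1] that nonzerodivisor_Quot_iff[OF genideal_ideal s, of "{r}"] r by simp
qed

lemma (in cring) regular_sequence_pair_iff:
  assumes r: "r \<in> carrier R" and s: "s \<in> carrier R"
  shows "regular_sequence R [r, s] \<longleftrightarrow>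
    (\<forall>y\<in>carrier R. r \<otimes> y = \<zero> \<longrightarrow> y = \<zero>) \<and>
    (\<forall>y\<in>carrier R. s \<otimes> y \<in> Idl {r} \<longrightarrow> y \<in> Idl {r}) \<and> Idl {r, s} \<noteq> carrier R"
proof -
  have two: "(\<forall>i<length [r, s]. Q i) \<longleftrightarrow> Q 0 \<and> Q 1" for Q :: "nat \<Rightarrow> bool"
    by (auto simp: less_Suc_eq)
  have "{r} \<subseteq> carrier R" using r by simp
  from nonzerodivisor_Quot_iff[OF genideal_ideal[OF this] s] nonzerodivisor_Quot_iff[OF zeroideal r] r s
  show ?thesis unfolding regular_sequence_def two Let_def by (simp add: Idl_empty)
qed

lemma forms_irrelevant: "d > 0 \<Longrightarrow> f \<in> forms n d \<Longrightarrow> f \<in> irrelevant n"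
  unfolding irrelevant_def by (auto simp: forms_polys forms_def monomials_of_degree_def in_keys_iff)

locale prime_quotient =
  fixes n :: nat and P :: "'k::field mpoly set"
  assumes prime_graded: "prime_graded n P"
begin

abbreviation A :: "'k mpoly set ring" where "A \<equiv> poly_ring n Quot P"

abbreviation cls :: "'k mpoly \<Rightarrow> 'k mpoly set" where "cls f \<equiv> P +>\<^bsub>poly_ring n\<^esub> f"

lemma P_graded: "graded_ideal n P" and P_ideal: "poly_ideal n P" and P_proper: "P \<noteq> polys n"
  using prime_graded by (auto simp: prime_graded_def graded_ideal_def)

lemma P_ring_ideal: "ideal P (poly_ring n)"
  using P_ideal by (simp add: ideal_iff_poly_ideal)

lemma cring_A: "cring A"
  by (rule ideal.quotient_is_cring[OF P_ring_ideal cring_poly_ring])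

lemma carrier_A: "carrier A = cls ` polys n"
  by (auto simp: FactRing_def A_RCOSETS_def')

lemma cls_mult: "f \<in> polys n \<Longrightarrow> g \<in> polys n \<Longrightarrow> cls f \<otimes>\<^bsub>A\<^esub> cls g = cls (f * g)"
  using ideal.rcoset_mult_add[OF P_ring_ideal] by (simp add: FactRing_def)

lemma zero_A: "\<zero>\<^bsub>A\<^esub> = P"
  by (simp add: FactRing_def)

lemma cls_eq_zero_iff: "f \<in> polys n \<Longrightarrow> cls f = \<zero>\<^bsub>A\<^esub> \<longleftrightarrow> f \<in> P"
  unfolding zero_A by (rule cring.coset_eq_ideal_iff[OF cring_poly_ring P_ring_ideal])

lemma cls_eq_iff:
  assumes "f \<in> polys n" "g \<in> polys n" shows "cls f = cls g \<longleftrightarrow> f - g \<in> P"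
proof -
  interpret S: cring "poly_ring n :: 'k mpoly ring" by (rule cring_poly_ring)
  have "\<ominus>\<^bsub>poly_ring n\<^esub> g = - g" by (rule S.add.inv_equality) (use assms in auto)
  then have "f \<ominus>\<^bsub>poly_ring n\<^esub> g = f - g" by (simp add: a_minus_def)
  then show ?thesis using S.quotient_eq_iff_same_a_r_cos[OF P_ring_ideal assms] by simp
qed

lemma cls_mem_Idl_iff:
  assumes f: "f \<in> polys n" and g: "g \<in> polys n"
  shows "cls f \<in> Idl\<^bsub>A\<^esub> {cls g} \<longleftrightarrow> f \<in> ideal_adjoin n P g"
proof -
  interpret A: cring A by (rule cring_A)
  have "cls g \<in> carrier A" using g carrier_A by blast
  then have "Idl\<^bsub>A\<^esub> {cls g} = {x \<otimes>\<^bsub>A\<^esub> cls g | x. x \<in> carrier A}"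
    using A.cgenideal_eq_genideal[of "cls g"] unfolding cgenideal_def by simp
  also have "\<dots> = {cls (s * g) | s. s \<in> polys n}"
    unfolding carrier_A using cls_mult[OF _ g] by force
  finally have "cls f \<in> Idl\<^bsub>A\<^esub> {cls g} \<longleftrightarrow> (\<exists>s\<in>polys n. cls f = cls (s * g))" by auto
  also have "\<dots> \<longleftrightarrow> (\<exists>s\<in>polys n. f - s * g \<in> P)"
    using cls_eq_iff[OF f] g by auto
  also have "\<dots> \<longleftrightarrow> f \<in> ideal_adjoin n P g"
  proof
    assume "\<exists>s\<in>polys n. f - s * g \<in> P"
    then obtain s where "s \<in> polys n" "f - s * g \<in> P" by blast
    moreover have "f = (f - s * g) + s * g" by simp
    ultimately show "f \<in> ideal_adjoin n P g" unfolding ideal_adjoin_def by blast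
  next
    assume "f \<in> ideal_adjoin n P g"
    then obtain a s where "a \<in> P" "s \<in> polys n" "f = a + s * g" unfolding ideal_adjoin_def by blast
    then show "\<exists>s\<in>polys n. f - s * g \<in> P" by (intro bexI[of _ s]) simp_all
  qed
  finally show ?thesis .
qed

text \<open>In degree \<open>0\<close> a proper ideal is zero, and \<open>P\<close> is graded.\<close>

lemma P_subset_irrelevant: "P \<subseteq> irrelevant n"
proof
  fix f assume f: "f \<in> P"
  have fp: "f \<in> polys n" by (rule poly_idealD(1)[OF P_ideal f])
  have "homogeneous_component 0 f \<in> P \<inter> forms n 0"
    using graded_idealD(2)[OF P_graded f] homogeneous_component_forms[OF fp] by blast
  then have "homogeneous_component 0 f = 0"
    using proper_ideal_Int_forms_0[OF P_ideal P_proper] by blast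
  then have "coef (homogeneous_component 0 f) 0 = 0" by simp
  then show "f \<in> irrelevant n" using fp by (simp add: irrelevant_def)
qed

lemma poly_ideal_irrelevant: "poly_ideal n (irrelevant n :: 'k mpoly set)"
proof -
  have "coef (s * f) 0 = 0" if "f \<in> irrelevant n" "s \<in> polys n" for s f :: "'k mpoly"
  proof (rule ccontr)
    assume "coef (s * f) 0 \<noteq> 0"
    then have "0 \<in> supp (s * f)" by (simp add: in_keys_iff)
    then obtain a b where ab: "a \<in> supp s" "b \<in> supp f" "0 = a + b"
      using Poly_Mapping.keys_mult[of s f] by blast
    have "monom_degree a + monom_degree b = 0" unfolding monom_degree_add[symmetric] ab(3)[symmetric] by simp
    then have "b = 0" by (simp add: monom_degree_eq_0_iff)
    then show False using ab(2) that(1) by (simp add: irrelevant_def in_keys_iff)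
  qed
  then show ?thesis by (auto simp: poly_ideal_def irrelevant_def lookup_add)
qed

lemma irrelevant_ideal_eq: "irrelevant_ideal n P = cls ` irrelevant n"
proof
  interpret S: cring "poly_ring n :: 'k mpoly ring" by (rule cring_poly_ring)
  interpret A: cring A by (rule cring_A)
  let ?G = "(\<lambda>i. cls (var i)) ` {..n}"
  have vp: "(var i :: 'k mpoly) \<in> polys n" if "i \<le> n" for i by (rule forms_polys[OF var_forms[OF that]])
  have G: "?G \<subseteq> carrier A" unfolding carrier_A using vp by auto
  have I: "ideal (cls ` irrelevant n) A"
    by (rule S.ring_ideal_imp_quot_ideal[OF P_ring_ideal])
      (simp add: ideal_iff_poly_ideal poly_ideal_irrelevant)
  show "irrelevant_ideal n P \<subseteq> cls ` irrelevant n"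
    unfolding irrelevant_ideal_def
  proof (rule A.genideal_minimal[OF I])
    show "?G \<subseteq> cls ` irrelevant n"
    proof
      fix x assume "x \<in> ?G"
      then obtain i where i: "i \<le> n" "x = cls (var i)" by blast
      have "(var i :: 'k mpoly) \<in> irrelevant n"
        by (rule forms_irrelevant[OF _ var_forms[OF i(1)]]) simp
      then show "x \<in> cls ` irrelevant n" unfolding i(2) by (rule imageI)
    qed
  qed
  let ?B = "{f \<in> polys n. cls f \<in> Idl\<^bsub>A\<^esub> ?G}"
  have "ideal ?B (poly_ring n)"
    by (rule ring_hom_ring.ideal_vimage[OF ideal.rcos_ring_hom_ring[OF P_ring_ideal] A.genideal_ideal[OF G]])
  then have B: "poly_ideal n ?B" by (simp add: ideal_iff_poly_ideal)
  show "cls ` irrelevant n \<subseteq> irrelevant_ideal n P"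
  proof
    fix x assume "x \<in> cls ` irrelevant n"
    then obtain f where f: "f \<in> irrelevant n" "x = cls f" by blast
    have "f * 1 \<in> ?B"
    proof (rule irrelevant_mult_mem[OF B polys_closed(2) _ f(1)])
      fix i assume i: "i \<le> n"
      then have "cls (var i) \<in> Idl\<^bsub>A\<^esub> ?G" using A.genideal_self[OF G] by blast
      then show "var i * 1 \<in> ?B" using vp[OF i] by simp
    qed
    then show "x \<in> irrelevant_ideal n P" unfolding irrelevant_ideal_def f(2) by simp
  qed
qed

lemma ideal_irrelevant_ideal: "ideal (irrelevant_ideal n P) A"
  unfolding irrelevant_ideal_eq
  by (rule ring.ring_ideal_imp_quot_ideal[OF cring.axioms(1)[OF cring_poly_ring] P_ring_ideal])
    (simp add: ideal_iff_poly_ideal poly_ideal_irrelevant)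

lemma one_notin_irrelevant_ideal: "irrelevant_ideal n P \<noteq> carrier A"
proof
  assume "irrelevant_ideal n P = carrier A"
  then have "cls 1 \<in> cls ` irrelevant n" unfolding irrelevant_ideal_eq carrier_A by blast
  then obtain h where h: "h \<in> irrelevant n" "cls 1 = cls h" by blast
  then have "1 - h \<in> P" using cls_eq_iff[of 1 h] by (simp add: irrelevant_def)
  then have "1 - h \<in> irrelevant n" using P_subset_irrelevant by blast
  then show False using h(1) by (simp add: irrelevant_def lookup_minus)
qed

text \<open>Both forms are in the irrelevant ideal, so the ideal generated by them is proper.\<close>

lemma regular_sequence_cls_iff:
  assumes f: "f \<in> irrelevant n" and g: "g \<in> irrelevant n"
  shows "regular_sequence A [cls f, cls g] \<longleftrightarrow> regular_pair n P f g"
proof -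
  interpret A: cring A by (rule cring_A)
  have fp: "f \<in> polys n" and gp: "g \<in> polys n" using f g by (auto simp: irrelevant_def)
  have fc: "cls f \<in> carrier A" and gc: "cls g \<in> carrier A" unfolding carrier_A using fp gp by auto
  have "Idl\<^bsub>A\<^esub> {cls f, cls g} \<subseteq> irrelevant_ideal n P"
    by (rule A.genideal_minimal[OF ideal_irrelevant_ideal]) (use f g in \<open>auto simp: irrelevant_ideal_eq\<close>)
  moreover have "irrelevant_ideal n P \<subseteq> carrier A"
    by (rule additive_subgroup.a_subset[OF ideal.axioms(1)[OF ideal_irrelevant_ideal]])
  ultimately have ne: "Idl\<^bsub>A\<^esub> {cls f, cls g} \<noteq> carrier A" using one_notin_irrelevant_ideal by blast
  have "(\<forall>y\<in>carrier A. cls f \<otimes>\<^bsub>A\<^esub> y = \<zero>\<^bsub>A\<^esub> \<longrightarrow> y = \<zero>\<^bsub>A\<^esub>) \<longleftrightarrow> colon n P f \<subseteq> P"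
    unfolding carrier_A using fp
    by (auto simp: cls_mult cls_eq_zero_iff colon_def mult.commute)
  moreover have "(\<forall>y\<in>carrier A. cls g \<otimes>\<^bsub>A\<^esub> y \<in> Idl\<^bsub>A\<^esub> {cls f} \<longrightarrow> y \<in> Idl\<^bsub>A\<^esub> {cls f})
      \<longleftrightarrow> colon n (ideal_adjoin n P f) g \<subseteq> ideal_adjoin n P f"
    unfolding carrier_A using fp gp
    by (auto simp: cls_mult cls_mem_Idl_iff colon_def mult.commute)
  moreover have "colon n P f \<subseteq> P \<longleftrightarrow> colon n P f = P"
    using colon_superset[OF P_ideal fp] by blast
  moreover have "colon n (ideal_adjoin n P f) g \<subseteq> ideal_adjoin n P f \<longleftrightarrow>
      colon n (ideal_adjoin n P f) g = ideal_adjoin n P f"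
    using colon_superset[OF poly_ideal_adjoin[OF P_ideal fp] gp] by blast
  ultimately show ?thesis
    unfolding A.regular_sequence_pair_iff[OF fc gc] regular_pair_def using ne by simp
qed

lemma depth_ge_2_if_regular_pair:
  assumes f: "f \<in> irrelevant n" and g: "g \<in> irrelevant n" and "regular_pair n P f g"
  shows "2 \<le> ring_depth A (irrelevant_ideal n P)"
proof -
  have "regular_sequence A [cls f, cls g]" using assms by (simp add: regular_sequence_cls_iff)
  moreover have "set [cls f, cls g] \<subseteq> irrelevant_ideal n P" using f g by (auto simp: irrelevant_ideal_eq)
  ultimately have "enat (length [cls f, cls g]) \<in>
      {enat (length rs) | rs. set rs \<subseteq> irrelevant_ideal n P \<and> regular_sequence A rs}" by blast
  then have "enat (length [cls f, cls g]) \<le> ring_depth A (irrelevant_ideal n P)"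
    unfolding ring_depth_def by (rule Sup_upper)
  then show ?thesis by (simp add: numeral_eq_enat numeral_2_eq_2)
qed

lemma regular_elements_if_depth_ge_2:
  assumes "2 \<le> ring_depth A (irrelevant_ideal n P)"
  shows "\<exists>r1\<in>irrelevant n. \<exists>r2\<in>irrelevant n. colon n P r1 \<subseteq> P \<and>
    colon n (ideal_adjoin n P r1) r2 \<subseteq> ideal_adjoin n P r1"
proof -
  interpret A: cring A by (rule cring_A)
  have "\<exists>rs. set rs \<subseteq> irrelevant_ideal n P \<and> regular_sequence A rs \<and> 2 \<le> length rs"
  proof (rule ccontr)
    assume "\<not> ?thesis"
    then have "ring_depth A (irrelevant_ideal n P) \<le> enat 1"
      unfolding ring_depth_def by (intro Sup_least) auto
    then have "(2 :: enat) \<le> enat 1" using assms by (rule order_trans[rotated])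
    then show False by (simp add: numeral_eq_enat)
  qed
  then obtain rs where rs: "set rs \<subseteq> irrelevant_ideal n P" "regular_sequence A rs" "2 \<le> length rs"
    by blast
  then obtain x1 x2 xs where xs: "rs = x1 # x2 # xs"
    by (cases rs; cases "tl rs") auto
  then have "x1 \<in> cls ` irrelevant n" "x2 \<in> cls ` irrelevant n"
    using rs(1) unfolding irrelevant_ideal_eq by auto
  then obtain r1 r2 where r: "r1 \<in> irrelevant n" "x1 = cls r1" "r2 \<in> irrelevant n" "x2 = cls r2" by blast
  note reg = A.regular_sequence_first_two[OF rs(2)[unfolded xs r(2,4)]]
  have p: "r1 \<in> polys n" "r2 \<in> polys n" using r by (auto simp: irrelevant_def)
  have c: "cls u \<in> carrier A" if "u \<in> polys n" for u unfolding carrier_A using that by blast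
  have "colon n P r1 \<subseteq> P"
  proof
    fix u assume "u \<in> colon n P r1"
    then have u: "u \<in> polys n" "r1 * u \<in> P" by (auto simp: colon_def mult.commute)
    have "cls r1 \<otimes>\<^bsub>A\<^esub> cls u = \<zero>\<^bsub>A\<^esub>"
      using u p by (simp add: cls_mult cls_eq_zero_iff)
    then show "u \<in> P" using reg(3)[OF c[OF u(1)]] cls_eq_zero_iff[OF u(1)] by simp
  qed
  moreover have "colon n (ideal_adjoin n P r1) r2 \<subseteq> ideal_adjoin n P r1"
  proof
    fix u assume "u \<in> colon n (ideal_adjoin n P r1) r2"
    then have u: "u \<in> polys n" "r2 * u \<in> ideal_adjoin n P r1" by (auto simp: colon_def mult.commute)
    have "cls r2 \<otimes>\<^bsub>A\<^esub> cls u \<in> Idl\<^bsub>A\<^esub> {cls r1}"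
      using u p by (simp add: cls_mult cls_mem_Idl_iff)
    then show "u \<in> ideal_adjoin n P r1"
      using reg(4)[OF c[OF u(1)]] cls_mem_Idl_iff[OF u(1) p(1)] by simp
  qed
  ultimately show ?thesis using r by blast
qed

end

lemma prime_graded_if_primeideal:
  assumes "primeideal P (poly_ring n)" "homogeneous_ideal n P"
  shows "prime_graded n P"
proof -
  interpret primeideal P "poly_ring n" by (rule assms(1))
  show ?thesis
    unfolding prime_graded_def using assms(2) I_notcarr I_prime by (auto simp: homogeneous_ideal_iff)
qed

lemma form_at_append:
  assumes "a \<in> carrier_vec N" "b \<in> carrier_vec N"
  shows "form_at 0 N M (a @\<^sub>v b) = form_of N M a" "form_at N N M (a @\<^sub>v b) = form_of N M b"
  unfolding form_at_def form_of_def by (rule sum.cong; use assms in simp)+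

lemma form_at_surj:
  fixes f g :: "'k::field mpoly"
  assumes M: "bij_betw M {..<N} (monomials_of_degree n d)" and f: "f \<in> forms n d" and g: "g \<in> forms n d"
  shows "\<exists>a\<in>carrier_vec N. \<exists>b\<in>carrier_vec N. form_of N M a = f \<and> form_of N M b = g"
proof -
  have "form_of N M (vec N (\<lambda>i. coef h (M i))) = h" if h: "h \<in> forms n d" for h :: "'k mpoly"
  proof -
    have "form_of N M (vec N (\<lambda>i. coef h (M i))) = (\<Sum>i<N. Poly_Mapping.single (M i) (coef h (M i)))"
      unfolding form_of_def by (rule sum.cong) auto
    also have "\<dots> = (\<Sum>m\<in>monomials_of_degree n d. Poly_Mapping.single m (coef h m))"
      by (rule sum.reindex_bij_betw[OF M])
    also have "\<dots> = h"
      by (rule poly_mapping_eq_sum_single[symmetric]) (use h in \<open>auto simp: forms_def finite_monomials_of_degree\<close>)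
    finally show ?thesis .
  qed
  then show ?thesis using f g by (metis vec_carrier)
qed

text \<open>With \<open>Z v\<close> saying that the two halves of \<open>v\<close> give a regular pair, \<open>G\<^sub>2\<close> is the set of all points that
  have a representative satisfying \<open>Z\<close>.\<close>

theorem proposition2p4:
  fixes \<pp> :: "'k::field mpoly set"
    and n d N :: nat
    and M :: "nat \<Rightarrow> monom"
  assumes "primeideal \<pp> (poly_ring n)"
    and "homogeneous_ideal n \<pp>"
    and "d > 0"
    and "N = (n + d) choose d"
    and "bij_betw M {..<N} (monomials_of_degree n d)"
  shows "zariski_open (2 * N - 1) (G2 n N M \<pp>) \<and>
    (G2 n N M \<pp> \<noteq> {} \<longrightarrow> ring_depth (poly_ring n Quot \<pp>) (irrelevant_ideal n \<pp>) \<ge> 2) \<and>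
    (infinite (UNIV :: 'k set) \<longrightarrow>
       ring_depth (poly_ring n Quot \<pp>) (irrelevant_ideal n \<pp>) \<ge> 2 \<longrightarrow> G2 n N M \<pp> \<noteq> {})"
proof -
  have prime: "prime_graded n \<pp>" by (rule prime_graded_if_primeideal[OF assms(1,2)])
  interpret prime_quotient n \<pp> by unfold_locales (rule prime)
  have "N > 0" using assms(4) by simp
  then have r: "2 * N - 1 + 1 = N + N" by simp
  have M: "M i \<in> monomials_of_degree n d" if "i < N" for i
    using assms(5) that by (auto simp: bij_betw_def)
  let ?Z = "\<lambda>v. regular_pair n \<pp> (form_at 0 N M v) (form_at N N M v)"
  have irr: "form_at s N M v \<in> irrelevant n" for s and v :: "'k vec"
    by (rule forms_irrelevant[OF assms(3) form_at_forms[OF M]])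
  have Z: "regular_sequence A [cls (form_of N M a), cls (form_of N M b)] \<longleftrightarrow> ?Z (a @\<^sub>v b)"
    if "a \<in> carrier_vec N" "b \<in> carrier_vec N" for a b
    unfolding form_at_append[OF that, symmetric] by (rule regular_sequence_cls_iff[OF irr irr])
  have Qc: "v \<in> carrier_vec (N + N)" if "Q \<in> proj_space (2 * N - 1)" "v \<in> Q" for Q and v :: "'k vec"
    using that unfolding proj_space_def quotient_def r by auto
  have G2: "G2 n N M \<pp> = {Q \<in> proj_space (2 * N - 1). \<exists>v\<in>Q. ?Z v}"
  proof (intro equalityI subsetI)
    fix Q assume "Q \<in> G2 n N M \<pp>"
    then show "Q \<in> {Q \<in> proj_space (2 * N - 1). \<exists>v\<in>Q. ?Z v}" unfolding G2_def using Z by blast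
  next
    fix Q assume "Q \<in> {Q \<in> proj_space (2 * N - 1). \<exists>v\<in>Q. ?Z v}"
    then obtain v where v: "Q \<in> proj_space (2 * N - 1)" "v \<in> Q" "?Z v" by blast
    have "vec_first v N @\<^sub>v vec_last v N = v" using Qc[OF v(1,2)] by simp
    then show "Q \<in> G2 n N M \<pp>"
      unfolding G2_def using v Z[of "vec_first v N" "vec_last v N"]
      by (intro CollectI conjI bexI[of _ "vec_first v N"] bexI[of _ "vec_last v N"]) auto
  qed
  have "zariski_open (2 * N - 1) (G2 n N M \<pp>)"
    by (rule zariski_openI[OF G2 regular_pair_open_near[OF prime M _ assms(3)]])
      (use \<open>N > 0\<close> in auto)
  moreover have "ring_depth A (irrelevant_ideal n \<pp>) \<ge> 2" if "G2 n N M \<pp> \<noteq> {}"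
    using that depth_ge_2_if_regular_pair[OF irr irr] unfolding G2 by blast
  moreover have "G2 n N M \<pp> \<noteq> {}"
    if k: "infinite (UNIV :: 'k set)" and depth: "ring_depth A (irrelevant_ideal n \<pp>) \<ge> 2"
  proof -
    obtain f g where fg: "f \<in> forms n d" "g \<in> forms n d" "regular_pair n \<pp> f g"
      using regular_elements_if_depth_ge_2[OF depth] exists_regular_pair[OF k prime] by blast
    obtain a b where ab: "a \<in> carrier_vec N" "b \<in> carrier_vec N" "form_of N M a = f" "form_of N M b = g"
      using form_at_surj[OF assms(5) fg(1,2)] by blast
    let ?v = "a @\<^sub>v b"
    have Zv: "?Z ?v" using fg(3) ab(3,4) by (simp add: form_at_append[OF ab(1,2)])
    have "?v \<noteq> 0\<^sub>v (N + N)"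
    proof
      assume v0: "?v = 0\<^sub>v (N + N)"
      have "form_at 0 N M ?v = 0" unfolding v0 form_at_def by simp
      then have "\<pp> = polys n"
        using Zv poly_idealD(2)[OF P_ideal] by (auto simp: regular_pair_def colon_def)
      then show False using P_proper by simp
    qed
    then have v: "?v \<in> carrier_vec (2 * N - 1 + 1) - {0\<^sub>v (2 * N - 1 + 1)}"
      using ab(1,2) unfolding r by simp
    define Q where "Q = {(u, v). u \<in> carrier_vec (2 * N - 1 + 1) - {0\<^sub>v (2 * N - 1 + 1)} \<and>
      (\<exists>c. c \<noteq> 0 \<and> v = c \<cdot>\<^sub>v u)} `` {?v}"
    have "Q \<in> proj_space (2 * N - 1)" unfolding Q_def proj_space_def by (rule quotientI[OF v])
    moreover have "?v \<in> Q" unfolding Q_def using v by (auto intro!: exI[of _ 1])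
    ultimately show ?thesis unfolding G2 using Zv by blast
  qed
  ultimately show ?thesis by blast
qed

end
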